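(* Let $X$ be a smooth projective split toric variety over $\mathbb{Q}$ with $-K_X$ globally generated, $r=\operatorname{rank}\operatorname{Pic}(X)$, $n=\#\Delta(1)$. Let $f,g\in\mathbb{Z}[x_\rho:\rho\in\Delta(1)]$ be coprime, i.e. the subscheme $f=g=0$ has codimension $2$ in $\mathbb{A}^n_\mathbb{Q}$. Then uniformly for $N\ge2$, $$\#\{\mathbf{X}\in\mathcal{A}(B):\exists\text{ prime }p\ge N,\ p\mid\gcd(f(\mathbf{X}),g(\mathbf{X}))\}\ll_{f,g}\frac{B(\log B)^{r-1}}{N\log N}+B(\log B)^{r-2}\log\log B.$$
   Context: $X$ is defined by a complete regular fan $\Delta$ in $N_\mathbb{R}$ ($M$ the dual lattice); $\Delta(1)$ is the set of rays with primitive generators $n_\rho$, $\Delta_{\max}$ the maximal cones. For $\sigma\in\Delta_{\max}$, $m_\sigma\in M$ is the unique element with $\langle m_\sigma,n_\rho\rangle=1$ for all rays $\rho$ of $\sigma$, and $a_\rho(\sigma)=1-\langle m_\sigma,n_\rho\rangle\ge0$. For $\mathbf{X}=(X_\rho)$ with positive entries, $\mathbf{X}^{D_0(\sigma)}=\prod_\rho X_\rho^{a_\rho(\sigma)}$, and $\mathcal{A}(B)=\{\mathbf{X}\in\mathbb{Z}_{\ge1}^{\Delta(1)}:\max_{\sigma\in\Delta_{\max}}\mathbf{X}^{D_0(\sigma)}\le B\}$. *)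

theory Defs
  imports "HOL-Analysis.Analysis" "HOL-Library.Poly_Mapping"
begin

text \<open>Lattice N = Z^d with d = CARD('n); vectors are int^'n, M is identified with Z^d via
  the standard pairing.  A (simplicial) fan is given by its set of maximal cones, each maximal
  cone being the finite set of primitive generators of its rays.\<close>

definition pair :: "int^'n \<Rightarrow> int^'n \<Rightarrow> int" where
  "pair m v = (\<Sum>i\<in>UNIV. m$i * v$i)"

definition rvec :: "int^'n \<Rightarrow> real^'n" where
  "rvec v = (\<chi> i. real_of_int (v$i))"

definition cone :: "(int^'n) set \<Rightarrow> (real^'n) set" where
  "cone S = {x. \<exists>c. (\<forall>v\<in>S. c v \<ge> (0::real)) \<and> x = (\<Sum>v\<in>S. c v *\<^sub>R rvec v)}"

definition fan_rays :: "(int^'n) set set \<Rightarrow> (int^'n) set" where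
  "fan_rays Fan = \<Union> Fan"

definition complete_regular_fan :: "(int^'n) set set \<Rightarrow> bool" where
  "complete_regular_fan Fan \<longleftrightarrow>
     finite Fan \<and> Fan \<noteq> {} \<and>
     (\<forall>\<sigma>\<in>Fan. finite \<sigma> \<and> card \<sigma> = CARD('n) \<and>
        (\<forall>v::int^'n. \<exists>c::int^'n \<Rightarrow> int. v = (\<Sum>u\<in>\<sigma>. c u *s u))) \<and>
     (\<forall>\<sigma>\<in>Fan. \<forall>\<tau>\<in>Fan. cone \<sigma> \<inter> cone \<tau> = cone (\<sigma> \<inter> \<tau>)) \<and>
     (\<Union>\<sigma>\<in>Fan. cone \<sigma>) = UNIV"

text \<open>Projectivity of X: existence of a strictly convex (ample) support function.\<close>
definition projective_fan :: "(int^'n) set set \<Rightarrow> bool" where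
  "projective_fan Fan \<longleftrightarrow>
     (\<exists>(c::int^'n \<Rightarrow> int) (m::(int^'n) set \<Rightarrow> int^'n).
        \<forall>\<sigma>\<in>Fan. \<forall>\<rho>\<in>fan_rays Fan.
          (\<rho> \<in> \<sigma> \<longrightarrow> pair (m \<sigma>) \<rho> = c \<rho>) \<and> (\<rho> \<notin> \<sigma> \<longrightarrow> pair (m \<sigma>) \<rho> < c \<rho>))"

definition m_sigma :: "(int^'n) set \<Rightarrow> int^'n" where
  "m_sigma \<sigma> = (THE m. \<forall>\<rho>\<in>\<sigma>. pair m \<rho> = 1)"

definition a_coef :: "int^'n \<Rightarrow> (int^'n) set \<Rightarrow> int" where
  "a_coef \<rho> \<sigma> = 1 - pair (m_sigma \<sigma>) \<rho>"

text \<open>rank Pic(X) = #Delta(1) - dim N for a smooth complete toric variety.\<close>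
definition pic_rank :: "(int^'n) set set \<Rightarrow> nat" where
  "pic_rank Fan = card (fan_rays Fan) - CARD('n)"

definition heightD0 :: "(int^'n) set set \<Rightarrow> (int^'n \<Rightarrow> nat) \<Rightarrow> (int^'n) set \<Rightarrow> nat" where
  "heightD0 Fan X \<sigma> = (\<Prod>\<rho>\<in>fan_rays Fan. X \<rho> ^ nat (a_coef \<rho> \<sigma>))"

definition count_set :: "(int^'n) set set \<Rightarrow> real \<Rightarrow> (int^'n \<Rightarrow> nat) set" where
  "count_set Fan B = {X. X \<in> fan_rays Fan \<rightarrow>\<^sub>E {1..} \<and>
                        (\<forall>\<sigma>\<in>Fan. real (heightD0 Fan X \<sigma>) \<le> B)}"

type_synonym ('v, 'a) mpoly = "('v \<Rightarrow>\<^sub>0 nat) \<Rightarrow>\<^sub>0 'a"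

definition mvars :: "('v, 'a::zero) mpoly \<Rightarrow> 'v set" where
  "mvars p = (\<Union>mon\<in>Poly_Mapping.keys p. Poly_Mapping.keys mon)"

definition meval :: "('v, 'a::comm_semiring_1) mpoly \<Rightarrow> ('v \<Rightarrow> 'a) \<Rightarrow> 'a" where
  "meval p x = (\<Sum>mon\<in>Poly_Mapping.keys p.
      Poly_Mapping.lookup p mon * (\<Prod>v\<in>Poly_Mapping.keys mon. x v ^ Poly_Mapping.lookup mon v))"

definition to_rat_poly :: "('v, int) mpoly \<Rightarrow> ('v, rat) mpoly" where
  "to_rat_poly p = Poly_Mapping.map rat_of_int p"

text \<open>f, g coprime in Q[x]: every common divisor is a unit (equivalently V(f,g) has codim 2).\<close>
definition coprime_Q :: "('v, int) mpoly \<Rightarrow> ('v, int) mpoly \<Rightarrow> bool" where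
  "coprime_Q f g \<longleftrightarrow> (\<forall>h::('v, rat) mpoly. h dvd to_rat_poly f \<and> h dvd to_rat_poly g \<longrightarrow> h dvd 1)"

end

theory Submission
  imports Defs "HOL-Computational_Algebra.Polynomial" "HOL-Computational_Algebra.Primes"
begin

text \<open>Cut the region into dyadic boxes. In a box whose sides are all at least \<open>2 ^ T\<close>, with
  \<open>2 ^ T\<close> about \<open>(ln B)\<^sup>2\<close>, Ekedahl's sieve bounds the bad points: for primes \<open>p \<le> 2 ^ T\<close> a
  proportion \<open>O(1 / p\<^sup>2)\<close> of the box lies on \<open>f = g = 0\<close> modulo \<open>p\<close>, while a larger \<open>p\<close> must
  divide a nonzero eliminant \<open>R\<close> in fewer variables and is one of \<open>O(ln B)\<close> primes. The sieve
  runs by induction on the variables for finite families of polynomials without common factor;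
  eliminants exist by Gauss' lemma, for which \<open>\<int>[x\<^sub>1, ..., x\<^sub>n]\<close> is realised inside the reals by
  algebraically independent numbers.

  To sum the volumes \<open>2 ^ \<bar>k\<bar>\<close>, write \<open>- (\<Sum>\<rho>. k\<^sub>\<rho> n\<^sub>\<rho>)\<close> as a nonnegative combination \<open>c\<close> of the
  generators of a cone \<open>\<sigma>\<close>. Then \<open>K = k + c\<close> is a relation between the rays and \<open>\<bar>K\<bar>\<close> is
  the exponent \<open>D\<^sub>0(\<sigma>)(k)\<close>, hence at most \<open>log 2 B\<close>; there are at most \<open>(S + 1) ^ (r - 1)\<close>
  relations of size \<open>S\<close>, and the weights \<open>2 ^ - \<bar>c\<bar>\<close> have bounded sum. Bounding one coordinate
  by \<open>T\<close> saves a factor \<open>ln B / T\<close>.\<close>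

section \<open>Unique factorization in subrings, and the lemma of Gauss\<close>

text \<open>Eliminating a variable turns two polynomials into the family of their coefficients, so
  the induction must run over finite families. The coefficient ring also changes at each stage:
  rings are therefore subsets of one type, and evaluation at a transcendental number brings
  \<open>S[X]\<close> back into the type of \<open>S\<close>. The threshold is a balance. Primes
  above \<open>2 ^ T\<close> contribute a proportion \<open>ln B / 2 ^ T\<close> of a total volume
  \<open>B (ln B) ^ (r - 1)\<close>, so \<open>(ln B)\<^sup>2 \<le> 2 ^ T\<close> pushes them down
  to \<open>B (ln B) ^ (r - 2)\<close>. The price is that strips of width \<open>T\<close>, of order
  \<open>ln (ln B)\<close>, are counted trivially; this is where the double logarithm comes from.
  The factor \<open>1 / (N ln N)\<close> is the tail of \<open>1 / p\<^sup>2\<close> over primes, by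
  Chebyshev's bound. Global generation of the anticanonical class, in the form
  \<open>a_coef \<ge> 0\<close>, makes the heights monotone in each coordinate, so a box that meets
  the region has its lower corner in it.\<close>

definition is_subring :: "'a::comm_ring_1 set \<Rightarrow> bool" where
  "is_subring S \<longleftrightarrow> 1 \<in> S \<and> (\<forall>a\<in>S. \<forall>b\<in>S. a - b \<in> S \<and> a * b \<in> S)"

lemma is_subring_closed:
  assumes "is_subring S"
  shows subring_one: "1 \<in> S" and subring_zero: "0 \<in> S"
    and subring_diff: "a \<in> S \<Longrightarrow> b \<in> S \<Longrightarrow> a - b \<in> S"
    and subring_mult: "a \<in> S \<Longrightarrow> b \<in> S \<Longrightarrow> a * b \<in> S"
    and subring_uminus: "a \<in> S \<Longrightarrow> - a \<in> S"
    and subring_add: "a \<in> S \<Longrightarrow> b \<in> S \<Longrightarrow> a + b \<in> S"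
proof -
  show 1: "1 \<in> S" using assms by (auto simp: is_subring_def)
  have d: "a - b \<in> S" if "a \<in> S" "b \<in> S" for a b using assms that by (auto simp: is_subring_def)
  show 0: "0 \<in> S" using d[OF 1 1] by simp
  have u: "- a \<in> S" if "a \<in> S" for a using d[OF 0 that] by simp
  show "a \<in> S \<Longrightarrow> b \<in> S \<Longrightarrow> a - b \<in> S" by (rule d)
  show "a \<in> S \<Longrightarrow> - a \<in> S" by (rule u)
  show "a \<in> S \<Longrightarrow> b \<in> S \<Longrightarrow> a * b \<in> S" using assms by (auto simp: is_subring_def)
  show "a \<in> S \<Longrightarrow> b \<in> S \<Longrightarrow> a + b \<in> S" using d[of a "- b"] u[of b] by simp
qed

lemma subring_sum:
  assumes "is_subring S" "\<And>i. i \<in> I \<Longrightarrow> f i \<in> S" shows "sum f I \<in> S"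
  using assms(2) by (induction I rule: infinite_finite_induct)
    (auto intro: subring_zero[OF assms(1)] subring_add[OF assms(1)])

lemma subring_prod:
  assumes "is_subring S" "\<And>i. i \<in> I \<Longrightarrow> f i \<in> S" shows "prod f I \<in> S"
  using assms(2) by (induction I rule: infinite_finite_induct)
    (auto intro: subring_one[OF assms(1)] subring_mult[OF assms(1)])

lemma subring_power:
  assumes "is_subring S" "a \<in> S" shows "a ^ n \<in> S"
  by (induction n) (auto intro: subring_one[OF assms(1)] subring_mult[OF assms(1)] assms(2))

lemma subring_of_int:
  assumes "is_subring S" shows "of_int k \<in> S"
proof -
  have n: "of_nat m \<in> S" for m
    by (induction m) (auto intro: subring_zero[OF assms] subring_one[OF assms] subring_add[OF assms])
  show ?thesis
    using n[of "nat k"] subring_uminus[OF assms n[of "nat (- k)"]]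
    by (cases "k \<ge> 0") (auto simp flip: of_nat_nat[of k, simplified])
qed

section \<open>Polynomials with coefficients in a subring\<close>

definition polys_over :: "'a::comm_ring_1 set \<Rightarrow> 'a poly set" where
  "polys_over S = {q. \<forall>i. coeff q i \<in> S}"

lemma is_subring_polys_over:
  assumes "is_subring S" shows "is_subring (polys_over S)"
  unfolding is_subring_def polys_over_def
  by (auto simp: coeff_mult coeff_1 intro!: subring_sum[OF assms] is_subring_closed[OF assms])

lemma polys_overD: "q \<in> polys_over S \<Longrightarrow> coeff q i \<in> S"
  by (simp add: polys_over_def)

lemma const_polys_over: "is_subring S \<Longrightarrow> c \<in> S \<Longrightarrow> [:c:] \<in> polys_over S"
  by (auto simp: polys_over_def coeff_pCons subring_zero split: nat.split)

lemma smult_polys_over: "is_subring S \<Longrightarrow> c \<in> S \<Longrightarrow> q \<in> polys_over S \<Longrightarrow> smult c q \<in> polys_over S"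
  by (auto simp: polys_over_def intro: subring_mult)

lemma monom_polys_over: "is_subring S \<Longrightarrow> c \<in> S \<Longrightarrow> monom c n \<in> polys_over S"
  by (auto simp: polys_over_def subring_zero)

section \<open>Divisibility and prime factorisation in a subring\<close>

definition dvd_in :: "'a::comm_ring_1 set \<Rightarrow> 'a \<Rightarrow> 'a \<Rightarrow> bool" where
  "dvd_in S a b \<longleftrightarrow> (\<exists>k\<in>S. b = a * k)"

definition unit_in :: "'a::comm_ring_1 set \<Rightarrow> 'a \<Rightarrow> bool" where
  "unit_in S u \<longleftrightarrow> u \<in> S \<and> (\<exists>w\<in>S. u * w = 1)"

definition prime_in :: "'a::comm_ring_1 set \<Rightarrow> 'a \<Rightarrow> bool" where
  "prime_in S p \<longleftrightarrow> p \<in> S \<and> p \<noteq> 0 \<and> \<not> unit_in S p \<and>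
     (\<forall>a\<in>S. \<forall>b\<in>S. dvd_in S p (a * b) \<longrightarrow> dvd_in S p a \<or> dvd_in S p b)"

text \<open>The index counts the prime factors; it is the measure for descents that cancel a
  prime.\<close>

inductive prime_fact :: "'a::comm_ring_1 set \<Rightarrow> nat \<Rightarrow> 'a \<Rightarrow> bool" for S where
  unit: "unit_in S u \<Longrightarrow> prime_fact S 0 u"
| step: "prime_in S p \<Longrightarrow> prime_fact S n a \<Longrightarrow> prime_fact S (Suc n) (p * a)"

text \<open>With prime rather than irreducible factors uniqueness is automatic, so only existence
  has to be carried from ring to ring.\<close>

definition ufd_in :: "'a::comm_ring_1 set \<Rightarrow> bool" where
  "ufd_in S \<longleftrightarrow> is_subring S \<and> (\<forall>a\<in>S. a \<noteq> 0 \<longrightarrow> (\<exists>n. prime_fact S n a))"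

lemma dvd_in_add:
  assumes S: "is_subring S" and "dvd_in S p a" "dvd_in S p b" shows "dvd_in S p (a + b)"
proof -
  obtain k l where "k \<in> S" "l \<in> S" "a = p * k" "b = p * l" using assms by (auto simp: dvd_in_def)
  then show ?thesis unfolding dvd_in_def
    by (intro bexI[of _ "k + l"] subring_add[OF S]) (simp_all add: algebra_simps)
qed

lemma dvd_in_diff:
  assumes S: "is_subring S" and "dvd_in S p a" "dvd_in S p b" shows "dvd_in S p (a - b)"
proof -
  obtain k l where "k \<in> S" "l \<in> S" "a = p * k" "b = p * l" using assms by (auto simp: dvd_in_def)
  then show ?thesis unfolding dvd_in_def
    by (intro bexI[of _ "k - l"] subring_diff[OF S]) (simp_all add: algebra_simps)
qed

lemma dvd_in_mult:
  assumes S: "is_subring S" and "dvd_in S p a" "b \<in> S" shows "dvd_in S p (a * b)"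
proof -
  obtain k where "k \<in> S" "a = p * k" using assms by (auto simp: dvd_in_def)
  then show ?thesis unfolding dvd_in_def using assms(3)
    by (intro bexI[of _ "k * b"] subring_mult[OF S]) (simp_all add: algebra_simps)
qed

lemma dvd_in_mult':
  assumes S: "is_subring S" and "dvd_in S p a" "b \<in> S" shows "dvd_in S p (b * a)"
  using dvd_in_mult[OF assms] by (simp add: mult.commute)

lemma dvd_in_sum:
  assumes "is_subring S" "\<And>i. i \<in> I \<Longrightarrow> dvd_in S p (f i)" shows "dvd_in S p (sum f I)"
  using assms(2)
proof (induction I rule: infinite_finite_induct)
  case empty
  show ?case using subring_zero[OF assms(1)] by (auto simp: dvd_in_def intro!: bexI[of _ 0])
next
  case (infinite A)
  show ?case using subring_zero[OF assms(1)] infinite(1) by (auto simp: dvd_in_def intro!: bexI[of _ 0])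
next
  case (insert x F)
  then show ?case by (auto intro: dvd_in_add[OF assms(1)])
qed

lemma unit_in_mult:
  assumes S: "is_subring S" and "unit_in S u" "unit_in S v" shows "unit_in S (u * v)"
proof -
  obtain w w' where w: "w \<in> S" "w' \<in> S" "u * w = 1" "v * w' = 1" and uv: "u \<in> S" "v \<in> S"
    using assms by (auto simp: unit_in_def)
  have "(u * v) * (w * w') = (u * w) * (v * w')" by (simp only: mult_ac)
  then have "(u * v) * (w * w') = 1" using w by simp
  then show ?thesis unfolding unit_in_def using w uv subring_mult[OF S] by blast
qed

lemma prime_fact_mem:
  fixes S :: "'a::idom set"
  assumes "is_subring S" "prime_fact S n a" shows "a \<in> S \<and> a \<noteq> 0"
  using assms(2) by induction (auto simp: unit_in_def prime_in_def intro: subring_mult[OF assms(1)])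

lemma prime_fact_unit_mult:
  assumes S: "is_subring S" and u: "unit_in S u" and "prime_fact S n a"
  shows "prime_fact S n (u * a)"
  using assms(3)
proof induction
  case (unit v) then show ?case by (intro prime_fact.unit unit_in_mult S u)
next
  case (step p n a)
  then show ?case using prime_fact.step[of S p n "u * a"] by (simp add: mult.left_commute)
qed

lemma prime_fact_mult:
  assumes S: "is_subring S" and a: "prime_fact S n a" and b: "prime_fact S m b"
  shows "prime_fact S (n + m) (a * b)"
  using a
proof induction
  case (unit v) then show ?case using prime_fact_unit_mult[OF S _ b] by simp
next
  case (step p n a)
  then show ?case using prime_fact.step[of S p "n + m" "a * b"] by (simp add: mult.assoc)
qed

text \<open>Since \<open>p\<close> divides \<open>q * w\<close>, it divides \<open>q\<close> or
  \<open>w\<close>. Cancelling \<open>p\<close> makes \<open>w\<close> a unit in the first case, and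
  in the second \<open>q\<close>, which is absurd.\<close>

lemma prime_in_associate:
  fixes S :: "'a::idom set"
  assumes S: "is_subring S" and p: "prime_in S p" and q: "prime_in S q" and w: "w \<in> S" "p = q * w"
  shows "unit_in S w"
proof -
  have p0: "p \<noteq> 0" using p by (simp add: prime_in_def)
  have "dvd_in S p q \<or> dvd_in S p w"
  proof -
    have "dvd_in S p (q * w)" unfolding dvd_in_def using w subring_one[OF S] by (intro bexI[of _ 1]) auto
    then show ?thesis using p q w(1) unfolding prime_in_def by blast
  qed
  then show ?thesis
  proof
    assume "dvd_in S p q"
    then obtain k where k: "k \<in> S" "q = p * k" by (auto simp: dvd_in_def)
    have "p * (w * k) = (p * k) * w" by (simp only: mult_ac)
    also have "\<dots> = p * 1" by (simp only: k(2)[symmetric] w(2)[symmetric] mult_1_right)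
    finally have "w * k = 1" using mult_left_cancel[OF p0, of "w * k" 1] by blast
    then show ?thesis using w(1) k(1) unfolding unit_in_def by blast
  next
    assume "dvd_in S p w"
    then obtain k where k: "k \<in> S" "w = p * k" by (auto simp: dvd_in_def)
    have "p * (q * k) = q * (p * k)" by (simp only: mult_ac)
    also have "\<dots> = p * 1" by (simp only: k(2)[symmetric] w(2)[symmetric] mult_1_right)
    finally have "q * k = 1" using mult_left_cancel[OF p0, of "q * k" 1] by blast
    then show ?thesis using q k(1) unfolding unit_in_def prime_in_def by blast
  qed
qed

text \<open>The prime \<open>q\<close> is associated to the first factor, where the quotient is a
  unit to be absorbed, or it divides the remaining product and the induction applies.\<close>

lemma prime_fact_cancel:
  fixes S :: "'a::idom set"
  assumes S: "is_subring S" and "prime_fact S n a" and q: "prime_in S q" and "b \<in> S" "a = q * b"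
  shows "\<exists>m. n = Suc m \<and> prime_fact S m b"
  using assms(2,4,5)
proof (induction arbitrary: b)
  case (unit u)
  then obtain w where "w \<in> S" "u * w = 1" by (auto simp: unit_in_def)
  then have "unit_in S q" using unit q
    by (auto simp: unit_in_def prime_in_def mult.assoc intro!: bexI[of _ "b * w"] subring_mult[OF S])
  then show ?case using q by (simp add: prime_in_def)
next
  case (step p n a)
  have aS: "a \<in> S" using prime_fact_mem[OF S step(2)] by simp
  have pS: "p \<in> S" "p \<noteq> 0" using step(1) by (auto simp: prime_in_def)
  have q0: "q \<noteq> 0" "q \<in> S" using q by (auto simp: prime_in_def)
  have "dvd_in S q (p * a)" using step by (auto simp: dvd_in_def)
  then consider "dvd_in S q p" | "dvd_in S q a" using q aS pS by (auto simp: prime_in_def)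
  then show ?case
  proof cases
    case 1
    then obtain w where w: "w \<in> S" "p = q * w" by (auto simp: dvd_in_def)
    have "unit_in S w" by (rule prime_in_associate[OF S step(1) q w])
    moreover have "b = w * a" using step(5) w(2) q0 by (simp add: mult.assoc)
    ultimately show ?thesis using prime_fact_unit_mult[OF S _ step(2)] by auto
  next
    case 2
    then obtain w where w: "w \<in> S" "a = q * w" by (auto simp: dvd_in_def)
    obtain m where m: "n = Suc m" "prime_fact S m w" using step.IH[OF w] by blast
    have "b = p * w" using step(5) w(2) q0 by (simp add: mult.left_commute)
    then show ?thesis using prime_fact.step[OF step(1) m(2)] m(1) by auto
  qed
qed

section \<open>Gauss' lemma and the removal of constants\<close>

lemma dvd_in_const_iff:
  fixes S :: "'a::idom set"
  assumes S: "is_subring S" and q: "q \<in> polys_over S"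
  shows "dvd_in (polys_over S) [:c:] q \<longleftrightarrow> (\<forall>i. dvd_in S c (coeff q i))"
proof
  assume "dvd_in (polys_over S) [:c:] q"
  then show "\<forall>i. dvd_in S c (coeff q i)" by (auto simp: dvd_in_def polys_over_def)
next
  assume *: "\<forall>i. dvd_in S c (coeff q i)"
  then obtain k where k: "\<And>i. k i \<in> S" "\<And>i. coeff q i = c * k i"
    unfolding dvd_in_def by metis
  \<comment> \<open>If \<open>c = 0\<close> the chosen quotients \<open>k i\<close> beyond the
    degree are arbitrary, hence the truncation.\<close>
  define r where "r = Poly (map (\<lambda>i. k i) [0..<Suc (degree q)])"
  have cr: "coeff r i = (if i \<le> degree q then k i else 0)" for i
    unfolding r_def by (auto simp: coeff_Poly_eq nth_default_def simp del: upt_Suc)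
  have "q = [:c:] * r"
  proof (rule poly_eqI)
    fix i show "coeff q i = coeff ([:c:] * r) i"
      using k(2)[of i] by (auto simp: cr coeff_eq_0)
  qed
  moreover have "r \<in> polys_over S" using k(1) subring_zero[OF S] by (auto simp: polys_over_def cr)
  ultimately show "dvd_in (polys_over S) [:c:] q" by (auto simp: dvd_in_def)
qed

lemma prime_in_const:
  fixes S :: "'a::idom set"
  assumes S: "is_subring S" and p: "prime_in S p"
  shows "prime_in (polys_over S) [:p:]"
  unfolding prime_in_def
proof (intro conjI ballI impI)
  show "[:p:] \<in> polys_over S" using p S by (auto simp: prime_in_def const_polys_over)
  show "[:p:] \<noteq> 0" using p by (auto simp: prime_in_def)
  show "\<not> unit_in (polys_over S) [:p:]"
  proof
    assume "unit_in (polys_over S) [:p:]"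
    then obtain w where w: "w \<in> polys_over S" "smult p w = 1" by (auto simp: unit_in_def)
    have "p * coeff w 0 = 1" using arg_cong[OF w(2), of "\<lambda>q. coeff q 0"] by simp
    then show False using p polys_overD[OF w(1), of 0] by (auto simp: prime_in_def unit_in_def)
  qed
next
  fix a b assume a: "a \<in> polys_over S" and b: "b \<in> polys_over S"
    and d: "dvd_in (polys_over S) [:p:] (a * b)"
  show "dvd_in (polys_over S) [:p:] a \<or> dvd_in (polys_over S) [:p:] b"
  proof (rule ccontr)
    assume n: "\<not> ?thesis"
    \<comment> \<open>At the least indices where \<open>p\<close> fails to divide the coefficients
      of \<open>a\<close> and \<open>b\<close>, their product is the only term of
      \<open>coeff (a * b) (i + j)\<close> that \<open>p\<close> does not divide.\<close>
    define i where "i = (LEAST i. \<not> dvd_in S p (coeff a i))"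
    define j where "j = (LEAST j. \<not> dvd_in S p (coeff b j))"
    have i: "\<not> dvd_in S p (coeff a i)" unfolding i_def
      by (rule LeastI_ex) (use n dvd_in_const_iff[OF S a, of p] in auto)
    have j: "\<not> dvd_in S p (coeff b j)" unfolding j_def
      by (rule LeastI_ex) (use n dvd_in_const_iff[OF S b, of p] in auto)
    have i': "dvd_in S p (coeff a l)" if "l < i" for l using not_less_Least that unfolding i_def by blast
    have j': "dvd_in S p (coeff b l)" if "l < j" for l using not_less_Least that unfolding j_def by blast
    have 1: "dvd_in S p (coeff (a * b) (i + j))"
      using d dvd_in_const_iff[OF S subring_mult[OF is_subring_polys_over[OF S] a b], of p] by blast
    have 2: "dvd_in S p (\<Sum>l\<in>{..i + j} - {i}. coeff a l * coeff b (i + j - l))"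
    proof (rule dvd_in_sum[OF S])
      fix l assume l: "l \<in> {..i + j} - {i}"
      show "dvd_in S p (coeff a l * coeff b (i + j - l))"
      proof (cases "l < i")
        case True then show ?thesis by (intro dvd_in_mult S i' polys_overD[OF b])
      next
        case False then show ?thesis using l by (intro dvd_in_mult' S j' polys_overD[OF a]) auto
      qed
    qed
    have "coeff (a * b) (i + j) = coeff a i * coeff b j +
        (\<Sum>l\<in>{..i + j} - {i}. coeff a l * coeff b (i + j - l))"
      unfolding coeff_mult by (subst sum.remove[of _ i]) auto
    then have "dvd_in S p (coeff a i * coeff b j)" using dvd_in_diff[OF S 1 2] by simp
    then show False using i j p polys_overD[OF a, of i] polys_overD[OF b, of j] by (auto simp: prime_in_def)
  qed
qed

text \<open>Each prime factor of \<open>c\<close> divides \<open>q\<close> or \<open>d\<close> by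
  Gauss' lemma and can be cancelled there. This converts an identity up to a constant, as
  pseudo-division supplies it, into a genuine factorisation of \<open>f\<close>.\<close>

lemma clear_constant:
  fixes S :: "'a::idom set"
  assumes S: "is_subring S" and "prime_fact S n c"
    and "f \<in> polys_over S" "q \<in> polys_over S" "d \<in> polys_over S" "smult c f = q * d"
  shows "\<exists>q'\<in>polys_over S. \<exists>d'\<in>polys_over S. \<exists>e\<in>S. \<exists>e'\<in>S.
    e \<noteq> 0 \<and> e' \<noteq> 0 \<and> f = q' * d' \<and> d = smult e d' \<and> q = smult e' q'"
  using assms(2-)
proof (induction arbitrary: q d)
  case (unit c)
  obtain w where w: "w \<in> S" "c * w = 1" using unit by (auto simp: unit_in_def)
  have 1: "f = smult w q * d" using arg_cong[OF unit(5), of "smult w"] w by (simp add: mult.commute)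
  have 2: "q = smult c (smult w q)" using w by simp
  show ?case using unit w 1 2
    by (intro bexI[of _ "smult w q"] bexI[of _ d] bexI[of _ 1] bexI[of _ c])
       (auto simp: unit_in_def smult_polys_over[OF S] subring_one[OF S])
next
  case (step p n a)
  have aS: "a \<in> S" using prime_fact_mem[OF S step(2)] by simp
  have p: "p \<in> S" "p \<noteq> 0" using step(1) by (auto simp: prime_in_def)
  have "q * d = [:p:] * smult a f" using step(7) by (simp add: mult.commute)
  then have "dvd_in (polys_over S) [:p:] (q * d)"
    using smult_polys_over[OF S aS step(4)] unfolding dvd_in_def by blast
  then consider "dvd_in (polys_over S) [:p:] q" | "dvd_in (polys_over S) [:p:] d"
    using prime_in_const[OF S step(1)] step(5,6) unfolding prime_in_def by blast
  then show ?case
  proof cases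
    case 1
    then obtain q1 where q1: "q1 \<in> polys_over S" "q = smult p q1" by (auto simp: dvd_in_def)
    have "smult p (smult a f) = smult p (q1 * d)" using step(7) q1 by simp
    then have "smult a f = q1 * d" using p(2) by (metis smult_cancel)
    from step.IH[OF step(4) q1(1) step(6) this] obtain q' d' e e' where
      *: "q' \<in> polys_over S" "d' \<in> polys_over S" "e \<in> S" "e' \<in> S" "e \<noteq> 0" "e' \<noteq> 0" "f = q' * d'"
         "d = smult e d'" "q1 = smult e' q'" by blast
    then show ?thesis using q1 p
      by (intro bexI[of _ q'] bexI[of _ d'] bexI[of _ e] bexI[of _ "p * e'"])
         (auto intro: subring_mult[OF S])
  next
    case 2
    then obtain q1 where q1: "q1 \<in> polys_over S" "d = smult p q1" by (auto simp: dvd_in_def)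
    have "smult p (smult a f) = smult p (q * q1)" using step(7) q1 by simp
    then have "smult a f = q * q1" using p(2) by (metis smult_cancel)
    from step.IH[OF step(4,5) q1(1) this] obtain q' d' e e' where
      *: "q' \<in> polys_over S" "d' \<in> polys_over S" "e \<in> S" "e' \<in> S" "e \<noteq> 0" "e' \<noteq> 0" "f = q' * d'"
         "q1 = smult e d'" "q = smult e' q'" by blast
    then show ?thesis using q1 p
      by (intro bexI[of _ q'] bexI[of _ d'] bexI[of _ "p * e"] bexI[of _ e'])
         (auto intro: subring_mult[OF S])
  qed
qed

section \<open>Pseudo-division and ideals of polynomials\<close>

lemma pseudo_division:
  fixes S :: "'a::idom set"
  assumes S: "is_subring S" and d: "d \<in> polys_over S" "d \<noteq> 0" and "f \<in> polys_over S"
  shows "\<exists>k. \<exists>q\<in>polys_over S. \<exists>r\<in>polys_over S.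
    smult (lead_coeff d ^ k) f = q * d + r \<and> (r = 0 \<or> degree r < degree d)"
  using assms(4)
proof (induction "degree f" arbitrary: f rule: less_induct)
  case less
  note PS = is_subring_polys_over[OF S]
  show ?case
  proof (cases "f = 0 \<or> degree f < degree d")
    case True
    show ?thesis using True less(2) subring_zero[OF PS]
      by (intro exI[of _ 0] bexI[of _ 0] bexI[of _ f]) auto
  next
    case False
    define m where "m = monom (lead_coeff f) (degree f - degree d)"
    \<comment> \<open>Scaling by the leading coefficient of \<open>d\<close> replaces a division
      that \<open>S\<close> need not permit; the top terms cancel.\<close>
    define g where "g = smult (lead_coeff d) f - m * d"
    have mS: "m \<in> polys_over S" unfolding m_def by (intro monom_polys_over S polys_overD less(2))
    have gS: "g \<in> polys_over S" unfolding g_def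
      by (intro subring_diff[OF PS] smult_polys_over S polys_overD less(2) d(1) subring_mult[OF PS] mS)
    have "degree (m * d) \<le> degree f" using False d unfolding m_def
      by (intro order.trans[OF degree_mult_le]) (auto simp: degree_monom_eq)
    then have dg: "degree g \<le> degree f" unfolding g_def
      by (intro degree_diff_le) auto
    have "degree f - degree d \<le> degree f" by simp
    have "coeff (m * d) (degree f) = lead_coeff f * lead_coeff d" using False unfolding m_def
      by (simp add: coeff_monom_mult)
    then have "coeff g (degree f) = 0" unfolding g_def by (simp add: mult.commute)
    then have g: "g = 0 \<or> degree g < degree f"
      using dg by (metis le_neq_implies_less leading_coeff_0_iff)
    have "\<exists>k. \<exists>q\<in>polys_over S. \<exists>r\<in>polys_over S.
      smult (lead_coeff d ^ k) g = q * d + r \<and> (r = 0 \<or> degree r < degree d)"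
    proof (cases "g = 0")
      case True
      then show ?thesis using subring_zero[OF PS] by (intro exI[of _ 0] bexI[of _ 0]) auto
    next
      case False
      then show ?thesis using g by (intro less(1) gS) auto
    qed
    then obtain k q r where *: "q \<in> polys_over S" "r \<in> polys_over S"
      "smult (lead_coeff d ^ k) g = q * d + r" "r = 0 \<or> degree r < degree d" by blast
    have "smult (lead_coeff d ^ Suc k) f = smult (lead_coeff d ^ k) (g + m * d)"
      by (simp add: g_def mult.commute)
    also have "\<dots> = (q + smult (lead_coeff d ^ k) m) * d + r"
      using *(3) by (simp add: smult_add_right algebra_simps)
    finally show ?thesis using *
      by (intro exI[of _ "Suc k"] bexI[of _ "q + smult (lead_coeff d ^ k) m"] bexI[of _ r])
         (auto intro!: subring_add[OF PS] smult_polys_over S subring_power[OF S] polys_overD d mS)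
  qed
qed

text \<open>A nonzero element \<open>d\<close> of least degree will do, by pseudo-division.\<close>

lemma ideal_generator:
  fixes S :: "'a::idom set"
  assumes S: "is_subring S" and F: "finite F" "F \<subseteq> polys_over S" "\<exists>f\<in>F. f \<noteq> 0"
  obtains d a where "d \<in> polys_over S" "d \<noteq> 0" "\<And>f. f \<in> F \<Longrightarrow> a f \<in> polys_over S"
    "d = (\<Sum>f\<in>F. a f * f)"
    "\<And>f. f \<in> F \<Longrightarrow> \<exists>k. \<exists>q\<in>polys_over S. smult (lead_coeff d ^ k) f = q * d"
proof -
  note PS = is_subring_polys_over[OF S]
  define I where "I = {\<Sum>f\<in>F. a f * f | a. \<forall>f\<in>F. a f \<in> polys_over S}"
  have I_sub: "I \<subseteq> polys_over S" unfolding I_def using F(2)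
    by (auto intro!: subring_sum[OF PS] subring_mult[OF PS])
  have FI: "f \<in> I" if "f \<in> F" for f
  proof -
    have "f = (\<Sum>g\<in>F. (if g = f then 1 else 0) * g)" using that F(1)
      by (subst sum.remove[of _ f]) auto
    then show ?thesis unfolding I_def using subring_one[OF PS] subring_zero[OF PS]
      by (intro CollectI exI[of _ "\<lambda>g. if g = f then 1 else 0"]) auto
  qed
  \<comment> \<open>Closure in exactly this shape puts the pseudo-remainder into the ideal.\<close>
  have Ilin: "p * f - q * d \<in> I" if fd: "f \<in> I" "d \<in> I" "q \<in> polys_over S" "p \<in> polys_over S" for f d p q
  proof -
    from fd(1) obtain a where a: "f = (\<Sum>g\<in>F. a g * g)" "\<forall>g\<in>F. a g \<in> polys_over S" unfolding I_def by blast
    from fd(2) obtain b where b: "d = (\<Sum>g\<in>F. b g * g)" "\<forall>g\<in>F. b g \<in> polys_over S" unfolding I_def by blast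
    have "p * f - q * d = (\<Sum>g\<in>F. (p * a g - q * b g) * g)"
      unfolding a(1) b(1) by (simp add: sum_distrib_left sum_subtractf algebra_simps)
    then show ?thesis unfolding I_def using a(2) b(2) fd(3,4)
      by (intro CollectI exI[of _ "\<lambda>g. p * a g - q * b g"])
         (auto intro!: subring_diff[OF PS] subring_mult[OF PS])
  qed
  define n where "n = (LEAST n. \<exists>d\<in>I. d \<noteq> 0 \<and> degree d = n)"
  have "\<exists>d\<in>I. d \<noteq> 0 \<and> degree d = n" unfolding n_def
    by (rule LeastI_ex) (use F(3) FI in blast)
  then obtain d where d: "d \<in> I" "d \<noteq> 0" "degree d = n" by blast
  have min: "n \<le> degree r" if "r \<in> I" "r \<noteq> 0" for r unfolding n_def
    by (rule Least_le) (use that in blast)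
  obtain a where a: "d = (\<Sum>f\<in>F. a f * f)" "\<forall>f\<in>F. a f \<in> polys_over S"
    using d(1) unfolding I_def by blast
  show ?thesis
  proof (rule that[of d a])
    show "d \<in> polys_over S" using d I_sub by blast
    show "d \<noteq> 0" by (rule d)
    show "a f \<in> polys_over S" if "f \<in> F" for f using a that by blast
    show "d = (\<Sum>f\<in>F. a f * f)" by (rule a)
    fix f assume f: "f \<in> F"
    obtain k q r where *: "q \<in> polys_over S" "r \<in> polys_over S"
      "smult (lead_coeff d ^ k) f = q * d + r" "r = 0 \<or> degree r < degree d"
      using pseudo_division[OF S _ d(2), of f] d(1) I_sub f F(2) by blast
    have "r = [:lead_coeff d ^ k:] * f - q * d" using *(3) by (simp add: algebra_simps)
    also have "\<dots> \<in> I" using d I_sub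
      by (intro Ilin FI f d *(1) const_polys_over S subring_power[OF S]) (auto simp: polys_overD)
    finally have rI: "r \<in> I" .
    have "r = 0"
    proof (rule ccontr)
      assume "r \<noteq> 0" then show False using min[OF rI] *(4) d(3) by simp
    qed
    then show "\<exists>k. \<exists>q\<in>polys_over S. smult (lead_coeff d ^ k) f = q * d" using * by auto
  qed
qed

section \<open>Polynomial rings over factorial rings are factorial\<close>

lemma unit_in_const:
  assumes S: "is_subring S" and u: "unit_in S u" shows "unit_in (polys_over S) [:u:]"
proof -
  obtain w where w: "w \<in> S" "u * w = 1" "u \<in> S" using u by (auto simp: unit_in_def)
  then show ?thesis unfolding unit_in_def
    by (auto intro!: bexI[of _ "[:w:]"] const_polys_over[OF S] simp: one_pCons)
qed

lemma prime_fact_const: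
  fixes S :: "'a::idom set"
  assumes S: "is_subring S" and "prime_fact S n c" shows "prime_fact (polys_over S) n [:c:]"
  using assms(2)
proof induction
  case (unit u) then show ?case by (intro prime_fact.unit unit_in_const S)
next
  case (step p n a)
  have "[:p * a:] = [:p:] * [:a:]" by simp
  then show ?case using prime_fact.step[OF prime_in_const[OF S step(1)] step(3)] by metis
qed

text \<open>Every prime taken out of \<open>f\<close> removes a prime from its leading coefficient.
  A splitting \<open>f = smult e f0\<close> whose leading coefficient has the least number of primes
  is therefore primitive.\<close>

lemma primitive_part:
  fixes S :: "'a::idom set"
  assumes U: "ufd_in S" and f: "f \<in> polys_over S" "f \<noteq> 0"
  obtains e f0 where "e \<in> S" "e \<noteq> 0" "f0 \<in> polys_over S" "f = smult e f0"
    "\<And>p. prime_in S p \<Longrightarrow> \<not> dvd_in (polys_over S) [:p:] f0"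
proof -
  have S: "is_subring S" using U by (simp add: ufd_in_def)
  define P where "P = (\<lambda>n. \<exists>e\<in>S. \<exists>f0\<in>polys_over S. e \<noteq> 0 \<and> f = smult e f0 \<and> prime_fact S n (lead_coeff f0))"
  have "lead_coeff f \<in> S" "lead_coeff f \<noteq> 0" using f by (auto simp: polys_overD)
  then obtain n0 where "prime_fact S n0 (lead_coeff f)" using U by (auto simp: ufd_in_def)
  then have "P n0" unfolding P_def using f by (intro bexI[of _ 1] bexI[of _ f]) (auto simp: subring_one[OF S])
  then have "P (LEAST n. P n)" by (rule LeastI)
  then obtain e f0 where *: "e \<in> S" "f0 \<in> polys_over S" "e \<noteq> 0" "f = smult e f0"
    "prime_fact S (LEAST n. P n) (lead_coeff f0)" unfolding P_def by blast
  show ?thesis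
  proof (rule that[of e f0])
    fix p assume p: "prime_in S p"
    show "\<not> dvd_in (polys_over S) [:p:] f0"
    proof
      assume "dvd_in (polys_over S) [:p:] f0"
      then obtain g where g: "g \<in> polys_over S" "f0 = smult p g" by (auto simp: dvd_in_def)
      have p': "p \<in> S" "p \<noteq> 0" using p by (auto simp: prime_in_def)
      have "lead_coeff f0 = p * lead_coeff g" unfolding g(2) by (rule lead_coeff_smult)
      then obtain m where m: "(LEAST n. P n) = Suc m" "prime_fact S m (lead_coeff g)"
        using prime_fact_cancel[OF S *(5) p polys_overD[OF g(1)]] by blast
      have "P m" unfolding P_def using * g p' m(2)
        by (intro bexI[of _ "e * p"] bexI[of _ g]) (auto intro: subring_mult[OF S])
      then have "(LEAST n. P n) \<le> m" by (rule Least_le)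
      then show False using m by simp
    qed
  qed (use * in auto)
qed

text \<open>If \<open>f\<close> divides \<open>a * b\<close>, the ideal of \<open>f\<close> and \<open>a\<close> contains either a nonzero constant, and then
  \<open>f\<close> divides \<open>b\<close>, or an associate of \<open>f\<close>, and then \<open>f\<close> divides \<open>a\<close>, both after cancelling constants.\<close>

lemma primitive_irreducible_prime:
  fixes S :: "'a::idom set"
  assumes U: "ufd_in S" and f: "f \<in> polys_over S" "degree f > 0"
    and prim: "\<And>p. prime_in S p \<Longrightarrow> \<not> dvd_in (polys_over S) [:p:] f"
    and irr: "\<And>g h. g \<in> polys_over S \<Longrightarrow> h \<in> polys_over S \<Longrightarrow> f = g * h \<Longrightarrow> degree g = 0 \<or> degree h = 0"
  shows "prime_in (polys_over S) f"
proof -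
  have S: "is_subring S" using U by (simp add: ufd_in_def)
  note PS = is_subring_polys_over[OF S]
  have f0: "f \<noteq> 0" using f by auto
  \<comment> \<open>The first prime of a non-unit constant factor would divide the primitive
    \<open>f\<close>.\<close>
  have const_unit: "unit_in S e" if e: "e \<in> S" "g \<in> polys_over S" "f = smult e g" for e g
  proof -
    have "e \<noteq> 0" using e f0 by auto
    then obtain n where "prime_fact S n e" using U e by (auto simp: ufd_in_def)
    then show ?thesis
    proof cases
      case unit then show ?thesis by simp
    next
      case (step p n a)
      have "f = [:p:] * smult a g" using e step by (simp add: mult.commute)
      moreover have "a \<in> S" using prime_fact_mem[OF S step(4)] by simp
      ultimately have "dvd_in (polys_over S) [:p:] f"
        using smult_polys_over[OF S _ e(2)] unfolding dvd_in_def by blast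
      then show ?thesis using prim step by blast
    qed
  qed
  \<comment> \<open>Clearing \<open>c\<close> splits \<open>b\<close> as \<open>q' * d'\<close> with
    \<open>f\<close> a constant multiple of \<open>d'\<close>, and that constant is a unit by
    \<open>const_unit\<close>.\<close>
  have cancel: "dvd_in (polys_over S) f b"
    if c: "c \<in> S" "c \<noteq> 0" "b \<in> polys_over S" "w \<in> polys_over S" "smult c b = w * f" for b c w
  proof -
    obtain n where "prime_fact S n c" using U c by (auto simp: ufd_in_def)
    from clear_constant[OF S this c(3,4) f(1) c(5)] obtain q' d' e where
      *: "q' \<in> polys_over S" "d' \<in> polys_over S" "e \<in> S" "b = q' * d'" "f = smult e d'" by blast
    obtain v where v: "v \<in> S" "e * v = 1" using const_unit[OF *(3,2,5)] by (auto simp: unit_in_def)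
    have "b = f * smult v q'" using * v by (simp add: mult.commute)
    then show ?thesis using smult_polys_over[OF S v(1) *(1)] unfolding dvd_in_def by blast
  qed
  show ?thesis unfolding prime_in_def
  proof (intro conjI ballI impI)
    show "f \<in> polys_over S" "f \<noteq> 0" using f by auto
    show "\<not> unit_in (polys_over S) f"
    proof
      assume "unit_in (polys_over S) f"
      then obtain w where w: "f * w = 1" by (auto simp: unit_in_def)
      then have "w \<noteq> 0" by auto
      then have "degree (f * w) = degree f + degree w" using f0 by (intro degree_mult_eq)
      then show False using w f by simp
    qed
  next
    fix a b assume a: "a \<in> polys_over S" and b: "b \<in> polys_over S"
      and ab: "dvd_in (polys_over S) f (a * b)"
    have fa: "finite {f, a}" "{f, a} \<subseteq> polys_over S" "\<exists>h\<in>{f, a}. h \<noteq> 0" using f a f0 by auto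
    obtain d k where d: "d \<in> polys_over S" "d \<noteq> 0" "\<And>h. h \<in> {f, a} \<Longrightarrow> k h \<in> polys_over S"
      "d = (\<Sum>h\<in>{f, a}. k h * h)"
      "\<And>h. h \<in> {f, a} \<Longrightarrow> \<exists>k. \<exists>q\<in>polys_over S. smult (lead_coeff d ^ k) h = q * d"
      by (rule ideal_generator[OF S fa]) blast
    have lc: "lead_coeff d ^ i \<in> S" "lead_coeff d ^ i \<noteq> 0" for i
      using d by (auto intro: subring_power[OF S] polys_overD)
    show "dvd_in (polys_over S) f a \<or> dvd_in (polys_over S) f b"
    proof (cases "degree d = 0")
      case True
      then obtain c where c: "d = [:c:]" by (metis degree_eq_zeroE)
      have cS: "c \<in> S" "c \<noteq> 0" using polys_overD[OF d(1), of 0] d(2) c by auto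
      obtain w where w: "w \<in> polys_over S" "a * b = f * w" using ab by (auto simp: dvd_in_def)
      have "\<exists>u\<in>polys_over S. smult c b = u * f"
      \<comment> \<open>For \<open>f = a\<close> the set \<open>{f, a}\<close> has one element and
        the Bezout sum only one term.\<close>
      proof (cases "f = a")
        case True
        have "smult c b = [:c:] * b" by simp
        also have "\<dots> = (k f * b) * f" using d(4) c True by (simp add: mult_ac)
        finally show ?thesis using d(3)[of f] b by (auto intro!: subring_mult[OF PS])
      next
        case False
        have "smult c b = [:c:] * b" by simp
        also have "\<dots> = (k f * f + k a * a) * b" using d(4) c False by simp
        also have "\<dots> = k f * b * f + k a * (a * b)" by (simp add: algebra_simps)
        also have "\<dots> = (k f * b + k a * w) * f" unfolding w by (simp add: algebra_simps)
        finally show ?thesis using d(3)[of f] d(3)[of a] b w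
          by (auto intro!: bexI[of _ "k f * b + k a * w"] subring_add[OF PS] subring_mult[OF PS])
      qed
      then show ?thesis using cancel[OF cS b] by blast
    next
      case False
      obtain i q where q: "q \<in> polys_over S" "smult (lead_coeff d ^ i) f = q * d" using d(5)[of f] by auto
      obtain j u where u: "u \<in> polys_over S" "smult (lead_coeff d ^ j) a = u * d" using d(5)[of a] by auto
      obtain n where "prime_fact S n (lead_coeff d ^ i)" using U lc[of i] by (auto simp: ufd_in_def)
      from clear_constant[OF S this f(1) q(1) d(1) q(2)] obtain q' d' e where
        *: "q' \<in> polys_over S" "d' \<in> polys_over S" "e \<in> S" "e \<noteq> 0" "f = q' * d'" "d = smult e d'" by blast
      have "degree d' \<noteq> 0" using False *(4,6) by auto
      then have "degree q' = 0" using irr[OF *(1,2,5)] by simp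
      then obtain v where v: "q' = [:v:]" by (metis degree_eq_zeroE)
      have vS: "v \<in> S" using polys_overD[OF *(1), of 0] v by simp
      have fv: "f = smult v d'" using *(5) v by simp
      obtain v' where v': "v' \<in> S" "v * v' = 1"
        using const_unit[OF vS *(2) fv] by (auto simp: unit_in_def)
      have "d' = smult v' f" using fv v' by (simp add: mult.commute)
      then have "smult (lead_coeff d ^ j) a = smult (e * v') u * f" using u(2) *(6) by simp
      then show ?thesis using cancel[OF lc(1,2) a] smult_polys_over[OF S subring_mult[OF S *(3) v'(1)] u(1)]
        by blast
    qed
  qed
qed

text \<open>By induction on the degree: a product of two factors of positive degree reduces to
  smaller degrees. Otherwise the primitive part is prime and the content is factored in
  \<open>S\<close>.\<close>

theorem ufd_in_polys_over:
  fixes S :: "'a::idom set"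
  assumes U: "ufd_in S" shows "ufd_in (polys_over S)"
proof -
  have S: "is_subring S" using U by (simp add: ufd_in_def)
  note PS = is_subring_polys_over[OF S]
  have "\<exists>n. prime_fact (polys_over S) n f" if "f \<in> polys_over S" "f \<noteq> 0" for f
    using that
  proof (induction "degree f" arbitrary: f rule: less_induct)
    case less
    show ?case
    proof (cases "degree f = 0")
      case True
      then obtain c where c: "f = [:c:]" by (metis degree_eq_zeroE)
      have cS: "c \<in> S" "c \<noteq> 0" using polys_overD[OF less(2), of 0] less(3) c by auto
      then obtain n where "prime_fact S n c" using U by (auto simp: ufd_in_def)
      then show ?thesis using prime_fact_const[OF S] c by blast
    next
      case False
      show ?thesis
      proof (cases "\<exists>g\<in>polys_over S. \<exists>h\<in>polys_over S. f = g * h \<and> degree g \<noteq> 0 \<and> degree h \<noteq> 0")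
        case True
        then obtain g h where gh: "g \<in> polys_over S" "h \<in> polys_over S" "f = g * h" "degree g \<noteq> 0" "degree h \<noteq> 0"
          by blast
        have nz: "g \<noteq> 0" "h \<noteq> 0" using gh by auto
        then have "degree f = degree g + degree h" using gh by (simp add: degree_mult_eq)
        then have "degree g < degree f" "degree h < degree f" using gh by auto
        then show ?thesis using less(1)[of g] less(1)[of h] gh nz prime_fact_mult[OF PS] by blast
      next
        case False2: False
        obtain e f0 where e: "e \<in> S" "e \<noteq> 0" "f0 \<in> polys_over S" "f = smult e f0"
          "\<And>p. prime_in S p \<Longrightarrow> \<not> dvd_in (polys_over S) [:p:] f0"
          by (rule primitive_part[OF U less(2,3)]) blast
        have "prime_in (polys_over S) f0"
        proof (rule primitive_irreducible_prime[OF U e(3)])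
          show "degree f0 > 0" using e False by auto
          show "\<not> dvd_in (polys_over S) [:p:] f0" if "prime_in S p" for p using e(5) that .
          fix g h assume gh: "g \<in> polys_over S" "h \<in> polys_over S" "f0 = g * h"
          then have "f = smult e g * h" using e by simp
          then have "degree (smult e g) = 0 \<or> degree h = 0"
            using False2 gh smult_polys_over[OF S e(1) gh(1)] by blast
          then show "degree g = 0 \<or> degree h = 0" using e by simp
        qed
        moreover obtain n where "prime_fact S n e" using U e by (auto simp: ufd_in_def)
        ultimately have "prime_fact (polys_over S) (Suc n) (f0 * [:e:])"
          by (intro prime_fact.step prime_fact_const S)
        then show ?thesis using e by (auto simp: mult.commute)
      qed
    qed
  qed
  then show ?thesis using PS by (auto simp: ufd_in_def)
qed

text \<open>The ideal generator \<open>d\<close> divides every member of \<open>F\<close> up to a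
  constant. A prime factor of \<open>d\<close> of positive degree cannot divide that constant, so it
  would be a common factor of \<open>F\<close>; hence \<open>d\<close> is a constant, the eliminant
  \<open>R\<close>.\<close>

lemma bezout_constant:
  fixes S :: "'a::idom set"
  assumes U: "ufd_in S" and F: "finite F" "F \<subseteq> polys_over S" "\<exists>f\<in>F. f \<noteq> 0"
    and coprime: "\<And>h. h \<in> polys_over S \<Longrightarrow> (\<And>f. f \<in> F \<Longrightarrow> dvd_in (polys_over S) h f) \<Longrightarrow> degree h = 0"
  obtains a R where "\<And>f. f \<in> F \<Longrightarrow> a f \<in> polys_over S" "R \<in> S" "R \<noteq> 0" "(\<Sum>f\<in>F. a f * f) = [:R:]"
proof -
  have S: "is_subring S" using U by (simp add: ufd_in_def)
  note PS = is_subring_polys_over[OF S]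
  obtain d a where d: "d \<in> polys_over S" "d \<noteq> 0" "\<And>f. f \<in> F \<Longrightarrow> a f \<in> polys_over S"
    "d = (\<Sum>f\<in>F. a f * f)"
    "\<And>f. f \<in> F \<Longrightarrow> \<exists>k. \<exists>q\<in>polys_over S. smult (lead_coeff d ^ k) f = q * d"
    by (rule ideal_generator[OF S F]) blast
  have factor: "\<exists>p. prime_in (polys_over S) p \<and> degree p > 0 \<and> dvd_in (polys_over S) p x"
    if "prime_fact (polys_over S) n x" "degree x > 0" for n x
    using that
  proof induction
    case (unit u)
    then obtain w where w: "u * w = 1" by (auto simp: unit_in_def)
    then have "u \<noteq> 0" "w \<noteq> 0" by auto
    then have "degree (u * w) = degree u + degree w" by (intro degree_mult_eq)
    then show ?case using w unit by simp
  next
    case (step p n a)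
    have aS: "a \<in> polys_over S" "a \<noteq> 0" using prime_fact_mem[OF PS step(2)] by auto
    have p: "p \<noteq> 0" "p \<in> polys_over S" using step(1) by (auto simp: prime_in_def)
    have dd: "degree (p * a) = degree p + degree a" using p aS by (intro degree_mult_eq)
    show ?case
    proof (cases "degree p > 0")
      case True
      have "dvd_in (polys_over S) p (p * a)" using aS by (auto simp: dvd_in_def)
      then show ?thesis using True step(1) by blast
    next
      case False
      then show ?thesis using step.IH step.prems dd dvd_in_mult'[OF PS _ p(2)] by auto
    qed
  qed
  have "degree d = 0"
  proof (rule ccontr)
    assume "degree d \<noteq> 0"
    moreover obtain n where "prime_fact (polys_over S) n d"
      using ufd_in_polys_over[OF U] d by (auto simp: ufd_in_def)
    ultimately obtain p where p: "prime_in (polys_over S) p" "degree p > 0" "dvd_in (polys_over S) p d"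
      using factor by blast
    have "dvd_in (polys_over S) p f" if f: "f \<in> F" for f
    proof -
      obtain k q where q: "q \<in> polys_over S" "smult (lead_coeff d ^ k) f = q * d" using d(5)[OF f] by auto
      have "dvd_in (polys_over S) p ([:lead_coeff d ^ k:] * f)" using dvd_in_mult'[OF PS p(3) q(1)] q by simp
      moreover have "\<not> dvd_in (polys_over S) p [:lead_coeff d ^ k:]"
      proof
        assume "dvd_in (polys_over S) p [:lead_coeff d ^ k:]"
        then obtain w where w: "[:lead_coeff d ^ k:] = p * w" by (auto simp: dvd_in_def)
        have "[:lead_coeff d ^ k:] \<noteq> 0" using d by simp
        then have "degree (p * w) = degree p + degree w" using w by (intro degree_mult_eq) auto
        then show False using p w[symmetric] by simp
      qed
      moreover have "[:lead_coeff d ^ k:] \<in> polys_over S"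
        by (intro const_polys_over S subring_power[OF S] polys_overD d)
      ultimately show ?thesis using p(1) F(2) f unfolding prime_in_def by blast
    qed
    then have "degree p = 0" using p(1) by (intro coprime) (auto simp: prime_in_def)
    then show False using p by simp
  qed
  then obtain R where R: "d = [:R:]" by (metis degree_eq_zeroE)
  have "R \<in> S" "R \<noteq> 0" using polys_overD[OF d(1), of 0] d(2) R by auto
  then show ?thesis using that[of a R] d R by metis
qed

text \<open>Transports factoriality from the integers to their copy in another ring, and from
  \<open>S[X]\<close> to \<open>S[t]\<close> when \<open>t\<close> is transcendental.\<close>

lemma ufd_in_image:
  fixes A :: "'a::comm_ring_1 set" and h :: "'a \<Rightarrow> 'b::comm_ring_1"
  assumes U: "ufd_in A" and inj: "inj_on h A"
    and h: "h 1 = 1" "\<And>a b. h (a - b) = h a - h b" "\<And>a b. h (a * b) = h a * h b"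
  shows "ufd_in (h ` A)"
proof -
  have A: "is_subring A" using U by (simp add: ufd_in_def)
  have h0: "h 0 = 0" using h(2)[of 0 0] by simp
  have eq: "a = b" if "h a = h b" "a \<in> A" "b \<in> A" for a b using that inj by (auto dest: inj_onD)
  have hA: "is_subring (h ` A)" unfolding is_subring_def
    using subring_one[OF A] subring_diff[OF A] subring_mult[OF A]
    by (auto simp flip: h intro: rev_image_eqI[of 1])
  have dvd: "dvd_in (h ` A) (h a) (h b) \<longleftrightarrow> dvd_in A a b" if "a \<in> A" "b \<in> A" for a b
  proof
    assume "dvd_in (h ` A) (h a) (h b)"
    then obtain k where k: "k \<in> A" "h b = h (a * k)" by (auto simp: dvd_in_def h(3))
    then show "dvd_in A a b" using eq[OF k(2) that(2)] subring_mult[OF A that(1) k(1)] by (auto simp: dvd_in_def)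
  qed (auto simp: dvd_in_def h(3))
  have unit: "unit_in (h ` A) (h a) \<longleftrightarrow> unit_in A a" if "a \<in> A" for a
    using dvd[OF that subring_one[OF A]] that h(1) unfolding unit_in_def dvd_in_def by auto
  have prime: "prime_in (h ` A) (h p)" if p: "prime_in A p" for p
  proof -
    have pA: "p \<in> A" "p \<noteq> 0" using p by (auto simp: prime_in_def)
    then have "h p \<noteq> 0" using eq[of p 0] h0 subring_zero[OF A] by auto
    moreover have "dvd_in (h ` A) (h p) (h a) \<or> dvd_in (h ` A) (h p) (h b)"
      if "a \<in> A" "b \<in> A" "dvd_in (h ` A) (h p) (h a * h b)" for a b
      using that p pA dvd subring_mult[OF A that(1,2)] h(3) unfolding prime_in_def by metis
    ultimately show ?thesis using p pA unit unfolding prime_in_def by auto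
  qed
  have pf: "prime_fact (h ` A) n (h a)" if "prime_fact A n a" for n a
    using that
  proof induction
    case (unit u) then show ?case using unit_in_def \<open>\<And>a. a \<in> A \<Longrightarrow> unit_in (h ` A) (h a) = unit_in A a\<close>
      by (auto intro!: prime_fact.unit simp: unit_in_def)
  next
    case (step p n a) then show ?case by (auto simp: h(3) intro!: prime_fact.step prime)
  qed
  have "\<exists>n. prime_fact (h ` A) n b" if "b \<in> h ` A" "b \<noteq> 0" for b
  proof -
    from that obtain a where a: "a \<in> A" "b = h a" "a \<noteq> 0" using h0 by auto
    then show ?thesis using U pf unfolding ufd_in_def by blast
  qed
  then show ?thesis using hA by (auto simp: ufd_in_def)
qed

lemma ufd_in_Ints: "ufd_in (range (of_int :: int \<Rightarrow> 'a::idom) :: 'a set)" if "inj (of_int :: int \<Rightarrow> 'a)"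
proof (rule ufd_in_image)
  have sub: "is_subring (UNIV :: int set)" by (auto simp: is_subring_def)
  have dv: "dvd_in UNIV a b \<longleftrightarrow> a dvd b" for a b :: int by (auto simp: dvd_in_def dvd_def)
  have un: "unit_in UNIV a \<longleftrightarrow> is_unit a" for a :: int by (auto simp: unit_in_def dvd_def)
  have pr: "prime_in UNIV p" if "prime_elem p" for p :: int
    using that unfolding prime_in_def dv un prime_elem_def by blast
  have "\<exists>n. prime_fact UNIV n a" if "a \<noteq> 0" for a :: int
    using that
  proof (induction a rule: prime_divisors_induct)
    case zero then show ?case by simp
  next
    case (unit x) then show ?case using prime_fact.unit[of UNIV x] by (auto simp: un)
  next
    case (factor p x)
    then have "x \<noteq> 0" "prime_elem p" by auto
    then show ?case using factor prime_fact.step[OF pr, of p] by auto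
  qed
  then show "ufd_in (UNIV :: int set)" using sub by (auto simp: ufd_in_def)
  show "inj_on (of_int :: int \<Rightarrow> 'a) UNIV" by (rule that)
qed auto

section \<open>Integer polynomials and algebraically independent reals\<close>

definition mon_eval :: "('v \<Rightarrow> 'b::comm_ring_1) \<Rightarrow> ('v \<Rightarrow>\<^sub>0 nat) \<Rightarrow> 'b" where
  "mon_eval x m = (\<Prod>v\<in>Poly_Mapping.keys m. x v ^ Poly_Mapping.lookup m v)"

text \<open>The coefficient map is a parameter because integer and rational polynomials are
  evaluated at the same points; the target may itself be a ring of polynomials.\<close>

definition poly_eval :: "('a::comm_ring_1 \<Rightarrow> 'b::comm_ring_1) \<Rightarrow> ('v \<Rightarrow> 'b) \<Rightarrow> ('v, 'a) mpoly \<Rightarrow> 'b" where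
  "poly_eval h x p = (\<Sum>m\<in>Poly_Mapping.keys p. h (Poly_Mapping.lookup p m) * mon_eval x m)"

lemma mon_eval_superset:
  assumes "finite K" "Poly_Mapping.keys m \<subseteq> K"
  shows "mon_eval x m = (\<Prod>v\<in>K. x v ^ Poly_Mapping.lookup m v)"
  unfolding mon_eval_def using assms
  by (intro prod.mono_neutral_left) (auto simp: in_keys_iff)

lemma mon_eval_add: "mon_eval x (m + m') = mon_eval x m * mon_eval x m'"
proof -
  let ?K = "Poly_Mapping.keys m \<union> Poly_Mapping.keys m'"
  have "mon_eval x (m + m') = (\<Prod>v\<in>?K. x v ^ Poly_Mapping.lookup (m + m') v)"
    by (intro mon_eval_superset keys_add) auto
  also have "\<dots> = (\<Prod>v\<in>?K. x v ^ Poly_Mapping.lookup m v) * (\<Prod>v\<in>?K. x v ^ Poly_Mapping.lookup m' v)"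
    by (simp add: lookup_add power_add prod.distrib)
  also have "\<dots> = mon_eval x m * mon_eval x m'"
    by (subst (1 2) mon_eval_superset[symmetric]) auto
  finally show ?thesis .
qed

lemma mon_eval_zero [simp]: "mon_eval x 0 = 1"
  by (simp add: mon_eval_def)

lemma poly_mapping_sum_single:
  fixes p :: "'k \<Rightarrow>\<^sub>0 'a::comm_monoid_add"
  shows "p = (\<Sum>m\<in>Poly_Mapping.keys p. Poly_Mapping.single m (Poly_Mapping.lookup p m))"
proof (rule poly_mapping_eqI)
  fix k
  show "Poly_Mapping.lookup p k =
    Poly_Mapping.lookup (\<Sum>m\<in>Poly_Mapping.keys p. Poly_Mapping.single m (Poly_Mapping.lookup p m)) k"
    by (auto simp: lookup_sum lookup_single when_def in_keys_iff)
qed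

text \<open>Both sides are biadditive and every polynomial is a sum of monomials.\<close>

lemma additive_imp_multiplicative:
  fixes T :: "('k::monoid_add \<Rightarrow>\<^sub>0 'a::comm_ring_1) \<Rightarrow> 'b::ring"
  assumes add: "\<And>p q. T (p + q) = T p + T q"
    and single: "\<And>m m' a b. T (Poly_Mapping.single m a * Poly_Mapping.single m' b) =
      T (Poly_Mapping.single m a) * T (Poly_Mapping.single m' b)"
  shows "T (p * q) = T p * T q"
proof -
  have T0: "T 0 = 0" using add[of 0 0] by simp
  have Tsum: "T (\<Sum>i\<in>I. f i) = (\<Sum>i\<in>I. T (f i))" for f :: "'k \<Rightarrow> _" and I
    by (induction I rule: infinite_finite_induct) (auto simp: T0 add)
  let ?s = "\<lambda>p m. Poly_Mapping.single m (Poly_Mapping.lookup p m)"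
  have "T (p * q) = T ((\<Sum>m\<in>Poly_Mapping.keys p. ?s p m) * (\<Sum>m\<in>Poly_Mapping.keys q. ?s q m))"
    using poly_mapping_sum_single[of p] poly_mapping_sum_single[of q] by simp
  also have "\<dots> = T (\<Sum>m\<in>Poly_Mapping.keys p. ?s p m) * T (\<Sum>m\<in>Poly_Mapping.keys q. ?s q m)"
    by (simp add: sum_product Tsum single)
  finally show ?thesis
    using poly_mapping_sum_single[of p] poly_mapping_sum_single[of q] by simp
qed

locale coeff_hom =
  fixes h :: "'a::comm_ring_1 \<Rightarrow> 'b::comm_ring_1"
  assumes hom_add: "h (a + b) = h a + h b" and hom_mult: "h (a * b) = h a * h b" and hom_one: "h 1 = 1"
begin

lemma hom_zero: "h 0 = 0" using hom_add[of 0 0] by simp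

lemma poly_eval_superset:
  assumes "finite K" "Poly_Mapping.keys p \<subseteq> K"
  shows "poly_eval h x p = (\<Sum>m\<in>K. h (Poly_Mapping.lookup p m) * mon_eval x m)"
  unfolding poly_eval_def using assms
  by (intro sum.mono_neutral_left) (auto simp: in_keys_iff hom_zero)

lemma poly_eval_add: "poly_eval h x (p + q) = poly_eval h x p + poly_eval h x q"
proof -
  let ?K = "Poly_Mapping.keys p \<union> Poly_Mapping.keys q"
  have "poly_eval h x (p + q) = (\<Sum>m\<in>?K. h (Poly_Mapping.lookup (p + q) m) * mon_eval x m)"
    by (intro poly_eval_superset keys_add) auto
  also have "\<dots> = (\<Sum>m\<in>?K. h (Poly_Mapping.lookup p m) * mon_eval x m) +
      (\<Sum>m\<in>?K. h (Poly_Mapping.lookup q m) * mon_eval x m)"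
    by (simp add: lookup_add hom_add algebra_simps sum.distrib)
  also have "\<dots> = poly_eval h x p + poly_eval h x q"
    by (subst (1 2) poly_eval_superset[symmetric]) auto
  finally show ?thesis .
qed

lemma poly_eval_single: "poly_eval h x (Poly_Mapping.single m a) = h a * mon_eval x m"
  by (subst poly_eval_superset[of "{m}"]) auto

lemma poly_eval_mult: "poly_eval h x (p * q) = poly_eval h x p * poly_eval h x q"
  by (rule additive_imp_multiplicative)
     (simp_all add: poly_eval_add mult_single poly_eval_single hom_mult mon_eval_add mult_ac)

lemma poly_eval_one: "poly_eval h x 1 = 1"
  using poly_eval_single[of x 0 1] by (simp add: hom_one)

lemma poly_eval_zero: "poly_eval h x 0 = 0"
  by (simp add: poly_eval_def)

lemma poly_eval_diff: "poly_eval h x (p - q) = poly_eval h x p - poly_eval h x q"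
  using poly_eval_add[of x "p - q" q] by simp

lemma poly_eval_sum: "poly_eval h x (\<Sum>i\<in>I. f i) = (\<Sum>i\<in>I. poly_eval h x (f i))"
  by (induction I rule: infinite_finite_induct) (auto simp: poly_eval_add poly_eval_zero)

end

interpretation of_int_hom: coeff_hom "of_int :: int \<Rightarrow> 'b::comm_ring_1"
  by unfold_locales auto

abbreviation int_eval :: "('v \<Rightarrow> 'b::comm_ring_1) \<Rightarrow> ('v, int) mpoly \<Rightarrow> 'b" where
  "int_eval \<equiv> poly_eval of_int"

lemma meval_eq: "meval p x = int_eval x p"
  by (simp add: meval_def poly_eval_def mon_eval_def)

lemma single_zero_int: "Poly_Mapping.single 0 (c::int) = of_int c"
proof -
  have "Poly_Mapping.single 0 (of_int c :: int) = of_int c" by (rule single_of_int)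
  then show ?thesis by simp
qed

lemma int_eval_of_int: "int_eval x (of_int c) = of_int c"
  using of_int_hom.poly_eval_single[of x 0 c] by (simp add: single_zero_int)

lemma poly_eval_to_rat: "poly_eval of_rat x (to_rat_poly p) = int_eval x p"
proof -
  have k: "Poly_Mapping.lookup (to_rat_poly p) m = of_int (Poly_Mapping.lookup p m)" for m
    by (auto simp: to_rat_poly_def map.rep_eq when_def)
  have "Poly_Mapping.keys (to_rat_poly p) = Poly_Mapping.keys p"
    by (auto simp: in_keys_iff k)
  then show ?thesis by (simp add: poly_eval_def k)
qed

lemma to_rat_poly_mult: "to_rat_poly (p * q) = to_rat_poly p * to_rat_poly q"
proof (rule additive_imp_multiplicative)
  have k: "Poly_Mapping.lookup (to_rat_poly p) m = of_int (Poly_Mapping.lookup p m)" for p :: "('a,int) mpoly" and m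
    by (auto simp: to_rat_poly_def map.rep_eq when_def)
  show "to_rat_poly (p + q) = to_rat_poly p + to_rat_poly q" for p q :: "('a,int) mpoly"
    by (rule poly_mapping_eqI) (simp add: k lookup_add)
  have s: "to_rat_poly (Poly_Mapping.single m a) = Poly_Mapping.single m (of_int a)" for m :: "'a \<Rightarrow>\<^sub>0 nat" and a
    by (rule poly_mapping_eqI) (auto simp add: k lookup_single when_def)
  show "to_rat_poly (Poly_Mapping.single m a * Poly_Mapping.single m' b) =
    to_rat_poly (Poly_Mapping.single m a) * to_rat_poly (Poly_Mapping.single m' b)" for m m' :: "'a \<Rightarrow>\<^sub>0 nat" and a b
    by (simp add: mult_single s)
qed

section \<open>Subrings generated by the values of the variables\<close>

definition adjoin :: "'a::comm_ring_1 set \<Rightarrow> 'a \<Rightarrow> 'a set" where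
  "adjoin S t = (\<lambda>q. poly q t) ` polys_over S"

text \<open>For \<open>t = mvar\<close> this is the ring of integer polynomials in the variables
  \<open>vs\<close>, for numbers \<open>t\<close> its image under evaluation. The head of the list
  is the outermost variable, the first to be eliminated.\<close>

primrec tower :: "('v \<Rightarrow> 'a::comm_ring_1) \<Rightarrow> 'v list \<Rightarrow> 'a set" where
  "tower t [] = range of_int"
| "tower t (v # vs) = adjoin (tower t vs) (t v)"

lemma is_subring_adjoin: assumes "is_subring S" shows "is_subring (adjoin S t)"
  using is_subring_closed[OF is_subring_polys_over[OF assms]]
  unfolding is_subring_def adjoin_def
  by (auto simp flip: poly_diff poly_mult intro: rev_image_eqI[of 1])

lemma adjoin_base: assumes "is_subring S" "a \<in> S" shows "a \<in> adjoin S t"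
  unfolding adjoin_def using const_polys_over[OF assms] by (intro rev_image_eqI[of "[:a:]"]) auto

lemma adjoin_gen: assumes "is_subring S" shows "t \<in> adjoin S t"
  unfolding adjoin_def using assms
  by (intro rev_image_eqI[of "[:0, 1:]"])
     (auto simp: polys_over_def coeff_pCons subring_zero subring_one split: nat.split)

lemma is_subring_tower: "is_subring (tower t vs)"
proof (induction vs)
  case Nil
  show ?case unfolding is_subring_def
    by (auto simp flip: of_int_diff of_int_mult intro: range_eqI[of _ _ 1])
qed (auto intro: is_subring_adjoin)

lemma tower_gen: "v \<in> set vs \<Longrightarrow> t v \<in> tower t vs"
  by (induction vs) (auto intro: adjoin_gen adjoin_base is_subring_tower)

lemma tower_cong: "(\<And>v. v \<in> set vs \<Longrightarrow> s v = t v) \<Longrightarrow> tower s vs = tower t vs"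
  by (induction vs) auto

lemma poly_eval_mem:
  assumes S: "is_subring S" and "\<And>v. v \<in> mvars p \<Longrightarrow> x v \<in> S"
  shows "int_eval x p \<in> S"
  unfolding poly_eval_def mon_eval_def using assms(2)
  by (intro subring_sum[OF S] subring_mult[OF S] subring_of_int[OF S] subring_prod[OF S] subring_power[OF S])
     (auto simp: mvars_def)

definition mvar :: "'v \<Rightarrow> ('v, int) mpoly" where
  "mvar v = Poly_Mapping.single (Poly_Mapping.single v 1) 1"

lemma int_eval_mvar: "int_eval x (mvar v) = x v"
  by (simp add: mvar_def of_int_hom.poly_eval_single mon_eval_def)

lemma mon_eval_mvar: "mon_eval mvar m = Poly_Mapping.single m 1"
proof -
  have pow: "mvar v ^ n = Poly_Mapping.single (Poly_Mapping.single v n) 1" for v :: 'a and n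
    by (induction n) (auto simp: mvar_def mult_single simp flip: single_add)
  have "(\<Prod>v\<in>K. mvar v ^ e v) = Poly_Mapping.single (\<Sum>v\<in>K. Poly_Mapping.single v (e v)) 1"
    for K :: "'a set" and e
    by (induction K rule: infinite_finite_induct) (auto simp: pow mult_single)
  then show ?thesis unfolding mon_eval_def using poly_mapping_sum_single[of m] by simp
qed

lemma int_eval_mvar_self: "int_eval mvar p = p"
proof -
  have "of_int c * Poly_Mapping.single m 1 = (Poly_Mapping.single m c :: ('a, int) mpoly)" for c m
    using mult_single[of 0 c m "1::int"] by (simp add: single_zero_int)
  then show ?thesis
    unfolding poly_eval_def mon_eval_mvar using poly_mapping_sum_single[of p] by simp
qed

text \<open>A polynomial is its own value at the variables, and that value is built by ring
  operations from elements of the tower.\<close>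

lemma mem_tower_mvar: "mvars p \<subseteq> set vs \<Longrightarrow> p \<in> tower mvar vs"
  using poly_eval_mem[OF is_subring_tower, of p mvar mvar vs] tower_gen[of _ vs mvar]
  by (auto simp: int_eval_mvar_self)

lemma poly_hom_eval:
  assumes "coeff_hom h" shows "h (poly q t) = poly (map_poly h q) (h t)"
proof -
  interpret coeff_hom h by (rule assms)
  show ?thesis by (induction q) (auto simp: hom_zero hom_add hom_mult map_poly_pCons)
qed

lemma map_poly_lift:
  assumes h0: "h 0 = 0" and S0: "0 \<in> S" and q: "q \<in> polys_over (h ` S)"
  obtains q' where "q' \<in> polys_over S" "map_poly h q' = q"
proof -
  \<comment> \<open>Zero coefficients must be lifted to zero, or the lifted sequence might not be a
    polynomial.\<close>
  have "\<exists>k. k \<in> S \<and> h k = coeff q i \<and> (coeff q i = 0 \<longrightarrow> k = 0)" for i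
    using polys_overD[OF q, of i] h0 S0 by (cases "coeff q i = 0") auto
  then obtain k where k: "\<And>i. k i \<in> S" "\<And>i. h (k i) = coeff q i" "\<And>i. coeff q i = 0 \<Longrightarrow> k i = 0" by metis
  define r where "r = Poly (map k [0..<Suc (degree q)])"
  have cr: "coeff r i = k i" for i
    unfolding r_def by (auto simp: coeff_Poly_eq nth_default_def k(3) coeff_eq_0 simp del: upt_Suc)
  show ?thesis
    by (rule that[of r]) (auto simp: polys_over_def cr k h0 coeff_map_poly intro: poly_eqI)
qed

lemma map_poly_polys_over: "h 0 = 0 \<Longrightarrow> q \<in> polys_over S \<Longrightarrow> map_poly h q \<in> polys_over (h ` S)"
  by (auto simp: polys_over_def coeff_map_poly)

lemma adjoin_image:
  assumes h: "coeff_hom h" and S: "is_subring S" shows "h ` adjoin S t = adjoin (h ` S) (h t)"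
proof -
  interpret coeff_hom h by (rule h)
  show ?thesis
  proof
    show "h ` adjoin S t \<subseteq> adjoin (h ` S) (h t)"
      unfolding adjoin_def using map_poly_polys_over[of h _ S, OF hom_zero]
      by (auto simp: poly_hom_eval[OF h])
    show "adjoin (h ` S) (h t) \<subseteq> h ` adjoin S t"
    proof
      fix y assume "y \<in> adjoin (h ` S) (h t)"
      then obtain q where q: "q \<in> polys_over (h ` S)" "y = poly q (h t)" by (auto simp: adjoin_def)
      obtain q' where "q' \<in> polys_over S" "map_poly h q' = q"
        using map_poly_lift[OF hom_zero subring_zero[OF S] q(1)] .
      then show "y \<in> h ` adjoin S t" using q
        by (auto simp: adjoin_def poly_hom_eval[OF h, symmetric])
    qed
  qed
qed

lemma coeff_hom_int_eval: "coeff_hom (int_eval x)"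
  by unfold_locales (auto simp: of_int_hom.poly_eval_add of_int_hom.poly_eval_mult of_int_hom.poly_eval_one)

text \<open>Lets statements about values in the tower be pulled back to polynomials.\<close>

lemma tower_image: "int_eval x ` tower mvar vs = tower x vs"
proof (induction vs)
  case Nil
  show ?case by (auto simp: int_eval_of_int image_image)
next
  case (Cons v vs)
  then show ?case by (simp add: adjoin_image[OF coeff_hom_int_eval is_subring_tower] int_eval_mvar)
qed

section \<open>Algebraic independence\<close>

definition transcendental :: "'a::comm_ring_1 set \<Rightarrow> 'a \<Rightarrow> bool" where
  "transcendental S t \<longleftrightarrow> (\<forall>q\<in>polys_over S. poly q t = 0 \<longrightarrow> q = 0)"

primrec alg_indep :: "('v \<Rightarrow> 'a::comm_ring_1) \<Rightarrow> 'v list \<Rightarrow> bool" where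
  "alg_indep t [] \<longleftrightarrow> True"
| "alg_indep t (v # vs) \<longleftrightarrow> alg_indep t vs \<and> transcendental (tower t vs) (t v)"

lemma alg_indep_cong: "(\<And>v. v \<in> set vs \<Longrightarrow> s v = t v) \<Longrightarrow> alg_indep s vs = alg_indep t vs"
  by (induction vs) (auto cong: tower_cong)

lemma countable_polys_over: assumes "countable S" shows "countable (polys_over S)"
proof (rule countable_image_inj_on)
  show "inj_on coeffs (polys_over S)" by (auto intro!: inj_onI simp: coeffs_eq_iff)
  have "coeffs ` polys_over S \<subseteq> lists S"
    by (auto simp: polys_over_def in_lists_conv_set coeffs_def split: if_splits)
  then show "countable (coeffs ` polys_over S)"
    using countable_lists[OF assms] by (rule countable_subset)
qed

lemma countable_tower: "countable (tower t vs)"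
  by (induction vs) (auto simp: adjoin_def intro: countable_polys_over)

text \<open>Countably many nonzero polynomials have only countably many roots altogether.\<close>

lemma ex_transcendental: assumes "countable S" shows "\<exists>t::real. transcendental S t"
proof -
  have "countable (\<Union>q\<in>polys_over S - {0}. {t::real. poly q t = 0})"
    using assms by (intro countable_UN countable_Diff countable_polys_over)
      (auto intro: countable_finite poly_roots_finite)
  then have "(\<Union>q\<in>polys_over S - {0}. {t::real. poly q t = 0}) \<noteq> UNIV"
    using uncountable_UNIV_real by metis
  then show ?thesis by (auto simp: transcendental_def)
qed

text \<open>Vanishing off \<open>vs\<close> keeps every \<open>t v\<close> in the tower; this
  matters because the cofactor that witnesses coprimality over the rationals may contain other
  variables.\<close>

lemma ex_alg_indep:
  assumes "distinct vs"
  shows "\<exists>t::'v \<Rightarrow> real. alg_indep t vs \<and> (\<forall>v. v \<notin> set vs \<longrightarrow> t v = 0)"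
  using assms
proof (induction vs)
  case Nil then show ?case by auto
next
  case (Cons v vs)
  then obtain t :: "'v \<Rightarrow> real" where t: "alg_indep t vs" "\<forall>v. v \<notin> set vs \<longrightarrow> t v = 0" by auto
  obtain r where r: "transcendental (tower t vs) r" using ex_transcendental[OF countable_tower] by blast
  have "tower (t(v := r)) vs = tower t vs" by (rule tower_cong) (use Cons.prems in auto)
  moreover have "alg_indep (t(v := r)) vs = alg_indep t vs" by (rule alg_indep_cong) (use Cons.prems in auto)
  ultimately have "alg_indep (t(v := r)) (v # vs)" using t r by (simp del: fun_upd_apply add: fun_upd_same)
  moreover have "\<forall>w. w \<notin> set (v # vs) \<longrightarrow> (t(v := r)) w = 0" using t by auto
  ultimately show ?case by blast
qed

text \<open>Transcendence of \<open>t v\<close> forces every evaluated coefficient to vanish, and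
  the coefficients have one variable fewer.\<close>

lemma int_eval_eq_0:
  assumes "alg_indep t vs" "p \<in> tower mvar vs" "int_eval t p = (0::'a::{comm_ring_1, ring_char_0})"
  shows "p = 0"
  using assms
proof (induction vs arbitrary: p)
  case Nil then show ?case by (auto simp: int_eval_of_int)
next
  case (Cons v vs)
  let ?E = "int_eval t"
  interpret E: coeff_hom ?E by (rule coeff_hom_int_eval)
  obtain q where q: "q \<in> polys_over (tower mvar vs)" "p = poly q (mvar v)" using Cons.prems by (auto simp: adjoin_def)
  have "map_poly ?E q \<in> polys_over (tower t vs)"
    using map_poly_polys_over[of ?E q "tower mvar vs", OF E.hom_zero q(1)] by (simp add: tower_image)
  moreover have "poly (map_poly ?E q) (t v) = 0"
    using Cons.prems(3) q poly_hom_eval[OF coeff_hom_int_eval, of t q "mvar v"] by (simp add: int_eval_mvar)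
  ultimately have "map_poly ?E q = 0" using Cons.prems by (auto simp: transcendental_def)
  then have "?E (coeff q i) = 0" for i by (metis coeff_map_poly E.hom_zero coeff_0)
  then have "coeff q i = 0" for i using Cons.IH[OF _ polys_overD[OF q(1)]] Cons.prems by auto
  then have "q = 0" by (intro poly_eqI) auto
  then show ?case using q by simp
qed

lemma int_eval_inj:
  fixes t :: "'v \<Rightarrow> 'a::{comm_ring_1, ring_char_0}"
  assumes "alg_indep t vs" "p \<in> tower mvar vs" "q \<in> tower mvar vs" "int_eval t p = int_eval t q"
  shows "p = q"
  using int_eval_eq_0[OF assms(1), of "p - q"] assms subring_diff[OF is_subring_tower]
  by (auto simp: of_int_hom.poly_eval_diff)

text \<open>A product that is a nonzero constant has factors of degree zero in each variable in
  turn.\<close>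

lemma factor_of_int:
  fixes t :: "'v \<Rightarrow> 'a::{idom, ring_char_0}"
  assumes "alg_indep t vs" "a \<in> tower t vs" "b \<in> tower t vs" "a * b = of_int D" "D \<noteq> 0"
  shows "a \<in> range of_int"
  using assms
proof (induction vs arbitrary: a b)
  case Nil then show ?case by auto
next
  case (Cons v vs)
  let ?S = "tower t vs"
  obtain p where p: "p \<in> polys_over ?S" "a = poly p (t v)" using Cons.prems by (auto simp: adjoin_def)
  obtain q where q: "q \<in> polys_over ?S" "b = poly q (t v)" using Cons.prems by (auto simp: adjoin_def)
  have "p * q - [:of_int D:] \<in> polys_over ?S"
    using p q is_subring_tower[of t vs]
    by (intro subring_diff[of "polys_over _"] subring_mult[of "polys_over _"] is_subring_polys_over
        const_polys_over subring_of_int)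
  moreover have "poly (p * q - [:of_int D:]) (t v) = 0" using p q Cons.prems by simp
  ultimately have "p * q - [:of_int D:] = 0" using Cons.prems(1) unfolding alg_indep.simps transcendental_def by blast
  then have pq: "p * q = [:of_int D:]" by simp
  have nz: "p \<noteq> 0" "q \<noteq> 0" using pq Cons.prems(5) by auto
  have "degree p + degree q = 0" using degree_mult_eq[OF nz] pq by simp
  then obtain a0 b0 where c: "p = [:a0:]" "q = [:b0:]" by (metis add_is_0 degree_eq_zeroE)
  have "a0 \<in> ?S" "b0 \<in> ?S" using polys_overD[OF p(1), of 0] polys_overD[OF q(1), of 0] c by auto
  moreover have "a0 * b0 = of_int D" using pq c by (simp add: mult.commute)
  ultimately show ?case using Cons.IH[of a0 b0] Cons.prems p c by simp
qed

text \<open>A certificate, variable by variable, that \<open>F\<close> has no common factor,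
  containing just what the sieve consumes: an eliminant \<open>R\<close> free of \<open>v\<close> in
  the ideal of \<open>F\<close>, and again a certificate for the coefficients with respect to
  \<open>v\<close>.\<close>

inductive codim2 :: "'v list \<Rightarrow> ('v, int) mpoly set \<Rightarrow> bool" where
  Nil: "finite F \<Longrightarrow> F \<subseteq> range of_int \<Longrightarrow> f \<in> F \<Longrightarrow> f \<noteq> 0 \<Longrightarrow> codim2 [] F"
| Cons: "finite F \<Longrightarrow> (\<And>f. f \<in> F \<Longrightarrow> c f \<in> polys_over (tower mvar vs) \<and> f = poly (c f) (mvar v)) \<Longrightarrow>
    codim2 vs (\<Union>f\<in>F. (\<lambda>i. coeff (c f) i) ` {..degree (c f)}) \<Longrightarrow>
    R \<in> tower mvar vs \<Longrightarrow> R \<noteq> 0 \<Longrightarrow> (\<Sum>f\<in>F. a f * f) = R \<Longrightarrow> codim2 (v # vs) F"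

lemma ufd_in_tower:
  fixes t :: "'v \<Rightarrow> 'a::{idom, ring_char_0}"
  assumes "alg_indep t vs" shows "ufd_in (tower t vs)"
  using assms
proof (induction vs)
  case Nil then show ?case by (auto intro!: ufd_in_Ints simp: inj_def)
next
  case (Cons v vs)
  let ?P = "polys_over (tower t vs)"
  have "ufd_in ((\<lambda>q. poly q (t v)) ` ?P)"
  proof (rule ufd_in_image)
    show "ufd_in ?P" using Cons by (intro ufd_in_polys_over) auto
    show "inj_on (\<lambda>q. poly q (t v)) ?P"
    proof (rule inj_onI)
      fix p q assume "p \<in> ?P" "q \<in> ?P" "poly p (t v) = poly q (t v)"
      then have "p - q \<in> ?P" "poly (p - q) (t v) = 0"
        using subring_diff[OF is_subring_polys_over[OF is_subring_tower]] by auto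
      then show "p = q" using Cons.prems by (auto simp: transcendental_def)
    qed
  qed auto
  then show ?case by (simp add: adjoin_def)
qed

text \<open>The last hypothesis says that the common divisors of \<open>F\<close> are nonzero
  integers. It passes to the family of coefficients, whose common divisors are also common divisors
  of \<open>F\<close>, and it excludes common factors of positive degree in \<open>v\<close>, so
  that \<open>bezout_constant\<close> applies.\<close>

lemma codim2I:
  fixes t :: "'v \<Rightarrow> 'a::{idom, ring_char_0}"
  assumes "alg_indep t vs" "finite F" "F \<subseteq> tower mvar vs"
    and "\<And>h. h \<in> tower t vs \<Longrightarrow> (\<And>f. f \<in> F \<Longrightarrow> dvd_in (tower t vs) h (int_eval t f)) \<Longrightarrow> h \<in> range of_int - {0}"
  shows "codim2 vs F"
  using assms
proof (induction vs arbitrary: F)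
  case Nil
  have "\<exists>f\<in>F. f \<noteq> 0"
  proof (rule ccontr)
    assume "\<not> ?thesis"
    \<comment> \<open>If all members vanished, \<open>0\<close> would be a common divisor.\<close>
    then have "(0::'a) \<in> range of_int - {0}"
      by (intro Nil(4)) (auto simp: dvd_in_def of_int_hom.poly_eval_zero intro: range_eqI[of _ _ 0])
    then show False by simp
  qed
  then show ?case using Nil by (auto intro: codim2.Nil)
next
  case (Cons v vs)
  let ?E = "int_eval t" let ?S = "tower t vs" let ?Z = "tower mvar vs"
  interpret E: coeff_hom ?E by (rule coeff_hom_int_eval)
  note S = is_subring_tower[of t vs]
  note PS = is_subring_polys_over[OF S]
  note S' = is_subring_tower[of t "v # vs"]
  have ai: "alg_indep t vs" "transcendental ?S (t v)" using Cons.prems by auto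
  have "\<forall>f\<in>F. \<exists>c. c \<in> polys_over ?Z \<and> f = poly c (mvar v)"
    using Cons.prems(3) by (auto simp: adjoin_def)
  then obtain c where c: "\<And>f. f \<in> F \<Longrightarrow> c f \<in> polys_over ?Z \<and> f = poly (c f) (mvar v)" by metis
  define G where "G = (\<lambda>f. map_poly ?E (c f))"
  have G: "G f \<in> polys_over ?S" "?E f = poly (G f) (t v)" if "f \<in> F" for f
    using map_poly_polys_over[of ?E "c f" ?Z, OF E.hom_zero] c[OF that]
      poly_hom_eval[OF coeff_hom_int_eval, of t "c f" "mvar v"]
    by (auto simp: G_def tower_image int_eval_mvar)
  have dvd_poly: "h \<in> range of_int - {0}" if hq: "q \<in> polys_over ?S" "h = poly q (t v)"
    "\<And>f. f \<in> F \<Longrightarrow> dvd_in (polys_over ?S) q (G f)" for h q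
  proof (rule Cons.prems(4))
    show "h \<in> tower t (v # vs)" using hq by (auto simp: adjoin_def)
    fix f assume f: "f \<in> F"
    obtain k where "k \<in> polys_over ?S" "G f = q * k" using hq(3)[OF f] by (auto simp: dvd_in_def)
    then show "dvd_in (tower t (v # vs)) h (?E f)" using G(2)[OF f] hq
      unfolding dvd_in_def by (intro bexI[of _ "poly k (t v)"]) (auto simp: adjoin_def)
  qed
  have inj: "inj_on G F"
  proof (rule inj_onI)
    fix f g assume fg: "f \<in> F" "g \<in> F" "G f = G g"
    then have "?E f = ?E g" using G by simp
    then show "f = g" using fg Cons.prems by (intro int_eval_inj[OF Cons.prems(1)]) auto
  qed
  have nz: "\<exists>g\<in>G ` F. g \<noteq> 0"
  proof (rule ccontr)
    assume "\<not> ?thesis"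
    then have "(0::'a) \<in> range of_int - {0}"
      using subring_zero[OF PS] by (intro dvd_poly[of 0]) (auto simp: dvd_in_def)
    then show False by simp
  qed
  \<comment> \<open>The value of \<open>h\<close> at \<open>t v\<close> is an integer, so by
    transcendence \<open>h\<close> is that constant.\<close>
  have dg: "degree h = 0" if h: "h \<in> polys_over ?S" "\<And>g. g \<in> G ` F \<Longrightarrow> dvd_in (polys_over ?S) h g" for h
  proof -
    have "poly h (t v) \<in> range of_int - {0}" using h by (intro dvd_poly[of h]) auto
    then obtain n where n: "poly h (t v) = of_int n" by auto
    have "h - [:of_int n:] \<in> polys_over ?S"
      by (intro subring_diff[OF PS] h const_polys_over S subring_of_int)
    moreover have "poly (h - [:of_int n:]) (t v) = 0" using n by simp
    ultimately have "h - [:of_int n:] = 0" using ai(2) unfolding transcendental_def by blast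
    then show ?thesis by simp
  qed
  have GF: "finite (G ` F)" "G ` F \<subseteq> polys_over ?S" using Cons.prems(2) G by auto
  obtain a R where a: "\<And>g. g \<in> G ` F \<Longrightarrow> a g \<in> polys_over ?S" "R \<in> ?S" "R \<noteq> 0" "(\<Sum>g\<in>G ` F. a g * g) = [:R:]"
    using bezout_constant[OF ufd_in_tower[OF ai(1)] GF nz dg] by blast
  have "R \<in> ?E ` ?Z" using a(2) by (simp add: tower_image)
  then obtain R' where R': "R' \<in> ?Z" "?E R' = R" by blast
  \<comment> \<open>The Bezout identity was found for values at \<open>t\<close>; its cofactors are
    pulled back to polynomials.\<close>
  have "\<forall>f\<in>F. \<exists>A. A \<in> tower mvar (v # vs) \<and> ?E A = poly (a (G f)) (t v)"
  proof
    fix f assume "f \<in> F"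
    then have "poly (a (G f)) (t v) \<in> tower t (v # vs)" using a(1) by (auto simp: adjoin_def)
    then have "poly (a (G f)) (t v) \<in> ?E ` tower mvar (v # vs)" by (simp only: tower_image)
    then show "\<exists>A. A \<in> tower mvar (v # vs) \<and> ?E A = poly (a (G f)) (t v)" by force
  qed
  then obtain A where A: "\<And>f. f \<in> F \<Longrightarrow> A f \<in> tower mvar (v # vs) \<and> ?E (A f) = poly (a (G f)) (t v)" by metis
  have "?E (\<Sum>f\<in>F. A f * f) = (\<Sum>f\<in>F. poly (a (G f)) (t v) * poly (G f) (t v))"
    using A G by (simp add: of_int_hom.poly_eval_sum of_int_hom.poly_eval_mult)
  also have "\<dots> = poly (\<Sum>g\<in>G ` F. a g * g) (t v)"
    by (simp add: sum.reindex[OF inj] poly_sum)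
  also have "\<dots> = ?E R'" by (simp add: a(4) R')
  finally have "(\<Sum>f\<in>F. A f * f) = R'"
  proof (rule int_eval_inj[OF Cons.prems(1), rotated 2])
    show "(\<Sum>f\<in>F. A f * f) \<in> tower mvar (v # vs)"
      using A Cons.prems(3) by (intro subring_sum[OF is_subring_tower] subring_mult[OF is_subring_tower]) auto
    show "R' \<in> tower mvar (v # vs)" using R'(1) by (auto intro: adjoin_base is_subring_tower)
  qed
  moreover have "codim2 vs (\<Union>f\<in>F. (\<lambda>i. coeff (c f) i) ` {..degree (c f)})"
  proof (rule Cons.IH[OF ai(1)])
    show "finite (\<Union>f\<in>F. (\<lambda>i. coeff (c f) i) ` {..degree (c f)})" using Cons.prems by auto
    show "(\<Union>f\<in>F. (\<lambda>i. coeff (c f) i) ` {..degree (c f)}) \<subseteq> ?Z" using c by (auto simp: polys_over_def)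
    fix h assume h: "h \<in> ?S" "\<And>k. k \<in> (\<Union>f\<in>F. (\<lambda>i. coeff (c f) i) ` {..degree (c f)}) \<Longrightarrow> dvd_in ?S h (?E k)"
    have "dvd_in (polys_over ?S) [:h:] (G f)" if f: "f \<in> F" for f
      unfolding dvd_in_const_iff[OF S G(1)[OF f]]
    proof
      fix i show "dvd_in ?S h (coeff (G f) i)"
      proof (cases "i \<le> degree (c f)")
        case True
        then show ?thesis using h(2)[of "coeff (c f) i"] f by (auto simp: G_def coeff_map_poly E.hom_zero)
      next
        case False
        then show ?thesis using subring_zero[OF S]
          by (auto simp: G_def coeff_map_poly E.hom_zero coeff_eq_0 dvd_in_def intro!: bexI[of _ 0])
      qed
    qed
    then show "h \<in> range of_int - {0}" using const_polys_over[OF S h(1)] by (intro dvd_poly[of "[:h:]"]) auto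
  qed
  moreover have "R' \<noteq> 0" using R' a(3) by (auto simp: of_int_hom.poly_eval_zero)
  ultimately show ?case using codim2.Cons[OF Cons.prems(2) c _ R'(1)] by blast
qed

text \<open>The denominators of the finitely many coefficients are cleared one monomial at a
  time.\<close>

lemma rat_eval_mem:
  fixes x :: "'v \<Rightarrow> 'a::{field_char_0}"
  assumes S: "is_subring S" and "\<And>v. x v \<in> S"
  shows "\<exists>D>0. of_int D * poly_eval of_rat x p \<in> S"
proof -
  have mon: "mon_eval x m \<in> S" for m
    unfolding mon_eval_def using assms by (intro subring_prod[OF S] subring_power[OF S])
  have "\<exists>D>0. of_int D * (\<Sum>m\<in>K. of_rat (c m) * mon_eval x m) \<in> S" if "finite K" for K and c :: "('v \<Rightarrow>\<^sub>0 nat) \<Rightarrow> rat"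
    using that
  proof induction
    case empty then show ?case using subring_zero[OF S] by (auto intro!: exI[of _ 1])
  next
    case (insert m K)
    obtain D where D: "D > 0" "of_int D * (\<Sum>m\<in>K. of_rat (c m) * mon_eval x m) \<in> S" using insert by blast
    obtain a b where ab: "quotient_of (c m) = (a, b)" by (cases "quotient_of (c m)")
    have b: "b > 0" "c m = of_int a / of_int b"
      using quotient_of_denom_pos[OF ab] quotient_of_div[OF ab] by auto
    have "of_int b * of_rat (c m) = (of_int a :: 'a)" using b by (simp add: of_rat_divide)
    then have e: "of_int (D * b) * (of_rat (c m) * y) = of_int (D * a) * y" for y :: 'a
      by (simp add: mult.assoc flip: mult.assoc[of "of_int b"])
    have "of_int (D * b) * (\<Sum>m\<in>insert m K. of_rat (c m) * mon_eval x m) =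
      of_int (D * a) * mon_eval x m + of_int b * (of_int D * (\<Sum>m\<in>K. of_rat (c m) * mon_eval x m))"
      unfolding sum.insert[OF insert(1,2)] distrib_left e by (simp add: mult_ac)
    also have "\<dots> \<in> S" using D mon by (intro subring_add[OF S] subring_mult[OF S _ mon] subring_mult[OF S _ D(2)] subring_of_int[OF S])
    finally show ?case using D b by (intro exI[of _ "D * b"]) auto
  qed
  from this[OF finite_keys] show ?thesis unfolding poly_eval_def .
qed

text \<open>By injectivity of evaluation a common divisor \<open>h\<close> in the tower comes from a
  polynomial \<open>H\<close> dividing \<open>f\<close> and \<open>g\<close>. Then \<open>H\<close>
  is a unit over the rationals, and clearing denominators makes \<open>h\<close> a divisor of a
  positive integer, hence an integer.\<close>

theorem coprime_imp_codim2:
  fixes f g :: "('v, int) mpoly"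
  assumes vs: "distinct vs" "mvars f \<subseteq> set vs" "mvars g \<subseteq> set vs" and fg: "coprime_Q f g"
  shows "codim2 vs {f, g}"
proof -
  obtain t :: "'v \<Rightarrow> real" where t: "alg_indep t vs" "\<And>v. v \<notin> set vs \<Longrightarrow> t v = 0" using ex_alg_indep[OF vs(1)] by auto
  note S = is_subring_tower[of t vs]
  have tS: "t v \<in> tower t vs" for v using tower_gen[of v vs t] t(2)[of v] subring_zero[OF S] by metis
  interpret R: coeff_hom "of_rat :: rat \<Rightarrow> real" by unfold_locales (auto simp: of_rat_add of_rat_mult)
  show ?thesis
  proof (rule codim2I[OF t(1)])
    show "{f, g} \<subseteq> tower mvar vs" using vs mem_tower_mvar by auto
    fix h assume h: "h \<in> tower t vs" "\<And>k. k \<in> {f, g} \<Longrightarrow> dvd_in (tower t vs) h (int_eval t k)"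
    from h(1) have "h \<in> int_eval t ` tower mvar vs" by (simp only: tower_image)
    then obtain H where H: "H \<in> tower mvar vs" "h = int_eval t H" by blast
    have "to_rat_poly H dvd to_rat_poly k" if k: "k \<in> {f, g}" for k
    proof -
      obtain l where l: "l \<in> tower t vs" "int_eval t k = h * l" using h(2)[OF k] by (auto simp: dvd_in_def)
      from l(1) have "l \<in> int_eval t ` tower mvar vs" by (simp only: tower_image)
      then obtain L where L: "L \<in> tower mvar vs" "l = int_eval t L" by blast
      have "k = H * L"
      proof (rule int_eval_inj[OF t(1)])
        show "k \<in> tower mvar vs" using k vs mem_tower_mvar by auto
        show "H * L \<in> tower mvar vs" by (intro subring_mult[OF is_subring_tower] H L)
        show "int_eval t k = int_eval t (H * L)" using l H L by (simp add: of_int_hom.poly_eval_mult)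
      qed
      then show ?thesis by (simp add: to_rat_poly_mult)
    qed
    then have "to_rat_poly H dvd 1" using fg by (auto simp: coprime_Q_def)
    then obtain K where K: "1 = to_rat_poly H * K" by (auto simp: dvd_def)
    have hK: "h * poly_eval of_rat t K = 1"
    proof -
      have "h * poly_eval of_rat t K = poly_eval of_rat t (to_rat_poly H * K)"
        by (simp only: R.poly_eval_mult poly_eval_to_rat H(2))
      also have "\<dots> = 1" by (simp only: K[symmetric] R.poly_eval_one)
      finally show ?thesis .
    qed
    obtain D where D: "D > 0" "of_int D * poly_eval of_rat t K \<in> tower t vs"
      using rat_eval_mem[where x = t and p = K, OF S tS] by blast
    have hD: "h * (of_int D * poly_eval of_rat t K) = of_int D"
      by (subst mult.left_commute) (simp only: hK mult_1_right)
    then have "h \<in> range of_int" using factor_of_int[OF t(1) h(1) D(2) hD] D(1) by simp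
    moreover have "h \<noteq> 0" using hD D(1) by auto
    ultimately show "h \<in> range of_int - {0}" by simp
  qed auto
qed

section \<open>The geometric sieve in dyadic boxes\<close>

\<comment> \<open>Over the integers this rule would rewrite \<open>int_eval\<close> out of the reach of \<open>of_int_hom\<close>.\<close>
declare of_int_eq_id [simp del]

section \<open>Prime divisors and a tail sum over primes\<close>

lemma prod_primes_dvd:
  fixes n :: nat
  assumes "finite P" "\<And>p. p \<in> P \<Longrightarrow> prime p \<and> p dvd n"
  shows "\<Prod>P dvd n"
  using assms
proof (induction P)
  case (insert p P)
  have "coprime p (\<Prod>P)" using insert by (intro prod_coprime_right primes_coprime) auto
  then show ?case using insert by (auto intro: divides_mult)
qed auto

lemma card_prime_divisors_le:
  fixes n :: nat
  assumes "n > 0" "finite P" "\<And>p. p \<in> P \<Longrightarrow> prime p \<and> p dvd n"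
  shows "real (card P) * ln 2 \<le> ln (real n)"
proof -
  have "2 ^ card P \<le> \<Prod>P"
    using prod_mono[of P "\<lambda>_. 2" "\<lambda>p. p"] assms(3) by (auto simp: prime_ge_2_nat)
  also have "\<dots> \<le> n" using prod_primes_dvd[OF assms(2,3)] assms(1) by (auto intro: dvd_imp_le)
  finally have "real (2 ^ card P) \<le> real n" by (simp only: of_nat_le_iff)
  then have "ln (2 ^ card P) \<le> ln (real n)" by (subst ln_le_cancel_iff) (use assms in auto)
  then show ?thesis by (simp add: ln_realpow)
qed

text \<open>Chebyshev's argument: these primes all divide the central binomial coefficient, which is
  at most \<open>4 ^ m\<close>.\<close>

lemma card_primes_dyadic:
  fixes m :: nat
  assumes m: "m \<ge> 2"
  shows "real (card {p. prime p \<and> m < p \<and> p \<le> 2 * m}) * ln (real m) \<le> real m * ln 4"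
proof -
  let ?P = "{p. prime p \<and> m < p \<and> p \<le> 2 * m}"
  have fin: "finite ?P" by (rule finite_subset[of _ "{..2 * m}"]) auto
  have "m ^ card ?P \<le> \<Prod>?P"
    using prod_mono[of ?P "\<lambda>_. m" "\<lambda>p. p"] by auto
  also have "\<Prod>?P dvd (2 * m) choose m"
  proof (rule prod_primes_dvd[OF fin])
    fix p assume p: "p \<in> ?P"
    have "p dvd fact (2 * m)" using p by (simp add: prime_dvd_fact_iff)
    also have "fact (2 * m) = fact m * fact m * ((2 * m) choose m)"
      using binomial_fact_lemma[of m "2 * m"] by simp
    finally show "prime p \<and> p dvd (2 * m) choose m"
      using p by (auto simp: prime_dvd_mult_iff prime_dvd_fact_iff)
  qed
  then have "\<Prod>?P \<le> (2 * m) choose m" by (rule dvd_imp_le) auto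
  also have "\<dots> \<le> 2 ^ (2 * m)" by (rule binomial_le_pow2)
  also have "\<dots> = 4 ^ m" by (simp add: power_mult)
  finally have "real (m ^ card ?P) \<le> real (4 ^ m)" by (simp only: of_nat_le_iff)
  then have "ln (real m ^ card ?P) \<le> ln (4 ^ m)" using m by (subst ln_le_cancel_iff) auto
  then show ?thesis using m by (simp add: ln_realpow)
qed

text \<open>The block from \<open>N * 2 ^ j\<close> to twice that contributes at most
  \<open>ln 4 / (N ln N)\<close> times \<open>2 ^ - j\<close>, whence the term
  \<open>2 * ln 4\<close>. The point \<open>N\<close> lies in no block and accounts for the
  \<open>1\<close>.\<close>

lemma sum_inverse_prime_squares:
  fixes N :: nat
  assumes N: "N \<ge> 2" and P: "finite P" "\<And>p. p \<in> P \<Longrightarrow> prime p \<and> N \<le> p"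
  shows "(\<Sum>p\<in>P. 1 / (real p)\<^sup>2) \<le> (1 + 2 * ln 4) / (real N * ln (real N))"
proof -
  let ?Q = "\<lambda>j. {p. prime p \<and> N * 2 ^ j < p \<and> p \<le> 2 * (N * 2 ^ j)}"
  have finQ: "finite (?Q j)" for j by (rule finite_subset[of _ "{..2 * (N * 2 ^ j)}"]) auto
  have lnN: "ln (real N) > 0" using N by simp
  have Qle: "(\<Sum>p\<in>?Q j. 1 / (real p)\<^sup>2) \<le> ln 4 / (real N * ln (real N)) * (1 / 2) ^ j" for j
  proof -
    let ?m = "N * 2 ^ j"
    have m1: "?m \<ge> N" by simp
    then have m: "?m \<ge> 2" "real ?m \<ge> real N" "real ?m > 0" using N by (auto simp only: of_nat_le_iff of_nat_0_less_iff)
    have m2: "1 < real ?m" using m(2) N by linarith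
    have lnm: "ln (real ?m) \<ge> ln (real N)" using m N by (subst ln_le_cancel_iff) auto
    have "(\<Sum>p\<in>?Q j. 1 / (real p)\<^sup>2) \<le> (\<Sum>p\<in>?Q j. 1 / (real ?m)\<^sup>2)"
    proof (rule sum_mono)
      fix p assume "p \<in> ?Q j"
      then have "real ?m \<le> real p" by (simp only: of_nat_le_iff mem_Collect_eq) linarith
      then show "1 / (real p)\<^sup>2 \<le> 1 / (real ?m)\<^sup>2"
        using m(3) by (intro divide_left_mono power_mono mult_pos_pos zero_less_power) linarith+
    qed
    also have "\<dots> = real (card (?Q j)) * (1 / (real ?m)\<^sup>2)" by simp
    also have "\<dots> \<le> (real ?m * ln 4 / ln (real ?m)) * (1 / (real ?m)\<^sup>2)"
      using card_primes_dyadic[OF m(1)] lnm lnN by (intro mult_right_mono) (auto simp: field_simps)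
    also have "\<dots> = ln 4 / (real ?m * ln (real ?m))"
      using m by (simp add: power2_eq_square)
    also have "\<dots> \<le> ln 4 / (real ?m * ln (real N))"
      using lnm lnN m m2 by (intro divide_left_mono mult_left_mono mult_pos_pos) auto
    also have "\<dots> = ln 4 / (real N * ln (real N)) * (1 / 2) ^ j" by (simp add: field_simps)
    finally show ?thesis .
  qed
  \<comment> \<open>A bound for \<open>P\<close> also bounds the block indices, because
    \<open>p \<le> N * 2 ^ p\<close>.\<close>
  obtain J where J: "\<And>p. p \<in> P \<Longrightarrow> p \<le> J" using P(1) finite_nat_set_iff_bounded_le by auto
  have cover: "P \<subseteq> insert N (\<Union>j<J. ?Q j)"
  proof
    fix p assume p: "p \<in> P"
    show "p \<in> insert N (\<Union>j<J. ?Q j)"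
    proof (cases "p = N")
      case False
      then have pN: "N < p" using P(2)[OF p] by auto
      define i where "i = (LEAST i. p \<le> N * 2 ^ i)"
      have ex: "p \<le> N * 2 ^ p" using N less_exp[of p] mult_le_mono[of 1 N p "2 ^ p"] by simp
      have i: "p \<le> N * 2 ^ i" unfolding i_def by (rule LeastI[of "\<lambda>i. p \<le> N * 2 ^ i" p, OF ex])
      have ip: "i \<le> p" unfolding i_def by (rule Least_le[of "\<lambda>i. p \<le> N * 2 ^ i" p, OF ex])
      obtain j where j: "i = Suc j" using i pN by (cases i) auto
      have "\<not> p \<le> N * 2 ^ j" using not_less_Least[of j "\<lambda>i. p \<le> N * 2 ^ i"] j unfolding i_def by auto
      then have "p \<in> ?Q j" using i j P(2)[OF p] by (auto simp: mult_ac)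
      moreover have "j < J" using ip j J[OF p] by simp
      ultimately show ?thesis by blast
    qed auto
  qed
  have "(\<Sum>p\<in>P. 1 / (real p)\<^sup>2) \<le> (\<Sum>p\<in>insert N (\<Union>j<J. ?Q j). 1 / (real p)\<^sup>2)"
    using cover finQ by (intro sum_mono2) auto
  also have "\<dots> \<le> 1 / (real N)\<^sup>2 + (\<Sum>p\<in>(\<Union>j<J. ?Q j). 1 / (real p)\<^sup>2)"
    using finQ by (subst sum.insert_if) auto
  also have "(\<Sum>p\<in>(\<Union>j<J. ?Q j). 1 / (real p)\<^sup>2) \<le> (\<Sum>j<J. \<Sum>p\<in>?Q j. 1 / (real p)\<^sup>2)"
  proof (induction J)
    case (Suc J)
    have "(\<Sum>p\<in>(\<Union>j<J. ?Q j) \<inter> ?Q J. 1 / (real p)\<^sup>2) \<ge> 0" by (intro sum_nonneg) auto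
    moreover have "(\<Sum>p\<in>(\<Union>j<J. ?Q j) \<union> ?Q J. 1 / (real p)\<^sup>2) = (\<Sum>p\<in>(\<Union>j<J. ?Q j). 1 / (real p)\<^sup>2) +
        (\<Sum>p\<in>?Q J. 1 / (real p)\<^sup>2) - (\<Sum>p\<in>(\<Union>j<J. ?Q j) \<inter> ?Q J. 1 / (real p)\<^sup>2)"
      by (intro sum_Un finite_UN_I finQ) auto
    moreover have "(\<Union>j<Suc J. ?Q j) = (\<Union>j<J. ?Q j) \<union> ?Q J" by (auto simp: lessThan_Suc)
    ultimately show ?case using Suc by simp
  qed simp
  also have "\<dots> \<le> (\<Sum>j<J. ln 4 / (real N * ln (real N)) * (1 / 2) ^ j)"
    by (intro sum_mono Qle)
  also have "\<dots> = ln 4 / (real N * ln (real N)) * (\<Sum>j<J. (1 / 2) ^ j)"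
    by (simp add: sum_distrib_left)
  also have "\<dots> \<le> ln 4 / (real N * ln (real N)) * 2"
  proof (intro mult_left_mono)
    show "(\<Sum>j<J. (1 / 2 :: real) ^ j) \<le> 2" by (subst geometric_sum) auto
  qed (use lnN in auto)
  also have "1 / (real N)\<^sup>2 \<le> 1 / (real N * ln (real N))"
    using N lnN ln_le_minus_one[of "real N"] unfolding power2_eq_square
    by (intro divide_left_mono mult_left_mono mult_pos_pos) auto
  finally show ?thesis by (simp add: add_divide_distrib mult.commute)
qed

section \<open>Dyadic boxes and fibres over one coordinate\<close>

definition dyadic :: "nat \<Rightarrow> nat set" where
  "dyadic j = {2 ^ j..<2 ^ Suc j}"

lemma card_dyadic: "card (dyadic j) = 2 ^ j" and finite_dyadic: "finite (dyadic j)"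
  by (auto simp: dyadic_def)

definition dyadic_box :: "('v \<Rightarrow> nat) \<Rightarrow> 'v set \<Rightarrow> ('v \<Rightarrow> nat) set" where
  "dyadic_box k V = PiE V (\<lambda>v. dyadic (k v))"

definition vol :: "('v \<Rightarrow> nat) \<Rightarrow> 'v set \<Rightarrow> real" where
  "vol k V = (\<Prod>v\<in>V. 2 ^ k v)"

lemma finite_dyadic_box: "finite V \<Longrightarrow> finite (dyadic_box k V)"
  unfolding dyadic_box_def by (intro finite_PiE finite_dyadic)

lemma card_dyadic_box: "finite V \<Longrightarrow> real (card (dyadic_box k V)) = vol k V"
  by (simp add: dyadic_box_def vol_def card_PiE card_dyadic)

lemma vol_pos: "vol k V > 0"
  by (auto simp: vol_def intro: prod_pos)

lemma vol_insert: "finite V \<Longrightarrow> v \<notin> V \<Longrightarrow> vol k (insert v V) = 2 ^ k v * vol k V"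
  by (simp add: vol_def)

abbreviation val :: "('v \<Rightarrow> nat) \<Rightarrow> ('v, int) mpoly \<Rightarrow> int" where
  "val x \<equiv> int_eval (\<lambda>v. int (x v))"

text \<open>Membership in the tower plays the part of the statement that only variables of
  \<open>vs\<close> occur.\<close>

lemma int_eval_cong:
  assumes "p \<in> tower mvar vs" "\<And>v. v \<in> set vs \<Longrightarrow> x v = y v"
  shows "int_eval x p = int_eval y p"
  using assms
proof (induction vs arbitrary: p)
  case Nil then show ?case by (auto simp: int_eval_of_int)
next
  case (Cons v vs)
  obtain q where q: "q \<in> polys_over (tower mvar vs)" "p = poly q (mvar v)"
    using Cons.prems by (auto simp: adjoin_def)
  have "map_poly (int_eval x) q = map_poly (int_eval y) q"
    using Cons.IH[OF polys_overD[OF q(1)]] Cons.prems(2)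
    by (intro poly_eqI) (simp add: coeff_map_poly of_int_hom.poly_eval_zero)
  then show ?case
    using poly_hom_eval[OF coeff_hom_int_eval, of x q "mvar v"] poly_hom_eval[OF coeff_hom_int_eval, of y q "mvar v"]
      q Cons.prems(2) by (simp add: int_eval_mvar)
qed

text \<open>The induction step of all the box counts: over \<open>A\<close> the whole fibre is
  conceded, elsewhere a fibre has at most \<beta> points and is empty off \<open>B\<close>.\<close>

lemma card_dyadic_box_fibre:
  assumes V: "finite V" "v \<notin> V" and \<beta>: "\<beta> \<ge> 0"
    and fib: "\<And>y. y \<in> dyadic_box k V \<Longrightarrow> \<not> A y \<Longrightarrow>
      real (card {z \<in> dyadic (k v). P (y(v := z))}) \<le> (if B y then \<beta> else 0)"
  shows "real (card {x \<in> dyadic_box k (insert v V). P x}) \<le>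
    2 ^ k v * real (card {y \<in> dyadic_box k V. A y}) + \<beta> * real (card {y \<in> dyadic_box k V. B y})"
proof -
  let ?F = "\<lambda>y. {z \<in> dyadic (k v). P (y(v := z))}"
  have "{x \<in> dyadic_box k (insert v V). P x} = (\<lambda>(y, z). y(v := z)) ` (SIGMA y:dyadic_box k V. ?F y)"
    unfolding dyadic_box_def PiE_insert_eq by force
  then have "card {x \<in> dyadic_box k (insert v V). P x} \<le> card (SIGMA y:dyadic_box k V. ?F y)"
    by (auto intro!: card_image_le finite_SigmaI finite_dyadic_box V simp: finite_dyadic)
  also have "\<dots> = (\<Sum>y\<in>dyadic_box k V. card (?F y))"
    by (intro card_SigmaI ballI finite_dyadic_box V) (simp add: finite_dyadic)
  finally have "real (card {x \<in> dyadic_box k (insert v V). P x}) \<le> (\<Sum>y\<in>dyadic_box k V. real (card (?F y)))"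
    by (simp flip: of_nat_sum)
  also have "\<dots> \<le> (\<Sum>y\<in>dyadic_box k V. (if A y then 2 ^ k v else 0) + (if B y then \<beta> else 0))"
  proof (rule sum_mono)
    fix y assume y: "y \<in> dyadic_box k V"
    show "real (card (?F y)) \<le> (if A y then 2 ^ k v else 0) + (if B y then \<beta> else 0)"
    proof (cases "A y")
      case True
      have "card (?F y) \<le> card (dyadic (k v))" by (intro card_mono) (auto simp: finite_dyadic)
      then have "real (card (?F y)) \<le> 2 ^ k v" by (simp add: card_dyadic)
      then show ?thesis using True \<beta> by (simp add: add_increasing2)
    next
      case False
      then show ?thesis using fib[OF y] by auto
    qed
  qed
  also have "\<dots> = 2 ^ k v * real (card {y \<in> dyadic_box k V. A y}) + \<beta> * real (card {y \<in> dyadic_box k V. B y})"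
    using V by (simp add: sum.distrib sum.If_cases finite_dyadic_box Int_def mult.commute)
  finally show ?thesis .
qed

text \<open>The modulus \<open>0\<close> is admitted so that the same bounds also count integral zeros.\<close>

definition modulus :: "int \<Rightarrow> real \<Rightarrow> bool" where
  "modulus m M \<longleftrightarrow> M \<ge> 1 \<and> (m = 0 \<or> prime m \<and> M \<le> of_int m)"

lemma modulus_mult: "modulus m M \<Longrightarrow> m dvd a * b \<Longrightarrow> m dvd a \<or> m dvd b"
  by (auto simp: modulus_def prime_dvd_mult_iff)

text \<open>A class meets an interval of length \<open>2 ^ j\<close> in at most
  \<open>2 ^ j / M + 1\<close> points, and \<open>M \<le> 2 ^ j\<close> absorbs the
  \<open>1\<close>. For \<open>m = 0\<close> the class is a single point.\<close>

lemma card_dyadic_class: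
  assumes m: "modulus m M" and M: "M \<le> 2 ^ j"
  shows "real (card {z \<in> dyadic j. m dvd int z - int z0}) \<le> 2 * 2 ^ j / M"
proof (cases "m = 0")
  case True
  have "{z \<in> dyadic j. m dvd int z - int z0} \<subseteq> {z0}" using True by auto
  then have "card {z \<in> dyadic j. m dvd int z - int z0} \<le> card {z0}" by (intro card_mono) auto
  then have "real (card {z \<in> dyadic j. m dvd int z - int z0}) \<le> 1" by simp
  also have "1 \<le> 2 * 2 ^ j / M" using m M by (auto simp: modulus_def field_simps)
  finally show ?thesis .
next
  case False
  then have p: "prime m" "M \<le> of_int m" "M \<ge> 1" using m by (auto simp: modulus_def)
  define q where "q = nat m"
  have q: "q > 0" "m = int q" using p(1) prime_gt_0_int[of m] by (auto simp: q_def)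
  let ?A = "{z \<in> dyadic j. m dvd int z - int z0}"
  \<comment> \<open>Within one residue class the quotient determines the point.\<close>
  have "inj_on (\<lambda>z. (z - 2 ^ j) div q) ?A"
  proof (rule inj_onI)
    fix z w assume z: "z \<in> ?A" and w: "w \<in> ?A" and e: "(z - 2 ^ j) div q = (w - 2 ^ j) div q"
    have "m dvd int z - int z0" "m dvd int w - int z0" using z w by auto
    then have "m dvd (int z - int z0) - (int w - int z0)" by (rule dvd_diff)
    then have "int q dvd int (z - 2 ^ j) - int (w - 2 ^ j)" using z w q
      by (simp add: dyadic_def of_nat_diff)
    then have "int (z - 2 ^ j) mod int q = int (w - 2 ^ j) mod int q" by (simp add: mod_eq_dvd_iff)
    then have "(z - 2 ^ j) mod q = (w - 2 ^ j) mod q" by (metis of_nat_eq_iff zmod_int)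
    then have "z - 2 ^ j = w - 2 ^ j" using e by (metis div_mult_mod_eq)
    then show "z = w" using z w by (auto simp: dyadic_def)
  qed
  moreover have "(\<lambda>z. (z - 2 ^ j) div q) ` ?A \<subseteq> {..2 ^ j div q}"
    by (auto simp: dyadic_def intro!: div_le_mono)
  ultimately have "card ?A \<le> card {..(2::nat) ^ j div q}" by (intro card_inj_on_le) auto
  then have "real (card ?A) \<le> real (2 ^ j div q) + 1" by simp
  also have "real (2 ^ j div q) \<le> 2 ^ j / real q" using of_nat_div_le_of_nat[of "2 ^ j" q, where ?'a = real] by simp
  also have "2 ^ j / real q \<le> 2 ^ j / M" using p q by (intro divide_left_mono) auto
  also have "1 \<le> 2 ^ j / M" using p M by (simp add: field_simps)
  finally show ?thesis by (simp add: field_simps)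
qed

text \<open>Lagrange's bound: splitting off one root modulo \<open>m\<close> leaves a polynomial of
  smaller degree, and \<open>m\<close>, prime or zero, divides a product only if it divides a
  factor. Working with integer polynomials treats both kinds of modulus at once.\<close>

lemma card_dyadic_roots:
  assumes m: "modulus m M" and M: "M \<le> 2 ^ j" and "degree q \<le> n" "\<not> m dvd coeff q i"
  shows "real (card {z \<in> dyadic j. m dvd poly q (int z)}) \<le> real n * (2 * 2 ^ j / M)"
  using assms(3,4)
proof (induction n arbitrary: q i)
  case 0
  obtain c where c: "q = [:c:]" using 0 by (metis degree_eq_zeroE le_zero_eq)
  then have "\<not> m dvd c" using 0 by (cases i) auto
  then have e: "{z \<in> dyadic j. m dvd poly q (int z)} = {}" using c by auto
  show ?case unfolding e by simp
next
  case (Suc n)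
  have M1: "M \<ge> 1" using m by (simp add: modulus_def)
  show ?case
  proof (cases "\<exists>z0\<in>dyadic j. m dvd poly q (int z0)")
    case False
    then have e: "{z \<in> dyadic j. m dvd poly q (int z)} = {}" by blast
    show ?thesis unfolding e using M1 by simp
  next
    case True
    then obtain z0 where z0: "z0 \<in> dyadic j" "m dvd poly q (int z0)" by blast
    define r where "r = synthetic_div q (int z0)"
    have qr: "q = [:- int z0, 1:] * r + [:poly q (int z0):]"
      unfolding r_def by (rule synthetic_div_correct'[symmetric])
    have "degree r \<le> n" using Suc.prems unfolding r_def by (simp add: degree_synthetic_div)
    \<comment> \<open>Otherwise \<open>m\<close> would divide all coefficients of \<open>q\<close>,
      since it also divides the remainder.\<close>
    moreover have "\<exists>i. \<not> m dvd coeff r i"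
    proof (rule ccontr)
      assume n: "\<not> ?thesis"
      have "m dvd coeff q i"
      proof (subst qr, cases i)
        case 0 then show "m dvd coeff ([:- int z0, 1:] * r + [:poly q (int z0):]) i"
          using n z0 by (auto simp: coeff_mult_0 intro!: dvd_diff)
      next
        case (Suc l) then show "m dvd coeff ([:- int z0, 1:] * r + [:poly q (int z0):]) i"
          using n by (auto simp: mult_pCons_left)
      qed
      then show False using Suc.prems by simp
    qed
    then obtain i' where "\<not> m dvd coeff r i'" by blast
    ultimately have IH: "real (card {z \<in> dyadic j. m dvd poly r (int z)}) \<le> real n * (2 * 2 ^ j / M)"
      by (rule Suc.IH)
    have "{z \<in> dyadic j. m dvd poly q (int z)} \<subseteq>
      {z \<in> dyadic j. m dvd int z - int z0} \<union> {z \<in> dyadic j. m dvd poly r (int z)}"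
    proof
      fix z assume z: "z \<in> {z \<in> dyadic j. m dvd poly q (int z)}"
      have "poly q (int z) = (int z - int z0) * poly r (int z) + poly q (int z0)"
        using arg_cong[OF qr, of "\<lambda>s. poly s (int z)"] by (simp add: algebra_simps)
      then have "(int z - int z0) * poly r (int z) = poly q (int z) - poly q (int z0)" by simp
      then have "m dvd (int z - int z0) * poly r (int z)" using z z0 by (auto intro: dvd_diff)
      then show "z \<in> {z \<in> dyadic j. m dvd int z - int z0} \<union> {z \<in> dyadic j. m dvd poly r (int z)}"
        using modulus_mult[OF m] z by auto
    qed
    then have "card {z \<in> dyadic j. m dvd poly q (int z)} \<le>
      card ({z \<in> dyadic j. m dvd int z - int z0} \<union> {z \<in> dyadic j. m dvd poly r (int z)})"
      by (intro card_mono) (auto simp: finite_dyadic)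
    also have "\<dots> \<le> card {z \<in> dyadic j. m dvd int z - int z0} + card {z \<in> dyadic j. m dvd poly r (int z)}"
      by (rule card_Un_le)
    finally have "real (card {z \<in> dyadic j. m dvd poly q (int z)}) \<le>
      real (card {z \<in> dyadic j. m dvd int z - int z0}) + real (card {z \<in> dyadic j. m dvd poly r (int z)})"
      by linarith
    also have "\<dots> \<le> 2 * 2 ^ j / M + real n * (2 * 2 ^ j / M)"
      by (intro add_mono card_dyadic_class[OF m M] IH)
    finally show ?thesis by (simp add: algebra_simps add_divide_distrib)
  qed
qed

lemma val_fibre:
  assumes "q \<in> polys_over (tower mvar vs)" "v \<notin> set vs"
  shows "val (y(v := z)) (poly q (mvar v)) = poly (map_poly (val y) q) (int z)"
proof -
  have "map_poly (val (y(v := z))) q = map_poly (val y) q"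
  proof (intro poly_eqI)
    fix i
    have "val (y(v := z)) (coeff q i) = val y (coeff q i)"
      using assms by (intro int_eval_cong[OF polys_overD[OF assms(1)]]) auto
    then show "coeff (map_poly (val (y(v := z))) q) i = coeff (map_poly (val y) q) i"
      by (simp add: coeff_map_poly of_int_hom.poly_eval_zero)
  qed
  then show ?thesis
    using poly_hom_eval[OF coeff_hom_int_eval, of "\<lambda>w. int ((y(v := z)) w)" q "mvar v"]
    by (simp add: int_eval_mvar)
qed

lemma card_fibre_roots:
  assumes m: "modulus m M" "M \<le> 2 ^ j" and q: "q \<in> polys_over (tower mvar vs)" "v \<notin> set vs"
    and n: "degree q \<le> n" "\<not> m dvd val y (coeff q i)"
  shows "real (card {z \<in> dyadic j. m dvd val (y(v := z)) (poly q (mvar v))}) \<le> real n * (2 * 2 ^ j / M)"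
  unfolding val_fibre[OF q]
proof (rule card_dyadic_roots[OF m])
  show "degree (map_poly (val y) q) \<le> n" 
    by (rule order.trans[OF degree_le[of "degree q"] n(1)])
       (auto simp: coeff_map_poly of_int_hom.poly_eval_zero coeff_eq_0)
  show "\<not> m dvd coeff (map_poly (val y) q) i" using n(2) by (simp add: coeff_map_poly of_int_hom.poly_eval_zero)
qed

lemma card_dyadic_box_Nil: "card {x \<in> dyadic_box k {}. P x} \<le> 1"
  by (rule order.trans[OF card_mono[of "{\<lambda>_. undefined}"]]) (auto simp: dyadic_box_def)

text \<open>Where the leading coefficient in \<open>v\<close> survives modulo \<open>m\<close>, the
  fibre has few roots; where it does not, the induction hypothesis for that coefficient
  applies.\<close>

lemma card_zeros_mod:
  assumes "distinct vs" "h \<in> tower mvar vs" "h \<noteq> 0"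
  shows "\<exists>C\<ge>0. \<forall>k m M. modulus m M \<longrightarrow> (\<forall>v\<in>set vs. M \<le> 2 ^ k v) \<longrightarrow>
    real (card {x \<in> dyadic_box k (set vs). m dvd val x h}) \<le> C * vol k (set vs) / M"
  using assms
proof (induction vs arbitrary: h)
  case Nil
  then obtain c where c: "h = of_int c" by auto
  then have c0: "c \<noteq> 0" using Nil by auto
  \<comment> \<open>The box is one point; if \<open>m\<close> divides the nonzero \<open>c\<close>,
    then \<open>M \<le> m \<le> \<bar>c\<bar>\<close>, so the constant pays for it.\<close>
  have "real (card {x \<in> dyadic_box k {}. m dvd val x h}) \<le> real_of_int \<bar>c\<bar> / M" if m: "modulus m M"
    for k :: "'a \<Rightarrow> nat" and m M
  proof (cases "m dvd c")
    case True
    then have "m \<noteq> 0" using c0 by auto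
    then have "M \<le> of_int m" "M \<ge> 1" using m by (auto simp: modulus_def)
    moreover have "m \<le> \<bar>c\<bar>" using True c0 by (simp add: dvd_imp_le_int abs_le_D1)
    ultimately have "1 \<le> real_of_int \<bar>c\<bar> / M" by (simp add: field_simps)
    then show ?thesis using card_dyadic_box_Nil[of k "\<lambda>x. m dvd val x h"] by linarith
  next
    case False
    then have e: "{x \<in> dyadic_box k {}. m dvd val x h} = {}" by (simp add: c int_eval_of_int) (simp add: of_int_eq_id)
    show ?thesis unfolding e using m by (simp add: modulus_def)
  qed
  then show ?case by (intro exI[of _ "real_of_int \<bar>c\<bar>"]) (auto simp: vol_def)
next
  case (Cons v vs)
  obtain q where q: "q \<in> polys_over (tower mvar vs)" "h = poly q (mvar v)" using Cons.prems by (auto simp: adjoin_def)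
  have "lead_coeff q \<noteq> 0" "distinct vs" using q Cons.prems by auto
  from Cons.IH[OF this(2) polys_overD[OF q(1)] this(1)] obtain C where C: "C \<ge> 0" "\<And>k m M. modulus m M \<Longrightarrow> (\<forall>v\<in>set vs. M \<le> 2 ^ k v) \<Longrightarrow>
    real (card {x \<in> dyadic_box k (set vs). m dvd val x (lead_coeff q)}) \<le> C * vol k (set vs) / M"
    by blast
  have "real (card {x \<in> dyadic_box k (set (v # vs)). m dvd val x h}) \<le> (C + 2 * degree q) * vol k (set (v # vs)) / M"
    if m: "modulus m M" and M: "\<forall>v\<in>set (v # vs). M \<le> 2 ^ k v" for k m M
  proof -
    let ?\<beta> = "real (degree q) * (2 * 2 ^ k v / M)"
    have M0: "M > 0" using m by (auto simp: modulus_def)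
    have "real (card {x \<in> dyadic_box k (insert v (set vs)). m dvd val x h}) \<le>
      2 ^ k v * real (card {y \<in> dyadic_box k (set vs). m dvd val y (lead_coeff q)}) + ?\<beta> * real (card {y \<in> dyadic_box k (set vs). True})"
    proof (rule card_dyadic_box_fibre)
      fix y assume "\<not> m dvd val y (lead_coeff q)"
      then show "real (card {z \<in> dyadic (k v). m dvd val (y(v := z)) h}) \<le> (if True then ?\<beta> else 0)"
        using card_fibre_roots[OF m _ q(1), of "k v" v "degree q" y "degree q"] M Cons.prems q(2) by auto
    qed (use Cons.prems M0 in auto)
    also have "\<dots> \<le> 2 ^ k v * (C * vol k (set vs) / M) + ?\<beta> * vol k (set vs)"
      using C(2)[OF m, of k] M M0 by (intro add_mono mult_left_mono) (auto simp: card_dyadic_box)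
    also have "\<dots> = (C + 2 * degree q) * vol k (set (v # vs)) / M"
      using Cons.prems by (simp add: vol_insert algebra_simps add_divide_distrib)
    finally show ?thesis by simp
  qed
  then show ?case using C(1) by (intro exI[of _ "C + 2 * degree q"]) auto
qed

lemma val_bound:
  assumes "p \<in> tower mvar vs"
  obtains C D where "C \<ge> (1::real)"
    "\<And>Y x. Y \<ge> 1 \<Longrightarrow> (\<And>v. v \<in> set vs \<Longrightarrow> real (x v) \<le> Y) \<Longrightarrow> \<bar>real_of_int (val x p)\<bar> \<le> C * Y ^ D"
proof -
  \<comment> \<open>Adding the exponents of all monomials is crude, but bounds the degree of each of
    them.\<close>
  define D where "D = (\<Sum>m\<in>Poly_Mapping.keys p. \<Sum>v\<in>Poly_Mapping.keys m. Poly_Mapping.lookup m v)"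
  define C where "C = 1 + (\<Sum>m\<in>Poly_Mapping.keys p. \<bar>real_of_int (Poly_Mapping.lookup p m)\<bar>)"
  show ?thesis
  proof (rule that[of C D])
    show "C \<ge> 1" unfolding C_def by (auto intro: sum_nonneg)
    fix Y :: real and x :: "'a \<Rightarrow> nat" assume Y: "Y \<ge> 1" and x: "\<And>v. v \<in> set vs \<Longrightarrow> real (x v) \<le> Y"
    \<comment> \<open>Coordinates off \<open>vs\<close> are unbounded; setting them to
      \<open>0\<close> leaves the value of \<open>p\<close> unchanged.\<close>
    define x' where "x' = (\<lambda>v. if v \<in> set vs then x v else 0)"
    have x': "real (x' v) \<le> Y" for v using x Y by (auto simp: x'_def)
    have mon: "\<bar>real_of_int (mon_eval (\<lambda>v. int (x' v)) m)\<bar> \<le> Y ^ D" if m: "m \<in> Poly_Mapping.keys p" for m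
    proof -
      have "\<bar>real_of_int (mon_eval (\<lambda>v. int (x' v)) m)\<bar> = (\<Prod>v\<in>Poly_Mapping.keys m. real (x' v) ^ Poly_Mapping.lookup m v)"
        by (simp add: mon_eval_def abs_prod)
      also have "\<dots> \<le> (\<Prod>v\<in>Poly_Mapping.keys m. Y ^ Poly_Mapping.lookup m v)"
        using x' by (intro prod_mono) (auto intro: power_mono)
      also have "\<dots> = Y ^ (\<Sum>v\<in>Poly_Mapping.keys m. Poly_Mapping.lookup m v)" by (simp add: power_sum)
      also have "\<dots> \<le> Y ^ D" using Y m unfolding D_def
        by (intro power_increasing member_le_sum) auto
      finally show ?thesis .
    qed
    have "val x p = val x' p" by (rule int_eval_cong[OF assms]) (auto simp: x'_def)
    then have "\<bar>real_of_int (val x p)\<bar> = \<bar>\<Sum>m\<in>Poly_Mapping.keys p. real_of_int (Poly_Mapping.lookup p m) *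
        real_of_int (mon_eval (\<lambda>v. int (x' v)) m)\<bar>"
      by (simp add: poly_eval_def of_int_eq_id)
    also have "\<dots> \<le> (\<Sum>m\<in>Poly_Mapping.keys p. \<bar>real_of_int (Poly_Mapping.lookup p m) *
        real_of_int (mon_eval (\<lambda>v. int (x' v)) m)\<bar>)" by (rule sum_abs)
    also have "\<dots> \<le> (\<Sum>m\<in>Poly_Mapping.keys p. \<bar>real_of_int (Poly_Mapping.lookup p m)\<bar> * Y ^ D)"
      unfolding abs_mult by (intro sum_mono mult_left_mono mon) auto
    also have "\<dots> = (\<Sum>m\<in>Poly_Mapping.keys p. \<bar>real_of_int (Poly_Mapping.lookup p m)\<bar>) * Y ^ D"
      by (simp add: sum_distrib_right)
    also have "\<dots> \<le> C * Y ^ D" unfolding C_def using Y by (intro mult_right_mono) auto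
    finally show "\<bar>real_of_int (val x p)\<bar> \<le> C * Y ^ D" .
  qed
qed

section \<open>Ekedahl's sieve for a family without common factor\<close>

lemma card_fibre_common:
  assumes m: "modulus m M" "M \<le> 2 ^ j" and F: "finite F" "f \<in> F"
    and c: "\<And>f. f \<in> F \<Longrightarrow> c f \<in> polys_over (tower mvar vs) \<and> f = poly (c f) (mvar v)"
    and v: "v \<notin> set vs" and n: "\<not> m dvd val y (coeff (c f) i)"
  shows "real (card {z \<in> dyadic j. \<forall>f\<in>F. m dvd val (y(v := z)) f}) \<le>
    real (\<Sum>f\<in>F. degree (c f)) * (2 * 2 ^ j / M)"
proof -
  have "card {z \<in> dyadic j. \<forall>f\<in>F. m dvd val (y(v := z)) f} \<le>
    card {z \<in> dyadic j. m dvd val (y(v := z)) (poly (c f) (mvar v))}"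
    using c[OF F(2)] F(2) by (intro card_mono) (auto simp: finite_dyadic)
  moreover have "real (card {z \<in> dyadic j. m dvd val (y(v := z)) (poly (c f) (mvar v))}) \<le>
    real (\<Sum>f\<in>F. degree (c f)) * (2 * 2 ^ j / M)"
    using c[OF F(2)] F by (intro card_fibre_roots[OF m _ v _ n] member_le_sum) auto
  ultimately show ?thesis by linarith
qed

text \<open>The eliminant is a combination of \<open>F\<close> in which \<open>v\<close> does not
  occur, so any \<open>z\<close> in the fibre imposes a condition on \<open>y\<close> alone.\<close>

lemma dvd_val_eliminant:
  assumes "R \<in> tower mvar vs" "v \<notin> set vs" "(\<Sum>f\<in>F. a f * f) = R"
    and "\<And>f. f \<in> F \<Longrightarrow> m dvd val (y(v := z)) f"
  shows "m dvd val y R"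
proof -
  have "m dvd (\<Sum>f\<in>F. val (y(v := z)) (a f) * val (y(v := z)) f)"
    using assms(4) by (intro dvd_sum dvd_mult) auto
  also have "\<dots> = val (y(v := z)) R"
    unfolding assms(3)[symmetric] of_int_hom.poly_eval_sum of_int_hom.poly_eval_mult ..
  also have "\<dots> = val y R" using assms(2) by (intro int_eval_cong[OF assms(1)]) auto
  finally show ?thesis .
qed

text \<open>Two factors \<open>1 / p\<close> are saved: \<open>y\<close> must be a zero of
  \<open>R\<close> modulo \<open>p\<close>, and then \<open>z\<close> a root of some member of
  \<open>F\<close>. If every coefficient vanishes at \<open>y\<close> modulo \<open>p\<close> the
  second saving fails, but such \<open>y\<close> are rare by induction.\<close>

lemma codim2_count_small:
  assumes "codim2 vs F" "distinct vs"
  shows "\<exists>C\<ge>0. \<forall>k p. prime p \<longrightarrow> (\<forall>v\<in>set vs. real p \<le> 2 ^ k v) \<longrightarrow>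
    real (card {x \<in> dyadic_box k (set vs). \<forall>f\<in>F. int p dvd val x f}) \<le> C * vol k (set vs) / (real p)\<^sup>2"
  using assms
proof (induction rule: codim2.induct)
  case (Nil F f)
  then obtain c where c: "f = of_int c" by auto
  then have c0: "c \<noteq> 0" using Nil by auto
  have "real (card {x \<in> dyadic_box k {}. \<forall>f\<in>F. int p dvd val x f}) \<le> (real_of_int c)\<^sup>2 / (real p)\<^sup>2"
    if p: "prime p" for k :: "'a \<Rightarrow> nat" and p
  proof (cases "int p dvd c")
    case True
    then have "int p \<le> \<bar>c\<bar>" using dvd_imp_le_int[of c "int p"] c0 by simp
    then have "real p \<le> \<bar>real_of_int c\<bar>" by linarith
    then have "(real p)\<^sup>2 \<le> (real_of_int c)\<^sup>2" using power_mono[of "real p" "\<bar>real_of_int c\<bar>" 2] by simp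
    then have "1 \<le> (real_of_int c)\<^sup>2 / (real p)\<^sup>2" using p prime_gt_0_nat by (simp add: field_simps)
    then show ?thesis using card_dyadic_box_Nil[of k "\<lambda>x. \<forall>f\<in>F. int p dvd val x f"] by linarith
  next
    case False
    then have "\<not> int p dvd val x f" for x :: "'a \<Rightarrow> nat" by (simp add: c int_eval_of_int) (simp add: of_int_eq_id)
    then have e: "{x \<in> dyadic_box k {}. \<forall>f\<in>F. int p dvd val x f} = {}" using Nil by blast
    show ?thesis unfolding e by simp
  qed
  then show ?case by (intro exI[of _ "(real_of_int c)\<^sup>2"]) (auto simp: vol_def)
next
  case (Cons F c vs v R a)
  let ?K = "\<Union>f\<in>F. (\<lambda>i. coeff (c f) i) ` {..degree (c f)}"
  define D where "D = real (\<Sum>f\<in>F. degree (c f))"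
  have D0: "D \<ge> 0" unfolding D_def by (rule of_nat_0_le_iff)
  have dist: "distinct vs" "v \<notin> set vs" using Cons.prems by auto
  obtain C1 where C1: "C1 \<ge> 0" "\<And>k p. prime p \<Longrightarrow> (\<forall>v\<in>set vs. real p \<le> 2 ^ k v) \<Longrightarrow>
    real (card {x \<in> dyadic_box k (set vs). \<forall>f\<in>?K. int p dvd val x f}) \<le> C1 * vol k (set vs) / (real p)\<^sup>2"
    using Cons.IH[OF dist(1)] by blast
  obtain C2 where C2: "C2 \<ge> 0" "\<And>k m M. modulus m M \<Longrightarrow> (\<forall>v\<in>set vs. M \<le> 2 ^ k v) \<Longrightarrow>
    real (card {x \<in> dyadic_box k (set vs). m dvd val x R}) \<le> C2 * vol k (set vs) / M"
    using card_zeros_mod[OF dist(1) Cons.hyps(4,5)] by blast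
  have "real (card {x \<in> dyadic_box k (set (v # vs)). \<forall>f\<in>F. int p dvd val x f}) \<le>
      (C1 + 2 * D * C2) * vol k (set (v # vs)) / (real p)\<^sup>2"
    if p: "prime p" and pk: "\<forall>v\<in>set (v # vs). real p \<le> 2 ^ k v" for k p
  proof -
    have p1: "real p \<ge> 1" using prime_ge_1_nat[OF p] by simp
    have m: "modulus (int p) (real p)" using p p1 by (simp add: modulus_def)
    let ?\<beta> = "D * (2 * 2 ^ k v / real p)"
    have "real (card {x \<in> dyadic_box k (insert v (set vs)). \<forall>f\<in>F. int p dvd val x f}) \<le>
      2 ^ k v * real (card {y \<in> dyadic_box k (set vs). \<forall>f\<in>?K. int p dvd val y f}) +
      ?\<beta> * real (card {y \<in> dyadic_box k (set vs). int p dvd val y R})"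
    proof (rule card_dyadic_box_fibre)
      fix y assume "\<not> (\<forall>f\<in>?K. int p dvd val y f)"
      then obtain f i where fi: "f \<in> F" "\<not> int p dvd val y (coeff (c f) i)" by blast
      show "real (card {z \<in> dyadic (k v). \<forall>f\<in>F. int p dvd val (y(v := z)) f}) \<le> (if int p dvd val y R then ?\<beta> else 0)"
      proof (cases "int p dvd val y R")
        case True
        then show ?thesis
          using card_fibre_common[OF m _ Cons.hyps(1) fi(1) Cons.hyps(2) dist(2) fi(2), of "k v", folded D_def] pk by simp
      next
        case False
        then have e: "{z \<in> dyadic (k v). \<forall>f\<in>F. int p dvd val (y(v := z)) f} = {}"
          using dvd_val_eliminant[OF Cons.hyps(4) dist(2) Cons.hyps(6)] by blast
        show ?thesis unfolding e using False by simp
      qed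
    qed (use dist p1 D0 in auto)
    also have "\<dots> \<le> 2 ^ k v * (C1 * vol k (set vs) / (real p)\<^sup>2) + ?\<beta> * (C2 * vol k (set vs) / real p)"
      using C1(2)[OF p, of k] C2(2)[OF m, of k] pk p1 D0 by (intro add_mono mult_left_mono) auto
    also have "\<dots> = (C1 + 2 * D * C2) * vol k (set (v # vs)) / (real p)\<^sup>2"
      using dist p1 by (simp add: vol_insert power2_eq_square field_simps)
    finally show ?thesis by simp
  qed
  moreover have "C1 + 2 * D * C2 \<ge> 0" using C1 C2 D0 by simp
  ultimately show ?case by blast
qed

text \<open>All primes above \<open>M\<close> are treated together. Off the \<open>y\<close> with
  \<open>R = 0\<close> and those where a large prime divides all coefficients, the prime must be one
  of the \<open>O(ln Y)\<close> prime divisors of the nonzero value of \<open>R\<close>, and each of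
  these allows few \<open>z\<close>.\<close>

lemma codim2_count_large:
  assumes "codim2 vs F" "distinct vs"
  shows "\<exists>C\<ge>0. \<forall>k M Y. M \<ge> 1 \<longrightarrow> Y \<ge> 3 \<longrightarrow> (\<forall>v\<in>set vs. M \<le> 2 ^ k v \<and> 2 ^ Suc (k v) \<le> Y) \<longrightarrow>
    real (card {x \<in> dyadic_box k (set vs). \<exists>p. prime p \<and> real p > M \<and> (\<forall>f\<in>F. int p dvd val x f)})
      \<le> C * vol k (set vs) * ln Y / M"
  using assms
proof (induction rule: codim2.induct)
  case (Nil F f)
  then obtain c where c: "f = of_int c" by auto
  then have c0: "c \<noteq> 0" using Nil by auto
  have "real (card {x \<in> dyadic_box k {}. \<exists>p. prime p \<and> real p > M \<and> (\<forall>f\<in>F. int p dvd val x f)}) \<le> real_of_int \<bar>c\<bar> * ln Y / M"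
    if M: "M \<ge> 1" and Y: "Y \<ge> 3" for k :: "'a \<Rightarrow> nat" and M Y
  proof (cases "\<exists>p. prime p \<and> real p > M \<and> int p dvd c")
    case True
    then obtain p where p: "prime p" "real p > M" "int p dvd c" by blast
    then have "int p \<le> \<bar>c\<bar>" using dvd_imp_le_int[of c "int p"] c0 by simp
    then have "M \<le> real_of_int \<bar>c\<bar>" using p(2) by linarith
    moreover have "ln Y \<ge> 1" using Y exp_le by (subst ln_ge_iff) auto
    ultimately have "1 * M \<le> ln Y * real_of_int \<bar>c\<bar>" using M by (intro mult_mono) auto
    then have "1 \<le> real_of_int \<bar>c\<bar> * ln Y / M" using M by (simp add: field_simps)
    then show ?thesis
      using card_dyadic_box_Nil[of k "\<lambda>x. \<exists>p. prime p \<and> real p > M \<and> (\<forall>f\<in>F. int p dvd val x f)"] by linarith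
  next
    case False
    have "val x f = c" for x :: "'a \<Rightarrow> nat" by (simp add: c int_eval_of_int) (simp add: of_int_eq_id)
    then have e: "{x \<in> dyadic_box k {}. \<exists>p. prime p \<and> real p > M \<and> (\<forall>f\<in>F. int p dvd val x f)} = {}"
      using Nil False by fastforce
    show ?thesis unfolding e using M Y by simp
  qed
  then show ?case by (intro exI[of _ "real_of_int \<bar>c\<bar>"]) (auto simp: vol_def)
next
  case (Cons F c vs v R a)
  let ?K = "\<Union>f\<in>F. (\<lambda>i. coeff (c f) i) ` {..degree (c f)}"
  define D where "D = real (\<Sum>f\<in>F. degree (c f))"
  have D0: "D \<ge> 0" unfolding D_def by (rule of_nat_0_le_iff)
  have dist: "distinct vs" "v \<notin> set vs" using Cons.prems by auto
  obtain C1 where C1: "C1 \<ge> 0" "\<And>k M Y. M \<ge> 1 \<Longrightarrow> Y \<ge> 3 \<Longrightarrow> (\<forall>v\<in>set vs. M \<le> 2 ^ k v \<and> 2 ^ Suc (k v) \<le> Y) \<Longrightarrow>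
    real (card {x \<in> dyadic_box k (set vs). \<exists>p. prime p \<and> real p > M \<and> (\<forall>f\<in>?K. int p dvd val x f)})
      \<le> C1 * vol k (set vs) * ln Y / M"
    using Cons.IH[OF dist(1)] by blast
  obtain C2 where C2: "C2 \<ge> 0" "\<And>k m M. modulus m M \<Longrightarrow> (\<forall>v\<in>set vs. M \<le> 2 ^ k v) \<Longrightarrow>
    real (card {x \<in> dyadic_box k (set vs). m dvd val x R}) \<le> C2 * vol k (set vs) / M"
    using card_zeros_mod[OF dist(1) Cons.hyps(4,5)] by blast
  obtain C3 E where C3: "C3 \<ge> (1::real)"
    "\<And>Y x. Y \<ge> 1 \<Longrightarrow> (\<And>v. v \<in> set vs \<Longrightarrow> real (x v) \<le> Y) \<Longrightarrow> \<bar>real_of_int (val x R)\<bar> \<le> C3 * Y ^ E"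
    using val_bound[OF Cons.hyps(4)] by blast
  \<comment> \<open>A nonzero value of \<open>R\<close> is at most \<open>C3 * Y ^ E\<close>, so it
    has at most \<open>ln (C3 * Y ^ E) / ln 2\<close> prime divisors; as \<open>ln Y \<ge> 1\<close>
    this is at most \<open>W * ln Y\<close>.\<close>
  define W where "W = (ln C3 + real E) / ln 2"
  have W0: "W \<ge> 0" using C3(1) by (simp add: W_def)
  have "real (card {x \<in> dyadic_box k (set (v # vs)). \<exists>p. prime p \<and> real p > M \<and> (\<forall>f\<in>F. int p dvd val x f)}) \<le>
      (C1 + C2 + 2 * D * W) * vol k (set (v # vs)) * ln Y / M"
    if M: "M \<ge> 1" and Y: "Y \<ge> 3" and kM: "\<forall>v\<in>set (v # vs). M \<le> 2 ^ k v \<and> 2 ^ Suc (k v) \<le> Y" for k M Y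
  proof -
    have lnY: "ln Y \<ge> 1" using Y exp_le by (subst ln_ge_iff) auto
    have kM': "\<forall>v\<in>set vs. M \<le> 2 ^ k v" "M \<le> 2 ^ k v" using kM by auto
    let ?B = "D * (2 * 2 ^ k v / M)"
    let ?\<beta> = "W * ln Y * ?B"
    \<comment> \<open>Written as divisibility by \<open>0\<close>, the vanishing of \<open>R\<close>
      falls under the count with modulus \<open>0\<close>.\<close>
    let ?A1 = "\<lambda>y. 0 dvd val y R"
    let ?A2 = "\<lambda>y. \<exists>p. prime p \<and> real p > M \<and> (\<forall>f\<in>?K. int p dvd val y f)"
    have "real (card {x \<in> dyadic_box k (insert v (set vs)). \<exists>p. prime p \<and> real p > M \<and> (\<forall>f\<in>F. int p dvd val x f)}) \<le>
      2 ^ k v * real (card {y \<in> dyadic_box k (set vs). ?A1 y \<or> ?A2 y}) +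
      ?\<beta> * real (card {y \<in> dyadic_box k (set vs). True})"
    proof (rule card_dyadic_box_fibre)
      fix y assume y: "y \<in> dyadic_box k (set vs)" and nA: "\<not> (?A1 y \<or> ?A2 y)"
      define P where "P = {p. prime p \<and> real p > M \<and> int p dvd val y R}"
      have R0: "val y R \<noteq> 0" using nA by simp
      have P_dvd: "prime p \<and> p dvd nat \<bar>val y R\<bar>" if "p \<in> P" for p
        using that R0 by (auto simp: P_def)
      have finP: "finite P"
        by (rule finite_subset[of _ "{..nat \<bar>val y R\<bar>}"]) (use P_dvd R0 in \<open>auto intro!: dvd_imp_le\<close>)
      have "real (card P) * ln 2 \<le> ln (real (nat \<bar>val y R\<bar>))"
        using R0 by (intro card_prime_divisors_le finP P_dvd) auto
      also have "real (nat \<bar>val y R\<bar>) = \<bar>real_of_int (val y R)\<bar>" by simp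
      also have "ln \<bar>real_of_int (val y R)\<bar> \<le> ln (C3 * Y ^ E)"
      proof (subst ln_le_cancel_iff)
        show "\<bar>real_of_int (val y R)\<bar> \<le> C3 * Y ^ E"
        proof (rule C3(2))
          fix w assume w: "w \<in> set vs"
          then have "y w \<in> dyadic (k w)" using y by (auto simp: dyadic_box_def)
          then have "y w \<le> 2 ^ Suc (k w)" by (auto simp: dyadic_def)
          then have "real (y w) \<le> real (2 ^ Suc (k w))" by (simp only: of_nat_le_iff)
          also have "\<dots> \<le> Y" using kM w by auto
          finally show "real (y w) \<le> Y" .
        qed (use Y in auto)
      qed (use R0 C3(1) Y in auto)
      also have "\<dots> = ln C3 + real E * ln Y" using C3(1) Y by (simp add: ln_mult ln_realpow)
      also have "\<dots> \<le> ln C3 * ln Y + real E * ln Y"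
        using lnY C3(1) mult_left_mono[of 1 "ln Y" "ln C3"] by simp
      also have "\<dots> = W * ln Y * ln 2" by (simp add: W_def field_simps)
      finally have cardP: "real (card P) \<le> W * ln Y" by simp
      have "{z \<in> dyadic (k v). \<exists>p. prime p \<and> real p > M \<and> (\<forall>f\<in>F. int p dvd val (y(v := z)) f)} \<subseteq>
        (\<Union>p\<in>P. {z \<in> dyadic (k v). \<forall>f\<in>F. int p dvd val (y(v := z)) f})"
        unfolding P_def using dvd_val_eliminant[OF Cons.hyps(4) dist(2) Cons.hyps(6)] by blast
      then have "card {z \<in> dyadic (k v). \<exists>p. prime p \<and> real p > M \<and> (\<forall>f\<in>F. int p dvd val (y(v := z)) f)} \<le>
        card (\<Union>p\<in>P. {z \<in> dyadic (k v). \<forall>f\<in>F. int p dvd val (y(v := z)) f})"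
        by (intro card_mono) (auto simp: finite_dyadic finP)
      also have "\<dots> \<le> (\<Sum>p\<in>P. card {z \<in> dyadic (k v). \<forall>f\<in>F. int p dvd val (y(v := z)) f})"
        by (rule card_UN_le[OF finP])
      finally have "real (card {z \<in> dyadic (k v). \<exists>p. prime p \<and> real p > M \<and> (\<forall>f\<in>F. int p dvd val (y(v := z)) f)}) \<le>
        (\<Sum>p\<in>P. real (card {z \<in> dyadic (k v). \<forall>f\<in>F. int p dvd val (y(v := z)) f}))"
        by (simp flip: of_nat_sum)
      also have "\<dots> \<le> (\<Sum>p\<in>P. ?B)"
      proof (rule sum_mono)
        fix p assume p: "p \<in> P"
        then obtain f i where fi: "f \<in> F" "\<not> int p dvd val y (coeff (c f) i)" using nA unfolding P_def by blast
        \<comment> \<open>Only the lower bound \<open>M\<close> for \<open>p\<close> enters, so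
          \<open>p\<close> may exceed the sides of the box.\<close>
        have "modulus (int p) M" using p M by (auto simp: P_def modulus_def)
        then show "real (card {z \<in> dyadic (k v). \<forall>f\<in>F. int p dvd val (y(v := z)) f}) \<le> ?B"
          by (rule card_fibre_common[OF _ kM'(2) Cons.hyps(1) fi(1) Cons.hyps(2) dist(2) fi(2), folded D_def])
      qed
      also have "\<dots> = real (card P) * ?B" by simp
      also have "\<dots> \<le> ?\<beta>" using cardP M D0 by (intro mult_right_mono mult_nonneg_nonneg) auto
      finally show "real (card {z \<in> dyadic (k v). \<exists>p. prime p \<and> real p > M \<and> (\<forall>f\<in>F. int p dvd val (y(v := z)) f)}) \<le>
        (if True then ?\<beta> else 0)" by simp
    qed (use dist M W0 D0 lnY in auto)
    also have "card {y \<in> dyadic_box k (set vs). ?A1 y \<or> ?A2 y} \<le>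
      card {y \<in> dyadic_box k (set vs). ?A1 y} + card {y \<in> dyadic_box k (set vs). ?A2 y}"
      by (rule order.trans[OF card_mono card_Un_le]) (auto simp: finite_dyadic_box)
    also have "2 ^ k v * real (card {y \<in> dyadic_box k (set vs). ?A1 y} + card {y \<in> dyadic_box k (set vs). ?A2 y}) +
      ?\<beta> * real (card {y \<in> dyadic_box k (set vs). True}) \<le>
      2 ^ k v * (C2 * vol k (set vs) / M + C1 * vol k (set vs) * ln Y / M) + ?\<beta> * vol k (set vs)"
      unfolding of_nat_add using C2(2)[of 0 M k] C1(2)[OF M Y, of k] kM kM' M D0 W0 lnY
      by (intro add_mono mult_left_mono) (auto simp: modulus_def card_dyadic_box)
    also have "C2 * vol k (set vs) / M \<le> C2 * vol k (set vs) * ln Y / M"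
      using mult_left_mono[OF lnY, of "C2 * vol k (set vs)"] C2(1) vol_pos[of k "set vs"] M
      by (intro divide_right_mono) auto
    also have "2 ^ k v * (C2 * vol k (set vs) * ln Y / M + C1 * vol k (set vs) * ln Y / M) + ?\<beta> * vol k (set vs) =
      (C1 + C2 + 2 * D * W) * vol k (set (v # vs)) * ln Y / M"
      using dist M by (simp add: vol_insert field_simps)
    finally show ?thesis by simp
  qed
  moreover have "C1 + C2 + 2 * D * W \<ge> 0" using C1 C2 W0 D0 by simp
  ultimately show ?case by blast
qed

text \<open>Primes up to \<open>2 ^ T\<close>, the least possible side, are summed individually;
  those beyond are handled together with \<open>M = 2 ^ T\<close>.\<close>

theorem codim2_count:
  assumes "codim2 vs F" "distinct vs"
  shows "\<exists>C\<ge>0. \<forall>k T Y N. N \<ge> 2 \<longrightarrow> Y \<ge> 3 \<longrightarrow> (\<forall>v\<in>set vs. T \<le> k v \<and> 2 ^ Suc (k v) \<le> Y) \<longrightarrow>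
    real (card {x \<in> dyadic_box k (set vs). \<exists>p\<ge>N. prime p \<and> (\<forall>f\<in>F. int p dvd val x f)})
      \<le> C * vol k (set vs) * (1 / (real N * ln (real N)) + ln Y / 2 ^ T)"
proof -
  obtain C1 where C1: "C1 \<ge> 0" "\<And>k p. prime p \<Longrightarrow> (\<forall>v\<in>set vs. real p \<le> 2 ^ k v) \<Longrightarrow>
    real (card {x \<in> dyadic_box k (set vs). \<forall>f\<in>F. int p dvd val x f}) \<le> C1 * vol k (set vs) / (real p)\<^sup>2"
    using codim2_count_small[OF assms] by blast
  obtain C2 where C2: "C2 \<ge> 0" "\<And>k M Y. M \<ge> 1 \<Longrightarrow> Y \<ge> 3 \<Longrightarrow> (\<forall>v\<in>set vs. M \<le> 2 ^ k v \<and> 2 ^ Suc (k v) \<le> Y) \<Longrightarrow>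
    real (card {x \<in> dyadic_box k (set vs). \<exists>p. prime p \<and> real p > M \<and> (\<forall>f\<in>F. int p dvd val x f)})
      \<le> C2 * vol k (set vs) * ln Y / M"
    using codim2_count_large[OF assms] by blast
  define C where "C = C1 * (1 + 2 * ln 4) + C2"
  have C0: "C \<ge> 0" using C1 C2 by (simp add: C_def)
  have "real (card {x \<in> dyadic_box k (set vs). \<exists>p\<ge>N. prime p \<and> (\<forall>f\<in>F. int p dvd val x f)})
      \<le> C * vol k (set vs) * (1 / (real N * ln (real N)) + ln Y / 2 ^ T)"
    if N: "N \<ge> 2" and Y: "Y \<ge> 3" and kT: "\<forall>v\<in>set vs. T \<le> k v \<and> 2 ^ Suc (k v) \<le> Y" for k T Y N
  proof -
    let ?V = "vol k (set vs)" and ?X = "dyadic_box k (set vs)"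
    have finX: "finite ?X" by (simp add: finite_dyadic_box)
    have kT': "\<forall>v\<in>set vs. (2::real) ^ T \<le> 2 ^ k v \<and> 2 ^ Suc (k v) \<le> Y" using kT by (auto intro: power_increasing)
    define P where "P = {p. prime p \<and> N \<le> p \<and> p \<le> 2 ^ T}"
    have finP: "finite P" unfolding P_def by (rule finite_subset[of _ "{..2 ^ T}"]) auto
    let ?S = "{x \<in> ?X. \<exists>p\<ge>N. prime p \<and> (\<forall>f\<in>F. int p dvd val x f)}"
    let ?L = "{x \<in> ?X. \<exists>p. prime p \<and> real p > 2 ^ T \<and> (\<forall>f\<in>F. int p dvd val x f)}"
    let ?A = "\<lambda>p. {x \<in> ?X. \<forall>f\<in>F. int p dvd val x f}"
    have "?S \<subseteq> (\<Union>p\<in>P. ?A p) \<union> ?L"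
    proof
      fix x assume "x \<in> ?S"
      then obtain p where p: "p \<ge> N" "prime p" "\<forall>f\<in>F. int p dvd val x f" "x \<in> ?X" by blast
      show "x \<in> (\<Union>p\<in>P. ?A p) \<union> ?L"
      proof (cases "p \<le> 2 ^ T")
        case True
        then have "p \<in> P" using p by (simp add: P_def)
        then show ?thesis using p by blast
      next
        case False
        then have "real p > real (2 ^ T)" by (simp only: of_nat_less_iff not_le)
        then have "real p > 2 ^ T" by simp
        then show ?thesis using p by blast
      qed
    qed
    then have "card ?S \<le> card ((\<Union>p\<in>P. ?A p) \<union> ?L)" by (intro card_mono) (auto simp: finX finP)
    also have "\<dots> \<le> card (\<Union>p\<in>P. ?A p) + card ?L" by (rule card_Un_le)
    also have "card (\<Union>p\<in>P. ?A p) \<le> (\<Sum>p\<in>P. card (?A p))" by (rule card_UN_le[OF finP])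
    finally have "real (card ?S) \<le> (\<Sum>p\<in>P. real (card (?A p))) + real (card ?L)"
      by (simp flip: of_nat_sum of_nat_add)
    also have "(\<Sum>p\<in>P. real (card (?A p))) \<le> (\<Sum>p\<in>P. C1 * ?V * (1 / (real p)\<^sup>2))"
    proof (rule sum_mono)
      fix p assume p: "p \<in> P"
      then have "real p \<le> real (2 ^ T)" by (simp only: of_nat_le_iff P_def mem_Collect_eq)
      then have "real p \<le> 2 ^ T" by simp
      then have "\<forall>v\<in>set vs. real p \<le> 2 ^ k v" using kT' order.trans by blast
      then show "real (card (?A p)) \<le> C1 * ?V * (1 / (real p)\<^sup>2)" using C1(2)[of p k] p by (simp add: P_def)
    qed
    also have "\<dots> = C1 * ?V * (\<Sum>p\<in>P. 1 / (real p)\<^sup>2)" by (simp add: sum_distrib_left)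
    also have "\<dots> \<le> C1 * ?V * ((1 + 2 * ln 4) / (real N * ln (real N)))"
      using C1(1) vol_pos[of k "set vs"]
      by (intro mult_left_mono sum_inverse_prime_squares N finP) (auto simp: P_def)
    also have "real (card ?L) \<le> C2 * ?V * ln Y / 2 ^ T" using Y kT' by (intro C2(2)) auto
    also have "C1 * ?V * ((1 + 2 * ln 4) / (real N * ln (real N))) + C2 * ?V * ln Y / 2 ^ T =
      (C1 * (1 + 2 * ln 4)) * (?V * (1 / (real N * ln (real N)))) + C2 * (?V * (ln Y / 2 ^ T))" by (simp add: mult_ac)
    also have "\<dots> \<le> C * (?V * (1 / (real N * ln (real N)))) + C * (?V * (ln Y / 2 ^ T))"
      using C1(1) C2(1) vol_pos[of k "set vs"] N Y unfolding C_def by (intro add_mono mult_right_mono) auto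
    also have "\<dots> = C * ?V * (1 / (real N * ln (real N)) + ln Y / 2 ^ T)" by (simp add: algebra_simps)
    finally show ?thesis by simp
  qed
  then show ?thesis using C0 by blast
qed

section \<open>Relations between the rays\<close>

lemma pair_scale: "pair m (c *s v) = c * pair m v"
  by (simp add: pair_def sum_distrib_left mult_ac)

lemma pair_add: "pair m (v + w) = pair m v + pair m w"
  by (simp add: pair_def distrib_left sum.distrib)

lemma pair_zero: "pair m 0 = 0"
  by (simp add: pair_def)

lemma pair_uminus: "pair m (- v) = - pair m v"
  by (simp add: pair_def sum_negf)

lemma pair_sum: "pair m (\<Sum>i\<in>I. f i) = (\<Sum>i\<in>I. pair m (f i))"
  by (induction I rule: infinite_finite_induct) (auto simp: pair_add pair_zero)

lemma pair_axis: "pair m (axis i 1) = m $ i"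
  by (simp add: pair_def axis_def if_distrib cong: if_cong)

lemma rvec_add: "rvec (v + w) = rvec v + rvec w"
  by (simp add: rvec_def vec_eq_iff)

lemma rvec_scale: "rvec (c *s v) = of_int c *\<^sub>R rvec v"
  by (simp add: rvec_def vec_eq_iff)

lemma rvec_zero: "rvec 0 = 0"
  by (simp add: rvec_def vec_eq_iff)

lemma rvec_sum: "rvec (\<Sum>i\<in>I. f i) = (\<Sum>i\<in>I. rvec (f i))"
  by (induction I rule: infinite_finite_induct) (auto simp: rvec_add rvec_zero)

lemma inj_rvec: "inj rvec"
  by (auto simp: inj_def rvec_def vec_eq_iff)

lemma rvec_axis: "rvec (axis i 1) = axis i 1"
  by (simp add: rvec_def vec_eq_iff axis_def)

text \<open>The second assumption is the global generation of the anticanonical class: each local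
  generator \<open>m_sigma\<close> pairs to at most \<open>1\<close> with every ray.\<close>

locale toric_fan =
  fixes Fan :: "(int^'n) set set"
  assumes regular: "complete_regular_fan Fan"
    and a_nonneg: "\<And>\<sigma> \<rho>. \<sigma> \<in> Fan \<Longrightarrow> \<rho> \<in> fan_rays Fan \<Longrightarrow> a_coef \<rho> \<sigma> \<ge> 0"
begin

abbreviation rays :: "(int^'n) set" where "rays \<equiv> fan_rays Fan"

section \<open>Maximal cones and their linear forms\<close>

lemma cone_facts:
  assumes "\<sigma> \<in> Fan"
  shows finite_cone: "finite \<sigma>" and card_cone: "card \<sigma> = CARD('n)" and cone_rays: "\<sigma> \<subseteq> rays"
    and cone_gen: "\<exists>c::int^'n \<Rightarrow> int. v = (\<Sum>u\<in>\<sigma>. c u *s u)"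
  using regular assms by (auto simp: complete_regular_fan_def fan_rays_def)

lemma finite_rays: "finite rays"
  using regular by (auto simp: complete_regular_fan_def fan_rays_def)

text \<open>The generators span the lattice, hence the real space, and there are only as many of
  them as its dimension.\<close>

lemma cone_indep:
  assumes s: "\<sigma> \<in> Fan" and z: "(\<Sum>u\<in>\<sigma>. c u *\<^sub>R rvec u) = 0" and u: "u \<in> \<sigma>"
  shows "c u = 0"
proof -
  have fin: "finite (rvec ` \<sigma>)" using finite_cone[OF s] by simp
  have inj: "inj_on rvec \<sigma>" using inj_rvec by (rule inj_on_subset) simp
  have ax: "axis i 1 \<in> span (rvec ` \<sigma>)" for i :: 'n
  proof -
    obtain b :: "int^'n \<Rightarrow> int" where "axis i 1 = (\<Sum>u\<in>\<sigma>. b u *s u)" using cone_gen[OF s] by blast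
    then have "(axis i 1 :: real^'n) = (\<Sum>u\<in>\<sigma>. of_int (b u) *\<^sub>R rvec u)"
      by (metis (no_types, lifting) rvec_axis rvec_sum rvec_scale sum.cong)
    also have "\<dots> \<in> span (rvec ` \<sigma>)" by (intro span_sum span_scale span_base) auto
    finally show ?thesis .
  qed
  have "(UNIV :: (real^'n) set) \<subseteq> span (rvec ` \<sigma>)"
  proof
    fix x :: "real^'n"
    have "x = (\<Sum>i\<in>UNIV. x $ i *\<^sub>R axis i 1)"
      by (simp add: vec_eq_iff axis_def if_distrib cong: if_cong)
    also have "\<dots> \<in> span (rvec ` \<sigma>)" by (intro span_sum span_scale ax)
    finally show "x \<in> span (rvec ` \<sigma>)" .
  qed
  moreover have "card (rvec ` \<sigma>) \<le> dim (UNIV :: (real^'n) set)"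
    using card_image[OF inj] card_cone[OF s] by (simp add: dim_UNIV)
  ultimately have ind: "independent (rvec ` \<sigma>)"
    using card_le_dim_spanning[of "rvec ` \<sigma>" UNIV] fin by auto
  let ?b = "\<lambda>x. c (the_inv_into \<sigma> rvec x)"
  have "(\<Sum>x\<in>rvec ` \<sigma>. ?b x *\<^sub>R x) = (\<Sum>u\<in>\<sigma>. c u *\<^sub>R rvec u)"
    by (subst sum.reindex[OF inj]) (auto intro!: sum.cong simp: the_inv_into_f_f[OF inj])
  then have "(\<Sum>x\<in>rvec ` \<sigma>. ?b x *\<^sub>R x) = 0" by (simp only: z)
  then have "\<forall>x\<in>rvec ` \<sigma>. ?b x = 0" using independentD[OF ind fin subset_refl, of ?b] by blast
  then show ?thesis using u by (auto simp: the_inv_into_f_f[OF inj])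
qed

lemma cone_coeff_unique:
  assumes s: "\<sigma> \<in> Fan" and e: "(\<Sum>u\<in>\<sigma>. b u *s u) = (\<Sum>u\<in>\<sigma>. c u *s u)" and u: "u \<in> \<sigma>"
  shows "b u = c u"
proof -
  have "(\<Sum>u\<in>\<sigma>. (of_int (b u) - of_int (c u)) *\<^sub>R rvec u) =
    rvec (\<Sum>u\<in>\<sigma>. b u *s u) - rvec (\<Sum>u\<in>\<sigma>. c u *s u)"
    by (simp add: rvec_sum rvec_scale scaleR_diff_left sum_subtractf)
  also have "\<dots> = 0" by (simp add: e)
  finally have "real_of_int (b u) - real_of_int (c u) = 0" by (rule cone_indep[OF s _ u])
  then show ?thesis by simp
qed

text \<open>Existence and uniqueness are both required, because \<open>m_sigma\<close> is a definite
  description.\<close>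

lemma pair_m_sigma:
  assumes s: "\<sigma> \<in> Fan" and u: "u \<in> \<sigma>"
  shows "pair (m_sigma \<sigma>) u = 1"
proof -
  obtain co :: "int^'n \<Rightarrow> int^'n \<Rightarrow> int" where co: "\<And>v. v = (\<Sum>u\<in>\<sigma>. co v u *s u)"
    using cone_gen[OF s] by metis
  \<comment> \<open>This is the sum of the basis dual to \<sigma>: the coefficient of
    \<open>axis i 1\<close> at \<open>u\<close> is the i-th coordinate of the dual vector of
    \<open>u\<close>.\<close>
  define m :: "int^'n" where "m = (\<chi> i. \<Sum>u\<in>\<sigma>. co (axis i 1) u)"
  have m1: "pair m w = 1" if w: "w \<in> \<sigma>" for w
  proof -
    let ?t = "\<lambda>u. \<Sum>i\<in>UNIV. w $ i * co (axis i 1) u"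
    have "(\<Sum>u\<in>\<sigma>. ?t u *s u) = (\<Sum>i\<in>UNIV. w $ i *s (\<Sum>u\<in>\<sigma>. co (axis i 1) u *s u))"
      by (simp add: vec_eq_iff sum_distrib_right sum_distrib_left mult_ac sum.swap[of _ \<sigma>])
    also have "\<dots> = (\<Sum>i\<in>UNIV. w $ i *s axis i 1)" by (simp only: co[symmetric])
    also have "\<dots> = w" by (simp add: vec_eq_iff axis_def if_distrib cong: if_cong)
    also have "\<dots> = (\<Sum>u\<in>\<sigma>. (if u = w then 1 else 0) *s u)"
      using w finite_cone[OF s] by (subst sum.remove[of _ w]) auto
    finally have t: "?t u = (if u = w then 1 else 0)" if "u \<in> \<sigma>" for u
      by (rule cone_coeff_unique[OF s _ that])
    have "pair m w = (\<Sum>i\<in>UNIV. \<Sum>u\<in>\<sigma>. w $ i * co (axis i 1) u)"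
      by (simp add: pair_def m_def sum_distrib_left mult.commute)
    also have "\<dots> = (\<Sum>u\<in>\<sigma>. ?t u)" by (rule sum.swap)
    also have "\<dots> = (\<Sum>u\<in>\<sigma>. if u = w then 1 else 0)" using t by (intro sum.cong) auto
    also have "\<dots> = 1" using w finite_cone[OF s] by simp
    finally show ?thesis .
  qed
  have uniq: "m' = m" if m': "\<forall>u\<in>\<sigma>. pair m' u = 1" for m'
  proof -
    have "pair m' v = pair m v" for v
    proof -
      have "pair m' (\<Sum>u\<in>\<sigma>. co v u *s u) = pair m (\<Sum>u\<in>\<sigma>. co v u *s u)"
        using m' m1 by (simp add: pair_sum pair_scale)
      then show ?thesis by (simp only: co[of v, symmetric])
    qed
    then show ?thesis by (metis pair_axis vec_eq_iff)
  qed
  have "\<exists>!m. \<forall>u\<in>\<sigma>. pair m u = 1" using m1 uniq by blast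
  from theI'[OF this] show ?thesis using u unfolding m_sigma_def by blast
qed

lemma a_coef_zero: "\<sigma> \<in> Fan \<Longrightarrow> u \<in> \<sigma> \<Longrightarrow> a_coef u \<sigma> = 0"
  by (simp add: a_coef_def pair_m_sigma)

text \<open>Completeness gives nonnegative real coefficients, regularity integral ones; by
  independence they coincide.\<close>

lemma cone_covering:
  obtains \<sigma> c where "\<sigma> \<in> Fan" "v = (\<Sum>u\<in>\<sigma>. int (c u) *s u)"
proof -
  have "rvec v \<in> (\<Union>\<sigma>\<in>Fan. cone \<sigma>)" using regular by (simp add: complete_regular_fan_def)
  then obtain \<sigma> c where s: "\<sigma> \<in> Fan" and c: "\<forall>u\<in>\<sigma>. c u \<ge> 0" "rvec v = (\<Sum>u\<in>\<sigma>. c u *\<^sub>R rvec u)"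
    unfolding cone_def by blast
  obtain b :: "int^'n \<Rightarrow> int" where b: "v = (\<Sum>u\<in>\<sigma>. b u *s u)" using cone_gen[OF s] by blast
  have bc: "of_int (b u) = c u" if "u \<in> \<sigma>" for u
  proof -
    have "(\<Sum>u\<in>\<sigma>. (of_int (b u) - c u) *\<^sub>R rvec u) = rvec (\<Sum>u\<in>\<sigma>. b u *s u) - (\<Sum>u\<in>\<sigma>. c u *\<^sub>R rvec u)"
      by (simp add: rvec_sum rvec_scale scaleR_diff_left sum_subtractf)
    also have "\<dots> = 0" by (simp only: b[symmetric] c(2)[symmetric] diff_self)
    finally have "of_int (b u) - c u = 0" by (rule cone_indep[OF s _ that])
    then show ?thesis by simp
  qed
  have "v = (\<Sum>u\<in>\<sigma>. int (nat (b u)) *s u)"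
  proof -
    have "b u \<ge> 0" if "u \<in> \<sigma>" for u using bc[OF that] c(1) that by (metis of_int_0_le_iff)
    then show ?thesis by (subst b) (intro sum.cong, auto)
  qed
  then show ?thesis using that[OF s, of "\<lambda>u. nat (b u)"] by blast
qed

lemma pair_m_sigma_cone:
  "\<sigma> \<in> Fan \<Longrightarrow> pair (m_sigma \<sigma>) (\<Sum>u\<in>\<sigma>. c u *s u) = (\<Sum>u\<in>\<sigma>. c u)"
  by (simp add: pair_sum pair_scale pair_m_sigma)

text \<open>The negative of the sum of the generators of \<sigma> lies in some cone, and
  \<open>m_sigma\<close> is negative on it; hence it is negative on a generator of that
  cone.\<close>

lemma ex_positive_a_coef:
  assumes s: "\<sigma> \<in> Fan" obtains \<rho> where "\<rho> \<in> rays" "a_coef \<rho> \<sigma> \<ge> 1"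
proof -
  obtain \<tau> c where t: "\<tau> \<in> Fan" "- (\<Sum>u\<in>\<sigma>. 1 *s u) = (\<Sum>w\<in>\<tau>. int (c w) *s w)"
    using cone_covering by metis
  have "(\<Sum>w\<in>\<tau>. int (c w) * pair (m_sigma \<sigma>) w) = pair (m_sigma \<sigma>) (- (\<Sum>u\<in>\<sigma>. 1 *s u))"
    unfolding t(2) by (simp add: pair_sum pair_scale)
  also have "\<dots> = - int (card \<sigma>)" using pair_m_sigma_cone[OF s, of "\<lambda>_. 1"] by (simp add: pair_uminus)
  also have "\<dots> < 0" using card_cone[OF s] by simp
  finally have "\<exists>w\<in>\<tau>. int (c w) * pair (m_sigma \<sigma>) w < 0"
    using sum_nonneg[of \<tau> "\<lambda>w. int (c w) * pair (m_sigma \<sigma>) w"] by (meson not_less)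
  then obtain w where w: "w \<in> \<tau>" "int (c w) * pair (m_sigma \<sigma>) w < 0" by blast
  then have "pair (m_sigma \<sigma>) w < 0" using mult_nonneg_nonneg[of "int (c w)" "pair (m_sigma \<sigma>) w"] by linarith
  then show ?thesis using that[of w] cone_rays[OF t(1)] w(1) by (auto simp: a_coef_def)
qed

text \<open>A cone containing \<open>- \<rho>\<close> cannot have \<rho> among its generators, since
  the coefficient would be \<open>-1\<close>.\<close>

lemma ex_cone_avoiding:
  obtains \<sigma> where "\<sigma> \<in> Fan" "\<rho> \<notin> \<sigma>"
proof -
  obtain \<sigma> c where s: "\<sigma> \<in> Fan" "- \<rho> = (\<Sum>u\<in>\<sigma>. int (c u) *s u)" using cone_covering by blast
  have "\<rho> \<notin> \<sigma>"
  proof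
    assume r: "\<rho> \<in> \<sigma>"
    have "(\<Sum>u\<in>\<sigma>. int (c u) *s u) = (\<Sum>u\<in>\<sigma>. (if u = \<rho> then -1 else 0) *s u)"
      using r finite_cone[OF s(1)] unfolding s(2)[symmetric] by (subst sum.remove[of _ \<rho>]) (auto simp: vector_sneg_minus1)
    from cone_coeff_unique[OF s(1) this r] show False by simp
  qed
  then show ?thesis using that s by blast
qed

section \<open>Exponent vectors and relations\<close>

definition size :: "(int^'n \<Rightarrow> nat) \<Rightarrow> nat" where
  "size k = (\<Sum>\<rho>\<in>rays. k \<rho>)"

text \<open>The exponent of the height: for \<open>X \<rho> = 2 ^ k \<rho>\<close> the monomial of
  \<sigma> equals \<open>2 ^ D0 \<sigma> k\<close>.\<close>

definition D0 :: "(int^'n) set \<Rightarrow> (int^'n \<Rightarrow> nat) \<Rightarrow> int" where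
  "D0 \<sigma> k = (\<Sum>\<rho>\<in>rays. a_coef \<rho> \<sigma> * int (k \<rho>))"

definition lincomb :: "(int^'n \<Rightarrow> nat) \<Rightarrow> int^'n" where
  "lincomb k = (\<Sum>\<rho>\<in>rays. int (k \<rho>) *s \<rho>)"

text \<open>Integral relations between the rays form the lattice dual to \<open>Pic(X)\<close>, of
  rank r, and the size of a relation is its pairing with the anticanonical class.\<close>

definition relations :: "nat \<Rightarrow> (int^'n \<Rightarrow> nat) set" where
  "relations S = {K \<in> rays \<rightarrow>\<^sub>E UNIV. lincomb K = 0 \<and> size K = S}"

text \<open>For \<open>2 ^ L \<le> B < 2 ^ (L + 1)\<close> these are the lower corners that lie in
  the region.\<close>

definition exponents :: "nat \<Rightarrow> (int^'n \<Rightarrow> nat) set" where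
  "exponents L = {k \<in> rays \<rightarrow>\<^sub>E UNIV. \<forall>\<sigma>\<in>Fan. D0 \<sigma> k \<le> int L}"

lemma D0_eq: "D0 \<sigma> k = int (size k) - pair (m_sigma \<sigma>) (lincomb k)"
  by (simp add: D0_def size_def lincomb_def a_coef_def pair_sum pair_scale left_diff_distrib
      right_diff_distrib sum_subtractf mult.commute)

lemma le_size: "\<rho> \<in> rays \<Longrightarrow> k \<rho> \<le> size k"
  unfolding size_def by (intro member_le_sum finite_rays) auto

lemma relations_subset: "relations S \<subseteq> rays \<rightarrow>\<^sub>E {..S}"
proof
  fix K assume K: "K \<in> relations S"
  then have "K \<rho> \<le> S" if "\<rho> \<in> rays" for \<rho> using le_size[OF that, of K] by (simp add: relations_def)
  then show "K \<in> rays \<rightarrow>\<^sub>E {..S}" using K by (auto simp: relations_def PiE_iff)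
qed

lemma finite_relations: "finite (relations S)"
  by (rule finite_subset[OF relations_subset]) (auto intro: finite_PiE finite_rays)

text \<open>A relation is determined by its size and its values off \<open>\<sigma> \<union> {\<rho>1}\<close>: the size is
  \<open>D0 \<sigma> K\<close>, in which \<open>K \<rho>1\<close> has a nonzero coefficient, and \<open>\<sigma>\<close> is a basis.\<close>

lemma relations_determined:
  assumes s: "\<sigma> \<in> Fan" and r1: "\<rho>1 \<in> rays" "a_coef \<rho>1 \<sigma> \<ge> 1"
    and K: "K \<in> relations S" "K' \<in> relations S"
    and agree: "\<And>\<rho>. \<rho> \<in> rays - \<sigma> - {\<rho>1} \<Longrightarrow> K \<rho> = K' \<rho>"
  shows "K = K'"
proof -
  have "D0 \<sigma> K = int S" "D0 \<sigma> K' = int S" using K by (auto simp: D0_eq relations_def pair_zero)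
  then have "(\<Sum>\<rho>\<in>rays. a_coef \<rho> \<sigma> * (int (K \<rho>) - int (K' \<rho>))) = 0"
    by (simp add: D0_def right_diff_distrib sum_subtractf)
  moreover have "(\<Sum>\<rho>\<in>rays - {\<rho>1}. a_coef \<rho> \<sigma> * (int (K \<rho>) - int (K' \<rho>))) = 0"
    using agree a_coef_zero[OF s] by (intro sum.neutral) fastforce
  ultimately have "a_coef \<rho>1 \<sigma> * (int (K \<rho>1) - int (K' \<rho>1)) = 0"
    using sum.remove[OF finite_rays r1(1), of "\<lambda>\<rho>. a_coef \<rho> \<sigma> * (int (K \<rho>) - int (K' \<rho>))"] by simp
  then have e1: "K \<rho>1 = K' \<rho>1" using r1(2) by auto
  have off: "K \<rho> = K' \<rho>" if "\<rho> \<in> rays - \<sigma>" for \<rho> using agree e1 that by (cases "\<rho> = \<rho>1") auto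
  have split: "lincomb k = (\<Sum>u\<in>\<sigma>. int (k u) *s u) + (\<Sum>\<rho>\<in>rays - \<sigma>. int (k \<rho>) *s \<rho>)" for k
    unfolding lincomb_def by (rule sum.subset_diff[OF cone_rays[OF s] finite_rays, THEN trans]) (simp add: add.commute)
  have "(\<Sum>\<rho>\<in>rays - \<sigma>. int (K \<rho>) *s \<rho>) = (\<Sum>\<rho>\<in>rays - \<sigma>. int (K' \<rho>) *s \<rho>)"
    using off by (intro sum.cong) auto
  moreover have "lincomb K = lincomb K'" using K by (simp add: relations_def)
  ultimately have "(\<Sum>u\<in>\<sigma>. int (K u) *s u) = (\<Sum>u\<in>\<sigma>. int (K' u) *s u)"
    unfolding split by simp
  then have "int (K u) = int (K' u)" if "u \<in> \<sigma>" for u using that by (rule cone_coeff_unique[OF s])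
  then have "K \<rho> = K' \<rho>" if "\<rho> \<in> rays" for \<rho> using off that by (cases "\<rho> \<in> \<sigma>") auto
  moreover have "K \<in> extensional rays" "K' \<in> extensional rays" using K by (auto simp: relations_def PiE_iff)
  ultimately show ?thesis by (intro extensionalityI[of K rays K'])
qed

text \<open>Restriction to \<open>W\<close> is injective when \<open>Q\<close> lets the values on
  \<open>W\<close> determine the remaining free coordinates. Fixing one coordinate by
  \<open>Q\<close> thus saves a factor \<open>S + 1\<close>.\<close>

lemma card_relations_le:
  assumes s: "\<sigma> \<in> Fan" and r1: "\<rho>1 \<in> rays" "a_coef \<rho>1 \<sigma> \<ge> 1"
    and Q: "\<And>K K'. K \<in> relations S \<Longrightarrow> K' \<in> relations S \<Longrightarrow> Q K \<Longrightarrow> Q K' \<Longrightarrow>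
      (\<And>\<rho>. \<rho> \<in> W \<Longrightarrow> K \<rho> = K' \<rho>) \<Longrightarrow> (\<And>\<rho>. \<rho> \<in> rays - \<sigma> - {\<rho>1} \<Longrightarrow> K \<rho> = K' \<rho>)"
    and W: "W \<subseteq> rays"
  shows "card {K \<in> relations S. Q K} \<le> (S + 1) ^ card W"
proof -
  have finW: "finite W" using W finite_rays by (rule finite_subset)
  have "inj_on (\<lambda>K. restrict K W) {K \<in> relations S. Q K}"
  proof (rule inj_onI)
    fix K K' assume K: "K \<in> {K \<in> relations S. Q K}" "K' \<in> {K \<in> relations S. Q K}" "restrict K W = restrict K' W"
    have "K \<rho> = K' \<rho>" if "\<rho> \<in> W" for \<rho>
      using fun_cong[OF K(3), of \<rho>] that by simp
    then have "K \<rho> = K' \<rho>" if "\<rho> \<in> rays - \<sigma> - {\<rho>1}" for \<rho>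
      using Q[of K K' \<rho>] K(1,2) that by blast
    then show "K = K'" using K(1,2) by (intro relations_determined[OF s r1, of K S K']) auto
  qed
  moreover have "(\<lambda>K. restrict K W) ` {K \<in> relations S. Q K} \<subseteq> W \<rightarrow>\<^sub>E {..S}"
    using relations_subset[of S] W by (auto simp: PiE_iff subset_iff)
  ultimately have "card {K \<in> relations S. Q K} \<le> card (W \<rightarrow>\<^sub>E {..S})"
    using finW by (intro card_inj_on_le finite_PiE) auto
  then show ?thesis using finW by (simp add: card_PiE)
qed

text \<open>The form \<open>a_coef\<close> vanishes on \<sigma>, so \<rho>1 is one of the r rays
  outside it.\<close>

lemma card_off_cone:
  assumes "\<sigma> \<in> Fan" "\<rho>1 \<in> rays" "a_coef \<rho>1 \<sigma> \<ge> 1"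
  shows "card (rays - \<sigma> - {\<rho>1}) = pic_rank Fan - 1" "pic_rank Fan \<ge> 1"
proof -
  have "\<rho>1 \<notin> \<sigma>" using assms a_coef_zero by fastforce
  then have r: "\<rho>1 \<in> rays - \<sigma>" using assms by blast
  have c: "card (rays - \<sigma>) = pic_rank Fan"
    using card_Diff_subset[OF finite_cone cone_rays, OF assms(1,1)] card_cone[OF assms(1)]
    by (simp add: pic_rank_def)
  then show "card (rays - \<sigma> - {\<rho>1}) = pic_rank Fan - 1" using r finite_rays by simp
  have "rays - \<sigma> \<noteq> {}" using r by blast
  then show "pic_rank Fan \<ge> 1" using c finite_rays by (metis card_0_eq finite_Diff less_one not_le)
qed

lemma card_relations: "card (relations S) \<le> (S + 1) ^ (pic_rank Fan - 1)"
proof -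
  have "Fan \<noteq> {}" using regular by (simp add: complete_regular_fan_def)
  then obtain \<sigma> where s: "\<sigma> \<in> Fan" by blast
  obtain \<rho>1 where r: "\<rho>1 \<in> rays" "a_coef \<rho>1 \<sigma> \<ge> 1" using ex_positive_a_coef[OF s] .
  have "card {K \<in> relations S. True} \<le> (S + 1) ^ card (rays - \<sigma> - {\<rho>1})"
    by (rule card_relations_le[OF s r]) auto
  then show ?thesis using card_off_cone[OF s r] by simp
qed

lemma pic_rank_pos: "pic_rank Fan \<ge> 1"
proof -
  have "Fan \<noteq> {}" using regular by (simp add: complete_regular_fan_def)
  then obtain \<sigma> where s: "\<sigma> \<in> Fan" by blast
  obtain \<rho>1 where r: "\<rho>1 \<in> rays" "a_coef \<rho>1 \<sigma> \<ge> 1" using ex_positive_a_coef[OF s] .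
  show ?thesis by (rule card_off_cone(2)[OF s r])
qed

text \<open>The shift \<open>c\<close> expresses \<open>- lincomb k\<close> in a cone \<open>\<sigma>\<close> containing it; the size of the
  resulting relation is \<open>D0 \<sigma> k\<close>.\<close>

lemma exponents_shift:
  assumes k: "k \<in> exponents L"
  obtains c S where "c \<in> rays \<rightarrow>\<^sub>E {..L}" "S \<le> L" "(\<lambda>\<rho>\<in>rays. k \<rho> + c \<rho>) \<in> relations S"
    "S = size k + size c"
proof -
  obtain \<sigma> b where s: "\<sigma> \<in> Fan" "- lincomb k = (\<Sum>u\<in>\<sigma>. int (b u) *s u)" using cone_covering by blast
  define c where "c = (\<lambda>\<rho>\<in>rays. if \<rho> \<in> \<sigma> then b \<rho> else 0)"
  let ?K = "\<lambda>\<rho>\<in>rays. k \<rho> + c \<rho>"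
  have sub: "\<sigma> \<subseteq> rays" by (rule cone_rays[OF s(1)])
  have "lincomb c = (\<Sum>u\<in>\<sigma>. int (b u) *s u)"
    unfolding lincomb_def using sub
    by (intro sum.mono_neutral_cong_right finite_rays) (auto simp: c_def)
  then have lc: "lincomb c = - lincomb k" by (simp only: s(2))
  have sc: "int (size c) = (\<Sum>u\<in>\<sigma>. int (b u))"
    unfolding size_def of_nat_sum using sub
    by (intro sum.mono_neutral_cong_right finite_rays) (auto simp: c_def)
  have "lincomb ?K = lincomb k + lincomb c"
    by (simp add: lincomb_def vector_sadd_rdistrib sum.distrib)
  then have l0: "lincomb ?K = 0" using lc by simp
  have sz: "size ?K = size k + size c" by (simp add: size_def sum.distrib)
  \<comment> \<open>On its own cone \<open>m_sigma\<close> adds up the coefficients, so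
    \<open>size c\<close> is its value at \<open>- lincomb k\<close>.\<close>
  have "int (size k + size c) = D0 \<sigma> k"
    using pair_m_sigma_cone[OF s(1), of "\<lambda>u. int (b u)"] sc
    unfolding D0_eq s(2)[symmetric] pair_uminus by simp
  also have "\<dots> \<le> int L" using k s(1) by (simp add: exponents_def)
  finally have le: "size k + size c \<le> L" by simp
  show ?thesis
  proof (rule that[of c "size k + size c"])
    show "c \<in> rays \<rightarrow>\<^sub>E {..L}" 
    proof -
      have "c \<rho> \<le> L" if "\<rho> \<in> rays" for \<rho> using le_size[OF that, of c] le by simp
      moreover have "c \<in> extensional rays" by (simp add: c_def)
      ultimately show ?thesis by (simp add: PiE_iff)
    qed
    show "?K \<in> relations (size k + size c)" using l0 sz by (auto simp: relations_def)
  qed (use le in auto)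
qed

lemma exponents_le: assumes k: "k \<in> exponents L" and r: "\<rho> \<in> rays" shows "k \<rho> \<le> L"
proof -
  obtain c S where "S \<le> L" "S = size k + size c" using exponents_shift[OF k] by metis
  then show ?thesis using le_size[OF r, of k] by simp
qed

lemma finite_exponents: "finite (exponents L)"
proof (rule finite_subset)
  show "exponents L \<subseteq> rays \<rightarrow>\<^sub>E {..L}"
  proof
    fix k assume k: "k \<in> exponents L"
    then have "k \<in> extensional rays" by (simp add: exponents_def PiE_iff)
    then show "k \<in> rays \<rightarrow>\<^sub>E {..L}" using exponents_le[OF k] by (simp add: PiE_iff)
  qed
qed (auto intro: finite_PiE finite_rays)

section \<open>Volume of the dyadic boxes\<close>

abbreviation shifts :: "nat \<Rightarrow> (int^'n \<Rightarrow> nat) set" where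
  "shifts L \<equiv> rays \<rightarrow>\<^sub>E {..L}"

lemma finite_shifts: "finite (shifts L)"
  by (intro finite_PiE finite_rays) auto

text \<open>The shift and the shifted vector determine \<open>k\<close>, and
  \<open>2 ^ size k\<close> is \<open>2 ^ S\<close> damped by \<open>2 ^ - size c\<close>.
  \<open>Q'\<close> records what the condition \<open>Q\<close> implies after the shift.\<close>

lemma sum_exponents_le:
  assumes Q: "\<And>k c. k \<in> exponents L \<Longrightarrow> Q k \<Longrightarrow> Q' (\<lambda>\<rho>\<in>rays. k \<rho> + c \<rho>) c"
  shows "(\<Sum>k\<in>{k \<in> exponents L. Q k}. 2 ^ size k) \<le>
    (\<Sum>c\<in>shifts L. (1 / 2) ^ size c * (\<Sum>S\<le>L. 2 ^ S * real (card {K \<in> relations S. Q' K c})))"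
proof -
  let ?T = "SIGMA c:shifts L. SIGMA S:{..L}. {K \<in> relations S. Q' K c}"
  let ?g = "\<lambda>(c, S, K::int^'n \<Rightarrow> nat). (1 / 2 :: real) ^ size c * 2 ^ S"
  have "(\<Sum>k\<in>{k \<in> exponents L. Q k}. 2 ^ size k) \<le> sum ?g ?T"
  \<comment> \<open>Subtracting the shift recovers \<open>k\<close> from the triple.\<close>
  proof (rule sum_le_included[where i = "\<lambda>(c, S, K). \<lambda>\<rho>\<in>rays. K \<rho> - c \<rho>"])
    show "finite {k \<in> exponents L. Q k}" using finite_exponents by simp
    show "finite ?T" by (intro finite_SigmaI finite_shifts) (auto simp: finite_relations)
    show "\<forall>y\<in>?T. 0 \<le> ?g y" by auto
    show "\<forall>x\<in>{k \<in> exponents L. Q k}. \<exists>y\<in>?T. (case y of (c, S, K) \<Rightarrow> \<lambda>\<rho>\<in>rays. K \<rho> - c \<rho>) = x \<and> 2 ^ size x \<le> ?g y"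
    proof
      fix k assume k: "k \<in> {k \<in> exponents L. Q k}"
      then obtain c S where c: "c \<in> shifts L" "S \<le> L" "(\<lambda>\<rho>\<in>rays. k \<rho> + c \<rho>) \<in> relations S"
        "S = size k + size c" using exponents_shift by blast
      have ext: "k \<in> extensional rays" using k by (auto simp: exponents_def PiE_iff)
      have "(\<lambda>\<rho>\<in>rays. (\<lambda>\<rho>\<in>rays. k \<rho> + c \<rho>) \<rho> - c \<rho>) = k"
        using ext by (auto simp: extensional_def fun_eq_iff)
      moreover have "(2::real) ^ size k \<le> (1 / 2) ^ size c * 2 ^ S"
        unfolding c(4) power_add by (simp add: power_divide)
      moreover have "(c, S, \<lambda>\<rho>\<in>rays. k \<rho> + c \<rho>) \<in> ?T" using c(1-3) k Q by auto
      ultimately show "\<exists>y\<in>?T. (case y of (c, S, K) \<Rightarrow> \<lambda>\<rho>\<in>rays. K \<rho> - c \<rho>) = k \<and> 2 ^ size k \<le> ?g y"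
        by (intro bexI[of _ "(c, S, \<lambda>\<rho>\<in>rays. k \<rho> + c \<rho>)"]) auto
    qed
  qed
  also have "sum ?g ?T = (\<Sum>c\<in>shifts L. \<Sum>S\<le>L. \<Sum>K\<in>{K \<in> relations S. Q' K c}. (1 / 2) ^ size c * 2 ^ S)"
    by (simp add: sum.Sigma[symmetric] finite_shifts finite_relations)
  also have "\<dots> = (\<Sum>c\<in>shifts L. (1 / 2) ^ size c * (\<Sum>S\<le>L. 2 ^ S * real (card {K \<in> relations S. Q' K c})))"
    by (simp add: sum_distrib_left mult_ac)
  finally show ?thesis .
qed

lemma sum_pow2_le: "(\<Sum>S\<le>L. (2::real) ^ S) \<le> 2 * 2 ^ L"
  by (induction L) auto

lemma sum_half_powers_le: "(\<Sum>j\<le>L. real (j + 1) * (1 / 2) ^ j) \<le> 4"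
proof -
  have "(\<Sum>j\<le>L. real (j + 1) * (1 / 2) ^ j) = 4 - real (L + 3) * (1 / 2) ^ L"
    by (induction L) (auto simp: field_simps)
  then show ?thesis by simp
qed

text \<open>The extra product absorbs the dependence on the shift that arises in the strips. The sum
  factors over the rays, with at most \<open>4\<close> for each.\<close>

lemma sum_shifts_le:
  "(\<Sum>c\<in>shifts L. (1 / 2) ^ size c * (\<Prod>\<rho>\<in>rays. real (c \<rho> + 1))) \<le> 4 ^ card rays"
proof -
  have "(\<Sum>c\<in>shifts L. (1 / 2) ^ size c * (\<Prod>\<rho>\<in>rays. real (c \<rho> + 1))) =
    (\<Sum>c\<in>shifts L. \<Prod>\<rho>\<in>rays. real (c \<rho> + 1) * (1 / 2) ^ c \<rho>)"
    by (simp add: size_def power_sum prod.distrib mult.commute)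
  also have "\<dots> = (\<Prod>\<rho>\<in>rays. \<Sum>j\<le>L. real (j + 1) * (1 / 2) ^ j)"
    by (subst prod_sum_PiE[OF finite_rays]) auto
  also have "\<dots> \<le> (\<Prod>\<rho>\<in>rays. 4)"
    by (intro prod_mono conjI sum_half_powers_le sum_nonneg) auto
  finally show ?thesis by simp
qed

text \<open>The powers of \<open>2\<close> concentrate the sum at sizes near \<open>L\<close>, where
  there are at most \<open>(L + 1) ^ (r - 1)\<close> relations.\<close>

lemma sum_exponents:
  "(\<Sum>k\<in>exponents L. 2 ^ size k) \<le> 2 * 4 ^ card rays * 2 ^ L * real (L + 1) ^ (pic_rank Fan - 1)"
proof -
  let ?r = "pic_rank Fan - 1"
  have "(\<Sum>k\<in>{k \<in> exponents L. True}. 2 ^ size k) \<le>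
    (\<Sum>c\<in>shifts L. (1 / 2) ^ size c * (\<Sum>S\<le>L. 2 ^ S * real (card {K \<in> relations S. True})))"
    by (rule sum_exponents_le)
  also have "\<dots> \<le> (\<Sum>c\<in>shifts L. ((1 / 2) ^ size c * (\<Prod>\<rho>\<in>rays. real (c \<rho> + 1))) * (2 * 2 ^ L * real (L + 1) ^ ?r))"
  proof (rule sum_mono)
    fix c assume "c \<in> shifts L"
    have "(\<Sum>S\<le>L. 2 ^ S * real (card {K \<in> relations S. True})) \<le> (\<Sum>S\<le>L. 2 ^ S * real (L + 1) ^ ?r)"
    proof (intro sum_mono mult_left_mono)
      fix S assume "S \<in> {..L}"
      then have "(S + 1) ^ ?r \<le> (L + 1) ^ ?r" by (intro power_mono) auto
      then have "card (relations S) \<le> (L + 1) ^ ?r" using card_relations[of S] by linarith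
      then have "real (card (relations S)) \<le> real ((L + 1) ^ ?r)" by (simp only: of_nat_le_iff)
      then show "real (card {K \<in> relations S. True}) \<le> real (L + 1) ^ ?r" by simp
    qed auto
    also have "\<dots> = (\<Sum>S\<le>L. 2 ^ S) * real (L + 1) ^ ?r" by (simp add: sum_distrib_right)
    also have "\<dots> \<le> 2 * 2 ^ L * real (L + 1) ^ ?r" by (intro mult_right_mono sum_pow2_le) auto
    finally have 1: "(\<Sum>S\<le>L. 2 ^ S * real (card {K \<in> relations S. True})) \<le> 2 * 2 ^ L * real (L + 1) ^ ?r" .
    have "(1 / 2) ^ size c * 1 \<le> (1 / 2 :: real) ^ size c * (\<Prod>\<rho>\<in>rays. real (c \<rho> + 1))"
      by (intro mult_left_mono prod_ge_1) auto
    then show "(1 / 2) ^ size c * (\<Sum>S\<le>L. 2 ^ S * real (card {K \<in> relations S. True})) \<le>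
      ((1 / 2) ^ size c * (\<Prod>\<rho>\<in>rays. real (c \<rho> + 1))) * (2 * 2 ^ L * real (L + 1) ^ ?r)"
      using 1 by (intro mult_mono sum_nonneg) auto
  qed
  also have "\<dots> = (\<Sum>c\<in>shifts L. (1 / 2) ^ size c * (\<Prod>\<rho>\<in>rays. real (c \<rho> + 1))) * (2 * 2 ^ L * real (L + 1) ^ ?r)"
    by (simp add: sum_distrib_right)
  also have "\<dots> \<le> 4 ^ card rays * (2 * 2 ^ L * real (L + 1) ^ ?r)"
    by (intro mult_right_mono sum_shifts_le) auto
  finally show ?thesis by (simp add: mult_ac)
qed

text \<open>The second alternative occurs for instance for the negative curve on the Hirzebruch
  surface \<open>F2\<close>, where \<open>D\<^sub>\<rho>\<close> is proportional to the anticanonical class.\<close>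

lemma ray_dichotomy:
  assumes r0: "\<rho>0 \<in> rays"
  shows "(pic_rank Fan \<ge> 2 \<and> (\<forall>S j. card {K \<in> relations S. K \<rho>0 = j} \<le> (S + 1) ^ (pic_rank Fan - 2))) \<or>
    (\<exists>a\<ge>1. \<forall>S. \<forall>K\<in>relations S. S \<le> a * K \<rho>0)"
proof -
  \<comment> \<open>Avoiding \<rho>0 makes it a free coordinate, so that fixing its value lowers the
    count.\<close>
  obtain \<sigma> where s: "\<sigma> \<in> Fan" "\<rho>0 \<notin> \<sigma>" using ex_cone_avoiding .
  show ?thesis
  proof (cases "\<exists>\<rho>1\<in>rays - {\<rho>0}. a_coef \<rho>1 \<sigma> \<ge> 1")
    case True
    then obtain \<rho>1 where r: "\<rho>1 \<in> rays" "a_coef \<rho>1 \<sigma> \<ge> 1" "\<rho>1 \<noteq> \<rho>0" by blast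
    let ?W = "rays - \<sigma> - {\<rho>1} - {\<rho>0}"
    have mem: "\<rho>0 \<in> rays - \<sigma> - {\<rho>1}" using r0 s r by auto
    have cW: "card ?W = pic_rank Fan - 2" using mem card_off_cone[OF s(1) r(1,2)] finite_rays by simp
    have "card (rays - \<sigma> - {\<rho>1}) > 0" using mem finite_rays by (auto simp: card_gt_0_iff)
    then have "pic_rank Fan \<ge> 2" using card_off_cone(1)[OF s(1) r(1,2)] by simp
    moreover have "card {K \<in> relations S. K \<rho>0 = j} \<le> (S + 1) ^ card ?W" for S j
    proof (rule card_relations_le[OF s(1) r(1,2)])
      fix K K' \<rho>
      assume "K \<rho>0 = j" "K' \<rho>0 = j" "\<And>\<rho>. \<rho> \<in> ?W \<Longrightarrow> K \<rho> = K' \<rho>" "\<rho> \<in> rays - \<sigma> - {\<rho>1}"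
      then show "K \<rho> = K' \<rho>" by (cases "\<rho> = \<rho>0") auto
    qed auto
    ultimately show ?thesis using cW by simp
  next
    \<comment> \<open>Here \<rho>0 is the only ray with a positive coefficient, so the size is a
      multiple of \<open>K \<rho>0\<close>.\<close>
    case False
    define a where "a = nat (a_coef \<rho>0 \<sigma>) + 1"
    have "S \<le> a * K \<rho>0" if K: "K \<in> relations S" for S K
    proof -
      have "int S = D0 \<sigma> K" using K by (auto simp: D0_eq relations_def pair_zero)
      also have "\<dots> = a_coef \<rho>0 \<sigma> * int (K \<rho>0)"
      proof -
        have "a_coef \<rho> \<sigma> = 0" if "\<rho> \<in> rays - {\<rho>0}" for \<rho>
          using False a_nonneg[OF s(1), of \<rho>] that by force
        then show ?thesis unfolding D0_def using r0 finite_rays by (subst sum.remove[of _ \<rho>0]) auto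
      qed
      also have "\<dots> \<le> int a * int (K \<rho>0)"
        using a_nonneg[OF s(1) r0] by (intro mult_right_mono) (auto simp: a_def)
      finally show ?thesis by (simp flip: of_nat_mult)
    qed
    moreover have "a \<ge> 1" by (simp add: a_def)
    ultimately show ?thesis by blast
  qed
qed

text \<open>The two terms bound the two alternatives of \<open>ray_dichotomy\<close>: either
  \<open>K \<rho>0\<close> takes at most \<open>T + c \<rho>0 + 1\<close> values, each costing one
  power of \<open>L\<close> less, or the size itself is at most \<open>a * (T + c \<rho>0)\<close>,
  which saves a power of \<open>2 ^ L\<close>.\<close>

lemma sum_exponents_strip:
  assumes r0: "\<rho>0 \<in> rays"
  shows "\<exists>a\<ge>1. \<forall>L T. (\<Sum>k\<in>{k \<in> exponents L. k \<rho>0 \<le> T}. 2 ^ size k) \<le>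
    2 * 4 ^ card rays * real (T + 1) * 2 ^ L * real (L + 1) powr (real (pic_rank Fan) - 2) +
    2 ^ T * 2 powr (real L * (1 - 1 / real a)) * real (L + 1) ^ (2 * card rays + 1)"
  (is "\<exists>a\<ge>1. \<forall>L T. ?lhs L T \<le> ?A L T + ?B a L T")
proof -
  have A0: "?A L T \<ge> 0" for L T by simp
  have B0: "?B a L T \<ge> 0" for a L T by simp
  have step: "?lhs L T \<le> (\<Sum>c\<in>shifts L. (1 / 2) ^ size c * (\<Sum>S\<le>L. 2 ^ S * real (card {K \<in> relations S. K \<rho>0 \<le> T + c \<rho>0})))" for L T
    by (rule sum_exponents_le) (use r0 in auto)
  from ray_dichotomy[OF r0] show ?thesis
  proof
    assume *: "pic_rank Fan \<ge> 2 \<and> (\<forall>S j. card {K \<in> relations S. K \<rho>0 = j} \<le> (S + 1) ^ (pic_rank Fan - 2))"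
    let ?r = "pic_rank Fan - 2"
    have "?lhs L T \<le> ?A L T" for L T
    proof -
      have "?lhs L T \<le> (\<Sum>c\<in>shifts L. ((1 / 2) ^ size c * (\<Prod>\<rho>\<in>rays. real (c \<rho> + 1))) * (real (T + 1) * (2 * 2 ^ L) * real (L + 1) ^ ?r))"
      proof (rule order.trans[OF step], rule sum_mono)
        fix c assume "c \<in> shifts L"
        have "(\<Sum>S\<le>L. 2 ^ S * real (card {K \<in> relations S. K \<rho>0 \<le> T + c \<rho>0})) \<le>
          (\<Sum>S\<le>L. 2 ^ S * (real (T + c \<rho>0 + 1) * real (L + 1) ^ ?r))"
        proof (intro sum_mono mult_left_mono)
          fix S assume S: "S \<in> {..L}"
          have "{K \<in> relations S. K \<rho>0 \<le> T + c \<rho>0} = (\<Union>j\<le>T + c \<rho>0. {K \<in> relations S. K \<rho>0 = j})" by auto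
          then have "card {K \<in> relations S. K \<rho>0 \<le> T + c \<rho>0} \<le> (\<Sum>j\<le>T + c \<rho>0. card {K \<in> relations S. K \<rho>0 = j})"
            using card_UN_le[of "{..T + c \<rho>0}"] by simp
          also have "\<dots> \<le> (\<Sum>j\<le>T + c \<rho>0. (L + 1) ^ ?r)"
          proof (rule sum_mono)
            fix j
            have "(S + 1) ^ ?r \<le> (L + 1) ^ ?r" using S by (intro power_mono) auto
            then show "card {K \<in> relations S. K \<rho>0 = j} \<le> (L + 1) ^ ?r" using * order.trans by blast
          qed
          also have "\<dots> = (T + c \<rho>0 + 1) * (L + 1) ^ ?r" by simp
          finally have "real (card {K \<in> relations S. K \<rho>0 \<le> T + c \<rho>0}) \<le> real ((T + c \<rho>0 + 1) * (L + 1) ^ ?r)"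
            by (simp only: of_nat_le_iff)
          then show "real (card {K \<in> relations S. K \<rho>0 \<le> T + c \<rho>0}) \<le> real (T + c \<rho>0 + 1) * real (L + 1) ^ ?r"
            by (simp only: of_nat_mult of_nat_power)
        qed auto
        also have "\<dots> = (\<Sum>S\<le>L. 2 ^ S) * (real (T + c \<rho>0 + 1) * real (L + 1) ^ ?r)" by (simp add: sum_distrib_right)
        also have "\<dots> \<le> (2 * 2 ^ L) * ((real (T + 1) * (\<Prod>\<rho>\<in>rays. real (c \<rho> + 1))) * real (L + 1) ^ ?r)"
        proof (intro mult_mono sum_pow2_le)
          \<comment> \<open>The shift enters only through one factor of the product in
            \<open>sum_shifts_le\<close>.\<close>
          have "(T + c \<rho>0 + 1) \<le> (T + 1) * (c \<rho>0 + 1)" by (simp add: algebra_simps)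
          then have "real (T + c \<rho>0 + 1) \<le> real ((T + 1) * (c \<rho>0 + 1))" by (simp only: of_nat_le_iff)
          also have "\<dots> = real (T + 1) * real (c \<rho>0 + 1)" by (simp only: of_nat_mult)
          also have "real (c \<rho>0 + 1) = (\<Prod>\<rho>\<in>{\<rho>0}. real (c \<rho> + 1))" by simp
          also have "\<dots> \<le> (\<Prod>\<rho>\<in>rays. real (c \<rho> + 1))"
            using r0 finite_rays by (intro prod_mono2) auto
          finally show "real (T + c \<rho>0 + 1) \<le> real (T + 1) * (\<Prod>\<rho>\<in>rays. real (c \<rho> + 1))" by (simp add: mult_left_mono)
        qed (auto intro!: mult_nonneg_nonneg prod_nonneg)
        finally have "(1 / 2) ^ size c * (\<Sum>S\<le>L. 2 ^ S * real (card {K \<in> relations S. K \<rho>0 \<le> T + c \<rho>0})) \<le>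
          (1 / 2) ^ size c * ((2 * 2 ^ L) * ((real (T + 1) * (\<Prod>\<rho>\<in>rays. real (c \<rho> + 1))) * real (L + 1) ^ ?r))"
          by (intro mult_left_mono) auto
        then show "(1 / 2) ^ size c * (\<Sum>S\<le>L. 2 ^ S * real (card {K \<in> relations S. K \<rho>0 \<le> T + c \<rho>0})) \<le>
          ((1 / 2) ^ size c * (\<Prod>\<rho>\<in>rays. real (c \<rho> + 1))) * (real (T + 1) * (2 * 2 ^ L) * real (L + 1) ^ ?r)"
          by (simp only: mult_ac)
      qed
      also have "\<dots> = (\<Sum>c\<in>shifts L. (1 / 2) ^ size c * (\<Prod>\<rho>\<in>rays. real (c \<rho> + 1))) * (real (T + 1) * (2 * 2 ^ L) * real (L + 1) ^ ?r)"
        by (simp add: sum_distrib_right)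
      also have "\<dots> \<le> 4 ^ card rays * (real (T + 1) * (2 * 2 ^ L) * real (L + 1) ^ ?r)"
        by (intro mult_right_mono sum_shifts_le) auto
      \<comment> \<open>This alternative has r at least 2, so truncated and real subtraction agree;
        for r = 1 the real exponent is \<open>-1\<close>.\<close>
      also have "real (L + 1) ^ ?r = real (L + 1) powr (real (pic_rank Fan) - 2)"
        using * by (subst powr_realpow[symmetric]) (auto simp: of_nat_diff)
      finally show ?thesis by (simp only: mult_ac)
    qed
    \<comment> \<open>Any \<open>a\<close> will do here, as the other term is nonnegative.\<close>
    then have "?lhs L T \<le> ?A L T + ?B 1 L T" for L T using B0[of T L 1] by (meson add_increasing2)
    then show ?thesis by blast
  next
    assume "\<exists>a\<ge>1. \<forall>S. \<forall>K\<in>relations S. S \<le> a * K \<rho>0"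
    then obtain a where a: "a \<ge> 1" "\<And>S K. K \<in> relations S \<Longrightarrow> S \<le> a * K \<rho>0" by blast
    have "?lhs L T \<le> ?B a L T" for L T
    proof -
      let ?b = "2 ^ T * 2 powr (real L * (1 - 1 / real a))"
      have "?lhs L T \<le> (\<Sum>c\<in>shifts L. \<Sum>S\<le>L. ?b * real (L + 1) ^ card rays)"
      proof (rule order.trans[OF step], rule sum_mono)
        fix c assume "c \<in> shifts L"
        have "(1 / 2) ^ size c * (2 ^ S * real (card {K \<in> relations S. K \<rho>0 \<le> T + c \<rho>0})) \<le> ?b * real (L + 1) ^ card rays"
          if S: "S \<le> L" for S
        proof (cases "{K \<in> relations S. K \<rho>0 \<le> T + c \<rho>0} = {}")
          case True
          show ?thesis unfolding True by simp
        next
          case False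
          then obtain K where K: "K \<in> relations S" "K \<rho>0 \<le> T + c \<rho>0" by blast
          have "S \<le> a * (T + c \<rho>0)" using a(2)[OF K(1)] K(2) mult_le_mono2 order.trans by blast
          then have "real S \<le> real (a * (T + c \<rho>0))" by (simp only: of_nat_le_iff)
          then have Sa: "real S / real a \<le> real T + real (c \<rho>0)" using a(1) by (simp add: field_simps)
          \<comment> \<open>Split \<open>S\<close> as \<open>S * (1 - 1 / a) + S / a\<close>: the
            first part is bounded through \<open>S \<le> L\<close>, the second by
            \<open>T + c \<rho>0\<close>, whose shift is cancelled by \<open>size c\<close>.\<close>
          have "real S * (1 - 1 / real a) \<le> real L * (1 - 1 / real a)"
            using S a(1) by (intro mult_right_mono) (auto simp: field_simps)
          then have "real S \<le> real L * (1 - 1 / real a) + real T + real (c \<rho>0)"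
            using Sa by (simp add: algebra_simps)
          also have "c \<rho>0 \<le> size c" by (rule le_size[OF r0])
          finally have "real S - real (size c) \<le> real T + real L * (1 - 1 / real a)" by simp
          then have "2 powr (real S - real (size c)) \<le> 2 powr (real T + real L * (1 - 1 / real a))" by simp
          then have w: "(1 / 2) ^ size c * 2 ^ S \<le> ?b"
            by (simp add: powr_diff powr_add powr_realpow power_divide)
          have "card {K \<in> relations S. K \<rho>0 \<le> T + c \<rho>0} \<le> card (rays \<rightarrow>\<^sub>E {..S})"
            using relations_subset by (intro card_mono finite_PiE finite_rays) auto
          also have "\<dots> = (S + 1) ^ card rays" by (simp add: card_PiE finite_rays)
          also have "\<dots> \<le> (L + 1) ^ card rays" using S by (intro power_mono) auto
          finally have "real (card {K \<in> relations S. K \<rho>0 \<le> T + c \<rho>0}) \<le> real ((L + 1) ^ card rays)"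
            by (simp only: of_nat_le_iff)
          then have cd: "real (card {K \<in> relations S. K \<rho>0 \<le> T + c \<rho>0}) \<le> real (L + 1) ^ card rays" by simp
          show ?thesis unfolding mult.assoc[symmetric, of "(1 / 2) ^ size c"]
            by (intro mult_mono w cd) auto
        qed
        then show "(1 / 2) ^ size c * (\<Sum>S\<le>L. 2 ^ S * real (card {K \<in> relations S. K \<rho>0 \<le> T + c \<rho>0})) \<le>
          (\<Sum>S\<le>L. ?b * real (L + 1) ^ card rays)"
          unfolding sum_distrib_left by (intro sum_mono) auto
      qed
      also have "\<dots> = real (card (shifts L)) * (real (L + 1) * (?b * real (L + 1) ^ card rays))" by simp
      \<comment> \<open>The exponent \<open>2 * card rays + 1\<close> collects the shifts, the crude
        count of relations, and the sum over \<open>S\<close>.\<close>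
      also have "real (card (shifts L)) = real (L + 1) ^ card rays" by (simp add: card_PiE finite_rays)
      finally show ?thesis unfolding power_add mult_2 power_one_right by (simp only: mult_ac)
    qed
    then have "?lhs L T \<le> ?A L T + ?B a L T" for L T using A0[of T L] by (meson add_increasing)
    then show ?thesis using a(1) by blast
  qed
qed

end

section \<open>Summation over the dyadic boxes\<close>

lemma ln_ln_3_pos: "ln (ln 3) > (0::real)"
  using ln3_gt_1 by simp

lemma log_scales:
  fixes B :: real
  assumes B: "B \<ge> 3"
  shows ln_ge_1: "ln B \<ge> 1" and ln_ln_ge: "ln (ln B) \<ge> ln (ln 3)" and ln_ln_pos: "ln (ln B) > 0"
proof -
  have "ln B \<ge> ln 3" using B by simp
  then show "ln B \<ge> 1" "ln (ln B) \<ge> ln (ln 3)" using ln3_gt_1 by auto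
  then show "ln (ln B) > 0" using ln_ln_3_pos by linarith
qed

text \<open>\<open>L\<close> is the integral part of the binary logarithm of \<open>B\<close>, and
  \<open>T\<close> is the least integer with \<open>(ln B)\<^sup>2 \<le> 2 ^ T\<close>.\<close>

lemma dyadic_scales:
  fixes B :: real
  assumes B: "B \<ge> 3"
  obtains L T :: nat where "2 ^ L \<le> B" "B < 2 ^ (L + 1)" "ln B \<le> real (L + 1)" "real (L + 1) \<le> 3 * ln B"
    "(ln B)\<^sup>2 \<le> 2 ^ T" "2 ^ T \<le> 2 * (ln B)\<^sup>2" "real (T + 1) \<le> (3 + 2 / ln (ln 3)) * ln (ln B)"
proof -
  let ?l = "ln B"
  have l: "?l \<ge> 1" and ll: "ln ?l \<ge> ln (ln 3)" "ln ?l > 0" using log_scales[OF B] by auto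
  have "1 \<le> nat \<lfloor>B\<rfloor>" using B by linarith
  then have "\<exists>n. 2 ^ n \<le> nat \<lfloor>B\<rfloor> \<and> nat \<lfloor>B\<rfloor> < 2 ^ (n + 1)" by (intro ex_power_ivl1) auto
  then obtain L where L: "2 ^ L \<le> nat \<lfloor>B\<rfloor>" "nat \<lfloor>B\<rfloor> < 2 ^ (L + 1)" by blast
  have "real (2 ^ L) \<le> real (nat \<lfloor>B\<rfloor>)" using L(1) by (simp only: of_nat_le_iff)
  moreover have "real (nat \<lfloor>B\<rfloor>) \<le> B" using B by linarith
  ultimately have "real (2 ^ L) \<le> B" by (rule order.trans)
  then have L1: "2 ^ L \<le> B" by simp
  have "nat \<lfloor>B\<rfloor> + 1 \<le> 2 ^ (L + 1)" using L(2) by simp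
  then have "real (nat \<lfloor>B\<rfloor> + 1) \<le> real (2 ^ (L + 1))" by (simp only: of_nat_le_iff)
  moreover have "B < real (nat \<lfloor>B\<rfloor> + 1)" using B by linarith
  ultimately have "B < real (2 ^ (L + 1))" by linarith
  then have L2: "B < 2 ^ (L + 1)" by simp
  have "ln (2 ^ L) \<le> ?l" using L1 B by (subst ln_le_cancel_iff) auto
  then have "real L * ln 2 \<le> ?l" by (simp add: ln_realpow)
  moreover have "real L * (2 / 3) \<le> real L * ln 2" using ln2_ge_two_thirds by (intro mult_left_mono) auto
  ultimately have L3: "real (L + 1) \<le> 3 * ?l" using l by simp
  have "?l \<le> ln (2 ^ (L + 1))" using L2 B by (subst ln_le_cancel_iff) auto
  also have "\<dots> = real (L + 1) * ln 2" by (rule ln_realpow)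
  also have "\<dots> \<le> real (L + 1) * 1" using ln_2_less_1 by (intro mult_left_mono) auto
  finally have L4: "?l \<le> real (L + 1)" by simp
  define T where "T = nat \<lceil>2 * log 2 ?l\<rceil>"
  have lg: "log 2 ?l \<ge> 0" using l by simp
  have pw: "2 powr (2 * log 2 ?l) = ?l\<^sup>2"
  proof -
    have "2 powr (2 * log 2 ?l) = 2 powr (log 2 ?l * 2)" by (simp only: mult.commute)
    also have "\<dots> = (2 powr log 2 ?l) powr 2" by (rule powr_powr[symmetric])
    also have "\<dots> = ?l\<^sup>2" using l by simp
    finally show ?thesis .
  qed
  have "2 * log 2 ?l \<le> real T" unfolding T_def using lg by linarith
  then have "2 powr (2 * log 2 ?l) \<le> 2 powr real T" by simp
  then have T1: "?l\<^sup>2 \<le> 2 ^ T" by (simp add: pw powr_realpow)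
  have T': "real T \<le> 2 * log 2 ?l + 1" unfolding T_def using lg by linarith
  then have "2 powr real T \<le> 2 powr (2 * log 2 ?l + 1)" by simp
  then have T2: "2 ^ T \<le> 2 * ?l\<^sup>2" by (simp add: pw powr_realpow powr_add)
  have "log 2 ?l \<le> ln ?l / (2 / 3)"
    unfolding log_def using ll ln2_ge_two_thirds by (intro divide_left_mono) auto
  then have "real (T + 1) \<le> 3 * ln ?l + 2" using T' by simp
  \<comment> \<open>For \<open>B \<ge> 3\<close> the double logarithm is at least
    \<open>ln (ln 3) > 0\<close>, so it can absorb an additive constant.\<close>
  also have "2 \<le> 2 / ln (ln 3) * ln ?l" using ll ln_ln_3_pos by (simp add: field_simps)
  finally have T3: "real (T + 1) \<le> (3 + 2 / ln (ln 3)) * ln ?l" by (simp add: distrib_right)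
  show ?thesis by (rule that[OF L1 L2 L4 L3 T1 T2 T3])
qed

text \<open>The exponent may be negative, so the quotient \<open>x / l\<close>, which lies between
  \<open>1\<close> and \<open>3\<close>, is raised to the larger exponent \<open>m\<close>.\<close>

lemma powr_scale:
  fixes x l e m :: real
  assumes "l \<ge> 1" "l \<le> x" "x \<le> 3 * l" "e \<le> m" "m \<ge> 0"
  shows "x powr e \<le> 3 powr m * l powr e"
proof -
  have t: "1 \<le> x / l" "x / l \<le> 3" using assms by (auto simp: field_simps)
  have "x powr e = (x / l * l) powr e" using assms by simp
  also have "\<dots> = (x / l) powr e * l powr e" by (rule powr_mult)
  also have "(x / l) powr e \<le> (x / l) powr m" using t assms by (intro powr_mono) auto
  also have "(x / l) powr m \<le> 3 powr m" using t assms by (intro powr_mono2) auto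
  finally show ?thesis by (simp add: mult_right_mono)
qed

text \<open>From \<open>(1 + y / q) ^ q \<le> exp y\<close> with \<open>y = x / a\<close>; used to
  absorb powers of \<open>ln B\<close> into a power of \<open>B\<close>.\<close>

lemma power_le_exp:
  fixes x a :: real
  assumes "x \<ge> 0" "a > 0" "q > 0"
  shows "x ^ q \<le> (a * real q) ^ q * exp (x / a)"
proof -
  have "x / (a * real q) \<ge> 0" using assms by auto
  then have "(x / (a * real q)) ^ q \<le> (1 + x / a / real q) ^ q" using assms by (intro power_mono) auto
  also have "\<dots> \<le> exp (x / a)"
    using assms by (intro exp_ge_one_plus_x_over_n_power_n) (auto intro: order.trans[of _ 0])
  finally show ?thesis using assms by (simp add: power_divide field_simps)
qed

context toric_fan
begin

text \<open>The power-saving alternative is \<open>B\<close> to the exponent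
  \<open>1 - 1 / a\<close> times powers of \<open>ln B\<close>, which fits under the bound of the
  other alternative.\<close>

lemma strip_bound:
  assumes r0: "\<rho>0 \<in> rays"
  shows "\<exists>C\<ge>0. \<forall>B L T. B \<ge> 3 \<longrightarrow> 2 ^ L \<le> B \<longrightarrow> ln B \<le> real (L + 1) \<longrightarrow> real (L + 1) \<le> 3 * ln B \<longrightarrow>
      2 ^ T \<le> 2 * (ln B)\<^sup>2 \<longrightarrow> real (T + 1) \<le> (3 + 2 / ln (ln 3)) * ln (ln B) \<longrightarrow>
    (\<Sum>k\<in>{k \<in> exponents L. k \<rho>0 \<le> T}. 2 ^ size k) \<le>
      C * (B * ln B powr (real (pic_rank Fan) - 2) * ln (ln B))"
proof -
  obtain a where a: "a \<ge> 1" "\<And>L T. (\<Sum>k\<in>{k \<in> exponents L. k \<rho>0 \<le> T}. 2 ^ size k) \<le>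
    2 * 4 ^ card rays * real (T + 1) * 2 ^ L * real (L + 1) powr (real (pic_rank Fan) - 2) +
    2 ^ T * 2 powr (real L * (1 - 1 / real a)) * real (L + 1) ^ (2 * card rays + 1)"
    using sum_exponents_strip[OF r0] by blast
  let ?r = "real (pic_rank Fan)" and ?n = "card rays"
  define \<tau> :: real where "\<tau> = 3 + 2 / ln (ln 3)"
  \<comment> \<open>There are \<open>2 * ?n + 1\<close> logarithms from the strip and two from
    \<open>2 ^ T\<close>; one more leaves \<open>1 / ln B\<close>, which is at most
    \<open>(ln B) powr (r - 2)\<close> because r is at least 1.\<close>
  define q where "q = 2 * ?n + 4"
  define C1 where "C1 = 2 * 4 ^ ?n * \<tau> * 3 powr ?r"
  define C2 where "C2 = 2 * 3 ^ (2 * ?n + 1) * (real a * real q) ^ q / ln (ln 3)"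
  have tau: "\<tau> \<ge> 0" using ln_ln_3_pos by (simp add: \<tau>_def)
  have C0: "C1 \<ge> 0" "C2 \<ge> 0" using tau ln_ln_3_pos by (auto simp: C1_def C2_def)
  have "(\<Sum>k\<in>{k \<in> exponents L. k \<rho>0 \<le> T}. 2 ^ size k) \<le> (C1 + C2) * (B * ln B powr (?r - 2) * ln (ln B))"
    if B: "B \<ge> 3" and L: "2 ^ L \<le> B" "ln B \<le> real (L + 1)" "real (L + 1) \<le> 3 * ln B"
      and T: "2 ^ T \<le> 2 * (ln B)\<^sup>2" "real (T + 1) \<le> \<tau> * ln (ln B)" for B L T
  proof -
    let ?l = "ln B"
    have l: "?l \<ge> 1" and ll: "ln ?l \<ge> ln (ln 3)" "ln ?l > 0" using log_scales[OF B] by auto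
    have "real (L + 1) powr (?r - 2) \<le> 3 powr ?r * ?l powr (?r - 2)" using l L by (intro powr_scale) auto
    then have "(2 * 4 ^ ?n * real (T + 1)) * 2 ^ L * real (L + 1) powr (?r - 2) \<le>
      (2 * 4 ^ ?n * (\<tau> * ln ?l)) * B * (3 powr ?r * ?l powr (?r - 2))"
      using T(2) L(1) tau ll B by (intro mult_mono) auto
    also have "\<dots> = C1 * (B * ?l powr (?r - 2) * ln ?l)" by (simp add: C1_def mult_ac)
    finally have 1: "2 * 4 ^ ?n * real (T + 1) * 2 ^ L * real (L + 1) powr (?r - 2) \<le> C1 * (B * ?l powr (?r - 2) * ln ?l)" .
    have e: "2 powr (real L * (1 - 1 / real a)) \<le> B * exp (- (?l / real a))"
    proof -
      have "2 powr (real L * (1 - 1 / real a)) = (2 ^ L) powr (1 - 1 / real a)"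
        by (simp add: powr_powr flip: powr_realpow)
      also have "\<dots> \<le> B powr (1 - 1 / real a)" using L(1) a(1) by (intro powr_mono2) (auto simp: field_simps)
      also have "\<dots> = exp (?l + - (?l / real a))" using B by (simp add: powr_def algebra_simps)
      also have "\<dots> = B * exp (- (?l / real a))" using B by (simp only: exp_add) simp
      finally show ?thesis .
    qed
    have "?l ^ q * exp (- (?l / real a)) \<le> (real a * real q) ^ q"
    proof -
      have "?l ^ q \<le> (real a * real q) ^ q * exp (?l / real a)"
        using l a(1) by (intro power_le_exp) (auto simp: q_def)
      then show ?thesis by (simp add: exp_minus field_simps)
    qed
    then have qb: "exp (- (?l / real a)) * ?l ^ (2 * ?n + 3) \<le> (real a * real q) ^ q * ?l powr (-1)"
      using l by (simp add: q_def powr_minus field_simps power_add eval_nat_numeral)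
    also have "\<dots> \<le> (real a * real q) ^ q * (?l powr (?r - 2) * (ln ?l / ln (ln 3)))"
    proof (intro mult_left_mono)
      have "?l powr (-1) \<le> ?l powr (?r - 2)" using l pic_rank_pos by (intro powr_mono) auto
      moreover have "1 \<le> ln ?l / ln (ln 3)" using ll ln_ln_3_pos by (simp add: field_simps)
      ultimately show "?l powr (-1) \<le> ?l powr (?r - 2) * (ln ?l / ln (ln 3))"
        using mult_mono[of "?l powr (-1)" "?l powr (?r - 2)" 1 "ln ?l / ln (ln 3)"] by simp
    qed auto
    finally have q: "exp (- (?l / real a)) * ?l ^ (2 * ?n + 3) \<le>
      (real a * real q) ^ q * (?l powr (?r - 2) * (ln ?l / ln (ln 3)))" .
    have "2 ^ T * 2 powr (real L * (1 - 1 / real a)) * real (L + 1) ^ (2 * ?n + 1) \<le>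
      (2 * ?l\<^sup>2) * (B * exp (- (?l / real a))) * (3 * ?l) ^ (2 * ?n + 1)"
      using T(1) e L(3) B by (intro mult_mono power_mono) auto
    also have "\<dots> = 2 * 3 ^ (2 * ?n + 1) * B * (exp (- (?l / real a)) * ?l ^ (2 * ?n + 3))"
      by (simp only: power_mult_distrib power_add power2_eq_square power3_eq_cube power_one_right mult_ac)
    also have "\<dots> \<le> 2 * 3 ^ (2 * ?n + 1) * B * ((real a * real q) ^ q * (?l powr (?r - 2) * (ln ?l / ln (ln 3))))"
      using q B by (intro mult_left_mono) auto
    also have "\<dots> = C2 * (B * ?l powr (?r - 2) * ln ?l)" by (simp add: C2_def)
    finally have 2: "2 ^ T * 2 powr (real L * (1 - 1 / real a)) * real (L + 1) ^ (2 * ?n + 1) \<le> C2 * (B * ?l powr (?r - 2) * ln ?l)" .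
    show ?thesis using a(2)[where L = L and T = T] 1 2 by (simp add: distrib_right)
  qed
  then show ?thesis using C0 unfolding \<tau>_def by (intro exI[of _ "C1 + C2"]) auto
qed

text \<open>Rounding the coordinates down to powers of two does not increase the heights, as all
  exponents are nonnegative; then \<open>2 ^ D0 < 2 ^ (L + 1)\<close> bounds the exponent by
  \<open>L\<close>.\<close>

lemma count_set_cover:
  assumes L: "B < 2 ^ (L + 1)" and X: "X \<in> count_set Fan B"
  obtains k where "k \<in> exponents L" "X \<in> dyadic_box k rays"
proof -
  have X1: "X \<in> rays \<rightarrow>\<^sub>E {1..}" and XB: "\<And>\<sigma>. \<sigma> \<in> Fan \<Longrightarrow> real (heightD0 Fan X \<sigma>) \<le> B"
    using X by (auto simp: count_set_def)
  have "\<exists>j. X \<rho> \<in> dyadic j" if "\<rho> \<in> rays" for \<rho>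
    using ex_power_ivl1[of 2 "X \<rho>"] X1 that by (force simp: dyadic_def PiE_iff)
  then obtain j where j: "\<And>\<rho>. \<rho> \<in> rays \<Longrightarrow> X \<rho> \<in> dyadic (j \<rho>)" by metis
  define k where "k = restrict j rays"
  have kX: "2 ^ k \<rho> \<le> X \<rho>" if "\<rho> \<in> rays" for \<rho> using j[OF that] that by (simp add: k_def dyadic_def)
  have "D0 \<sigma> k \<le> int L" if s: "\<sigma> \<in> Fan" for \<sigma>
  proof -
    let ?m = "\<Sum>\<rho>\<in>rays. k \<rho> * nat (a_coef \<rho> \<sigma>)"
    have "2 ^ ?m = (\<Prod>\<rho>\<in>rays. (2 ^ k \<rho>) ^ nat (a_coef \<rho> \<sigma>))" by (simp add: power_sum power_mult)
    also have "\<dots> \<le> heightD0 Fan X \<sigma>" unfolding heightD0_def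
      using kX by (intro prod_mono) (auto intro: power_mono)
    finally have "real (2 ^ ?m) \<le> real (heightD0 Fan X \<sigma>)" by (simp only: of_nat_le_iff)
    also have "\<dots> < 2 ^ (L + 1)" using XB[OF s] L by linarith
    finally have "(2::real) ^ ?m < 2 ^ (L + 1)" by simp
    then have "?m < L + 1" by (subst (asm) power_strict_increasing_iff) auto
    moreover have "D0 \<sigma> k = int ?m"
      using a_nonneg[OF s] by (simp add: D0_def mult.commute cong: sum.cong)
    ultimately show ?thesis by linarith
  qed
  then have "k \<in> exponents L" by (simp add: exponents_def k_def)
  moreover have "X \<in> dyadic_box k rays" using X1 j by (auto simp: dyadic_box_def k_def PiE_iff)
  ultimately show ?thesis using that by blast
qed

lemma vol_rays: "vol k rays = 2 ^ size k"
  by (simp add: vol_def size_def power_sum)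

text \<open>All that is asked of \<open>P\<close> is a bound for thick boxes. Boxes with some side
  exponent at most \<open>T\<close> are counted in full by \<open>strip_bound\<close>.\<close>

theorem count_bad:
  fixes P :: "nat \<Rightarrow> (int^'n \<Rightarrow> nat) \<Rightarrow> bool"
  assumes C: "C \<ge> 0" "\<And>k T Y N. N \<ge> 2 \<Longrightarrow> Y \<ge> 3 \<Longrightarrow> (\<forall>v\<in>rays. T \<le> k v \<and> 2 ^ Suc (k v) \<le> Y) \<Longrightarrow>
    real (card {x \<in> dyadic_box k rays. P N x}) \<le> C * vol k rays * (1 / (real N * ln (real N)) + ln Y / 2 ^ T)"
  shows "\<exists>C>0. \<forall>B::real. \<forall>N::nat. B \<ge> 3 \<longrightarrow> N \<ge> 2 \<longrightarrow>
     real (card {X \<in> count_set Fan B. P N X})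
     \<le> C * (B * ln B powr (real (pic_rank Fan) - 1) / (real N * ln (real N))
            + B * ln B powr (real (pic_rank Fan) - 2) * ln (ln B))"
proof -
  let ?r = "real (pic_rank Fan)" and ?n = "card rays"
  let ?Q = "\<lambda>\<rho> C. C \<ge> 0 \<and> (\<forall>B L T. B \<ge> 3 \<longrightarrow> 2 ^ L \<le> B \<longrightarrow> ln B \<le> real (L + 1) \<longrightarrow> real (L + 1) \<le> 3 * ln B \<longrightarrow>
      2 ^ T \<le> 2 * (ln B)\<^sup>2 \<longrightarrow> real (T + 1) \<le> (3 + 2 / ln (ln 3)) * ln (ln B) \<longrightarrow>
    (\<Sum>k\<in>{k \<in> exponents L. k \<rho> \<le> T}. 2 ^ size k) \<le> C * (B * ln B powr (?r - 2) * ln (ln B)))"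
  have "\<forall>\<rho>\<in>rays. \<exists>C. ?Q \<rho> C" by (intro ballI strip_bound)
  from bchoice[OF this] obtain S where Q: "\<forall>\<rho>\<in>rays. ?Q \<rho> (S \<rho>)" by (rule exE)
  have S: "S \<rho> \<ge> 0"
    "\<And>B L T. B \<ge> 3 \<Longrightarrow> 2 ^ L \<le> B \<Longrightarrow> ln B \<le> real (L + 1) \<Longrightarrow> real (L + 1) \<le> 3 * ln B \<Longrightarrow>
      2 ^ T \<le> 2 * (ln B)\<^sup>2 \<Longrightarrow> real (T + 1) \<le> (3 + 2 / ln (ln 3)) * ln (ln B) \<Longrightarrow>
    (\<Sum>k\<in>{k \<in> exponents L. k \<rho> \<le> T}. 2 ^ size k) \<le> S \<rho> * (B * ln B powr (?r - 2) * ln (ln B))"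
    if "\<rho> \<in> rays" for \<rho>
    using bspec[OF Q that] by blast+
  \<comment> \<open>The constant of \<open>sum_exponents\<close>, with \<open>L + 1\<close> replaced
    by \<open>3 * ln B\<close>.\<close>
  define A where "A = 2 * 4 ^ ?n * 3 powr ?r"
  define K where "K = 1 + (\<Sum>\<rho>\<in>rays. S \<rho>) + C * A + C * A * (2 / ln (ln 3))"
  have A0: "A \<ge> 0" by (simp add: A_def)
  have S0: "(\<Sum>\<rho>\<in>rays. S \<rho>) \<ge> 0" using S(1) by (rule sum_nonneg)
  have CA: "C * A \<ge> 0" "C * A * (2 / ln (ln 3)) \<ge> 0" using C(1) A0 ln_ln_3_pos by auto
  have K0: "K > 0" using S0 CA by (simp add: K_def)
  have "real (card {X \<in> count_set Fan B. P N X}) \<le>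
    K * (B * ln B powr (?r - 1) / (real N * ln (real N)) + B * ln B powr (?r - 2) * ln (ln B))"
    if B: "B \<ge> 3" and N: "N \<ge> 2" for B N
  proof -
    let ?l = "ln B"
    have l: "?l \<ge> 1" and ll: "ln ?l \<ge> ln (ln 3)" "ln ?l > 0" using log_scales[OF B] by auto
    obtain L T where LT: "2 ^ L \<le> B" "B < 2 ^ (L + 1)" "ln B \<le> real (L + 1)" "real (L + 1) \<le> 3 * ln B"
      "(ln B)\<^sup>2 \<le> 2 ^ T" "2 ^ T \<le> 2 * (ln B)\<^sup>2" "real (T + 1) \<le> (3 + 2 / ln (ln 3)) * ln (ln B)"
      using dyadic_scales[OF B] .
    let ?E1 = "B * ?l powr (?r - 1) / (real N * ln (real N))"
    let ?E2 = "B * ?l powr (?r - 2) * ln ?l"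
    have lnN: "ln (real N) > 0" using N by simp
    have E0: "?E1 \<ge> 0" "?E2 \<ge> 0" using B ll lnN by auto
    let ?thin = "\<lambda>\<rho>. {k \<in> exponents L. k \<rho> \<le> T}"
    let ?thick = "{k \<in> exponents L. \<forall>\<rho>\<in>rays. T \<le> k \<rho>}"
    let ?bad = "\<lambda>k. {x \<in> dyadic_box k rays. P N x}"
    have finbox: "finite (dyadic_box k rays)" for k by (rule finite_dyadic_box[OF finite_rays])
    have finthin: "finite (?thin \<rho>)" "finite ?thick" for \<rho> using finite_exponents by auto
    let ?U = "\<Union>\<rho>\<in>rays. \<Union>k\<in>?thin \<rho>. dyadic_box k rays" and ?W = "\<Union>k\<in>?thick. ?bad k"
    have "{X \<in> count_set Fan B. P N X} \<subseteq> ?U \<union> ?W"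
    proof
      fix X assume X: "X \<in> {X \<in> count_set Fan B. P N X}"
      then obtain k where k: "k \<in> exponents L" "X \<in> dyadic_box k rays" using count_set_cover[OF LT(2)] by blast
      show "X \<in> ?U \<union> ?W"
      proof (cases "\<forall>\<rho>\<in>rays. T \<le> k \<rho>")
        case True
        then show ?thesis using k X by blast
      next
        case False
        then obtain \<rho> where "\<rho> \<in> rays" "k \<rho> \<le> T" by (meson nat_le_linear)
        then show ?thesis using k by blast
      qed
    qed
    then have "card {X \<in> count_set Fan B. P N X} \<le> card (?U \<union> ?W)"
      by (intro card_mono) (auto simp: finbox finthin finite_rays)
    also have "\<dots> \<le> card ?U + card ?W" by (rule card_Un_le)
    also have "card ?U \<le> (\<Sum>\<rho>\<in>rays. card (\<Union>k\<in>?thin \<rho>. dyadic_box k rays))"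
      by (rule card_UN_le[OF finite_rays])
    also have "\<dots> \<le> (\<Sum>\<rho>\<in>rays. \<Sum>k\<in>?thin \<rho>. card (dyadic_box k rays))"
      by (intro sum_mono card_UN_le finthin)
    also have "card ?W \<le> (\<Sum>k\<in>?thick. card (?bad k))" by (rule card_UN_le[OF finthin(2)])
    finally have "real (card {X \<in> count_set Fan B. P N X}) \<le>
      (\<Sum>\<rho>\<in>rays. \<Sum>k\<in>?thin \<rho>. real (card (dyadic_box k rays))) + (\<Sum>k\<in>?thick. real (card (?bad k)))"
      by (simp flip: of_nat_sum of_nat_add)
    also have "(\<Sum>\<rho>\<in>rays. \<Sum>k\<in>?thin \<rho>. real (card (dyadic_box k rays))) = (\<Sum>\<rho>\<in>rays. \<Sum>k\<in>?thin \<rho>. 2 ^ size k)"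
      by (simp only: card_dyadic_box[OF finite_rays] vol_rays)
    also have "\<dots> \<le> (\<Sum>\<rho>\<in>rays. S \<rho> * ?E2)"
      using LT by (intro sum_mono S(2) B) auto
    also have "\<dots> = (\<Sum>\<rho>\<in>rays. S \<rho>) * ?E2" by (simp add: sum_distrib_right)
    also have "(\<Sum>k\<in>?thick. real (card (?bad k))) \<le>
      (\<Sum>k\<in>?thick. C * (1 / (real N * ln (real N)) + ln (2 * B) / 2 ^ T) * 2 ^ size k)"
    proof (rule sum_mono)
      fix k assume k: "k \<in> ?thick"
      \<comment> \<open>A corner has \<open>k \<rho> \<le> L\<close>, so its box has all coordinates
        below \<open>2 * B\<close>; this is the value given to \<open>Y\<close>.\<close>
      have "2 ^ Suc (k \<rho>) \<le> 2 * B" if "\<rho> \<in> rays" for \<rho>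
      proof -
        have "(2::real) ^ k \<rho> \<le> 2 ^ L" using k exponents_le[of k L \<rho>] that by (intro power_increasing) auto
        from order.trans[OF this LT(1)] show ?thesis by simp
      qed
      then show "real (card (?bad k)) \<le> C * (1 / (real N * ln (real N)) + ln (2 * B) / 2 ^ T) * 2 ^ size k"
        using C(2)[of N "2 * B" T k] k N B by (simp add: vol_rays mult_ac)
    qed
    also have "\<dots> = C * (1 / (real N * ln (real N)) + ln (2 * B) / 2 ^ T) * (\<Sum>k\<in>?thick. 2 ^ size k)"
      by (simp add: sum_distrib_left)
    also have "\<dots> \<le> C * (1 / (real N * ln (real N)) + 2 / ?l) * (A * B * ?l powr (?r - 1))"
    proof (intro mult_mono)
      \<comment> \<open>Here the choice of \<open>T\<close> pays off: the large primes cost only a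
        proportion \<open>2 / ln B\<close>.\<close>
      have "ln (2 * B) \<le> 2 * ?l" using B ln_2_less_1 l by (simp add: ln_mult)
      then have "ln (2 * B) / 2 ^ T \<le> (2 * ?l) / ?l\<^sup>2" using LT(5) l by (intro frac_le) auto
      also have "\<dots> = 2 / ?l" by (simp add: power2_eq_square)
      finally show "1 / (real N * ln (real N)) + ln (2 * B) / 2 ^ T \<le> 1 / (real N * ln (real N)) + 2 / ?l" by simp
      have "(\<Sum>k\<in>?thick. (2::real) ^ size k) \<le> (\<Sum>k\<in>exponents L. 2 ^ size k)"
        by (intro sum_mono2 finite_exponents) auto
      also have "\<dots> \<le> 2 * 4 ^ ?n * 2 ^ L * real (L + 1) ^ (pic_rank Fan - 1)" by (rule sum_exponents)
      also have "real (L + 1) ^ (pic_rank Fan - 1) = real (L + 1) powr (?r - 1)"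
        using pic_rank_pos by (subst powr_realpow[symmetric]) (auto simp: of_nat_diff)
      also have "2 * 4 ^ ?n * 2 ^ L * real (L + 1) powr (?r - 1) \<le> 2 * 4 ^ ?n * B * (3 powr ?r * ?l powr (?r - 1))"
        using LT l B by (intro mult_mono powr_scale) auto
      also have "\<dots> = A * B * ?l powr (?r - 1)" by (simp add: A_def)
      finally show "(\<Sum>k\<in>?thick. 2 ^ size k) \<le> A * B * ?l powr (?r - 1)" .
    qed (use C(1) l lnN B in \<open>auto intro!: sum_nonneg mult_nonneg_nonneg add_nonneg_nonneg\<close>)
    also have "\<dots> = C * A * ?E1 + C * A * (B * (?l powr (?r - 1) * (2 / ?l)))"
      by (simp add: algebra_simps)
    also have "?l powr (?r - 1) * (2 / ?l) = 2 * ?l powr (?r - 2)"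
      using l by (simp add: powr_diff power2_eq_square)
    also have "C * A * (B * (2 * ?l powr (?r - 2))) \<le> C * A * (2 / ln (ln 3)) * ?E2"
    proof -
      \<comment> \<open>The sieve error carries no double logarithm; one is inserted so that it
        merges with the strips.\<close>
      have "1 \<le> ln ?l / ln (ln 3)" using ll ln_ln_3_pos by (simp add: field_simps)
      then have "C * A * (B * (2 * ?l powr (?r - 2))) * 1 \<le> C * A * (B * (2 * ?l powr (?r - 2))) * (ln ?l / ln (ln 3))"
        using CA B by (intro mult_left_mono) auto
      then show ?thesis by (simp add: mult_ac)
    qed
    finally have "real (card {X \<in> count_set Fan B. P N X}) \<le>
      (\<Sum>\<rho>\<in>rays. S \<rho>) * ?E2 + (C * A * ?E1 + C * A * (2 / ln (ln 3)) * ?E2)" by simp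
    also have "\<dots> \<le> K * ?E2 + K * ?E1 - (1 + C * A) * ?E2"
    proof -
      have "C * A * ?E1 \<le> K * ?E1" using S0 CA E0 by (intro mult_right_mono) (auto simp: K_def)
      then show ?thesis by (simp add: K_def algebra_simps)
    qed
    also have "\<dots> \<le> K * (?E1 + ?E2)"
    proof -
      have "(1 + C * A) * ?E2 \<ge> 0" using CA E0(2) by (intro mult_nonneg_nonneg[of "1 + C * A" ?E2]) linarith+
      then show ?thesis by (simp add: algebra_simps)
    qed
    finally show ?thesis .
  qed
  then show ?thesis using K0 by blast
qed

end

theorem theorem8p1:
  fixes Fan :: "(int^'n) set set"
    and f g :: "(int^'n, int) mpoly"
  assumes "complete_regular_fan Fan"
    and "projective_fan Fan"
    and "\<forall>\<sigma>\<in>Fan. \<forall>\<rho>\<in>fan_rays Fan. a_coef \<rho> \<sigma> \<ge> 0"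
    and "mvars f \<subseteq> fan_rays Fan" and "mvars g \<subseteq> fan_rays Fan"
    and "coprime_Q f g"
  shows "\<exists>C>0. \<forall>B::real. \<forall>N::nat. B \<ge> 3 \<longrightarrow> N \<ge> 2 \<longrightarrow>
     real (card {X \<in> count_set Fan B. \<exists>p::nat. prime p \<and> p \<ge> N \<and>
                int p dvd meval f (\<lambda>\<rho>. int (X \<rho>)) \<and> int p dvd meval g (\<lambda>\<rho>. int (X \<rho>))})
     \<le> C * (B * ln B powr (real (pic_rank Fan) - 1) / (real N * ln (real N))
            + B * ln B powr (real (pic_rank Fan) - 2) * ln (ln B))"
proof -
  interpret toric_fan Fan using assms(1,3) by unfold_locales auto
  obtain vs where vs: "set vs = rays" "distinct vs" using finite_distinct_list[OF finite_rays] by blast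
  have "codim2 vs {f, g}" using assms vs by (intro coprime_imp_codim2) auto
  from codim2_count[OF this vs(2)] obtain C where C: "C \<ge> 0"
    "\<And>k T Y N. N \<ge> 2 \<Longrightarrow> Y \<ge> 3 \<Longrightarrow> (\<forall>v\<in>rays. T \<le> k v \<and> 2 ^ Suc (k v) \<le> Y) \<Longrightarrow>
    real (card {x \<in> dyadic_box k rays. \<exists>p\<ge>N. prime p \<and> (\<forall>h\<in>{f, g}. int p dvd val x h)})
      \<le> C * vol k rays * (1 / (real N * ln (real N)) + ln Y / 2 ^ T)"
    unfolding vs(1) by blast
  have eq: "(\<exists>p\<ge>N. prime p \<and> (\<forall>h\<in>{f, g}. int p dvd val x h)) \<longleftrightarrow>
    (\<exists>p. prime p \<and> p \<ge> N \<and> int p dvd meval f (\<lambda>\<rho>. int (x \<rho>)) \<and> int p dvd meval g (\<lambda>\<rho>. int (x \<rho>)))" for N and x :: "int^'n \<Rightarrow> nat"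
    by (auto simp: meval_eq)
  show ?thesis using count_bad[OF C] unfolding eq .
qed

end
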